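(* Consider the stationary hidden Markov model $(P,\pi,\Phi)$ with law $\mathbf{P}$, and the associated kernels $P^X$, $\mu$, measure $\mathbf{P}^Y$ and quenched laws $\mathbf{P}_{z,y}$ of the conditional signal (see context). Suppose that: (Ergodicity) $\|\mathbf{P}^z(X_n\in\cdot)-\pi\|_{\mathrm{TV}}\to0$ as $n\to\infty$ for $\pi$-a.e. $z\in E$; (Nondegeneracy) there exist a probability measure $\varphi$ on $\mathcal{B}(F)$ and a strictly positive measurable function $g:E\times F\to]0,\infty[$ such that $\Phi(z,A)=\int I_A(u)g(z,u)\varphi(du)$ for all $A\in\mathcal{B}(F)$, $z\in E$. Then any (hence all) of the following three equivalent conditions hold true: 1. $\|\mathbf{P}_{z,y}(X_n \in \cdot) - \mathbf{P}_{z',y}(X_n \in \cdot)\|_{\mathrm{TV}} \to 0$ as $n\to\infty$ for $(\mu\otimes\mu)\mathbf{P}^Y$-a.e. $(z,z',y)$. 2. There is a fixed set $H$ of $(\mu\otimes\mu)\mathbf{P}^Y$-full measure such that $\mathbf{P}_{z,y}(A) = \mathbf{P}_{z,y}(A)^2 = \mathbf{P}_{z',y}(A)$ for all $A\in\mathcal{T}^X=\bigcap_{n\ge0}\mathcal{F}^X_{[n,\infty[}$ and $(z,z',y)\in H$. 3. For $(\mu\otimes\mu)\mathbf{P}^Y$-a.e. $(z,z',y)$, there is an $n\in\mathbb{N}$ such that $\mathbf{P}_{z,y}(X_n\in\cdot)$ and $\mathbf{P}_{z',y}(X_n\in\cdot)$ are not mutually singular.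
   Context: Let $E,F$ be Polish spaces, $\Omega=\Omega^X\times\Omega^Y$, $\Omega^X=E^{\mathbb{Z}}$, $\Omega^Y=F^{\mathbb{Z}}$, with coordinate processes $X_n(x,y)=x(n)$, $Y_n(x,y)=y(n)$, $Y=(Y_k)_{k\in\mathbb{Z}}$, and shift $\Theta$, $(\Theta(x,y))(m)=(x(m+1),y(m+1))$ (the same symbol denotes the shift on $\Omega^Y$). For $I\subset\mathbb{Z}$, $\mathcal{F}^X_I=\sigma\{X_k:k\in I\}$, $\mathcal{F}^Y_I=\sigma\{Y_k:k\in I\}$; $\mathcal{F}^X_n=\mathcal{F}^X_{]-\infty,n]}$, $\mathcal{F}^Y=\mathcal{F}^Y_{\mathbb{Z}}$. Hidden Markov model: $P:E\times\mathcal{B}(E)\to[0,1]$ is a probability kernel, $\pi$ a probability measure on $E$ with $\int P(z,A)\pi(dz)=\pi(A)$ for all $A$, and $\Phi:E\times\mathcal{B}(F)\to[0,1]$ a probability kernel. $\mathbf{P}$ is the law on $\Omega$ under which $(X_n)_{n\in\mathbb{Z}}$ is the stationary Markov chain with transition kernel $P$ and stationary law $\pi$ and, conditionally on $(X_n)_{n\in\mathbb{Z}}$, the $Y_n$ are independent with $Y_n\sim\Phi(X_n,\cdot)$. $\mathbf{P}^z$ is the law of $(X_n,Y_n)_{n\ge0}$ for the same model with $X_0=z$. Conditional signal: $\mathbf{P}^Y=\mathbf{P}|_{\mathcal{F}^Y}$ is regarded as a probability measure on $\Omega^Y$. Probability kernels $P^X:E\times\Omega^Y\times\mathcal{B}(E)\to[0,1]$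 and $\mu:\Omega^Y\times\mathcal{B}(E)\to[0,1]$ are fixed (such kernels exist) such that $\int P^X(z,y,A)\mu(y,dz)=\mu(\Theta y,A)$ for all $y,A$, and, for every $A\in\mathcal{B}(E)$ and $n\in\mathbb{Z}$, $P^X(X_n,Y\circ\Theta^n,A)=\mathbf{P}(X_{n+1}\in A|\mathcal{F}^X_n\vee\mathcal{F}^Y)$ and $\mu(Y\circ\Theta^n,A)=\mathbf{P}(X_n\in A|\mathcal{F}^Y)$ $\mathbf{P}$-a.s. $\mathbf{P}_{z,y}$ is the law on $\mathcal{F}^X_{[0,\infty[}$ of the time-inhomogeneous Markov chain $(X_n)_{n\ge0}$ with $X_0=z$ and transition law of $X_{n+1}$ given $X_n$ equal to $P^X(X_n,\Theta^ny,\cdot)$. $(\mu\otimes\mu)\mathbf{P}^Y$ is the measure $A\mapsto\int I_A(z,z',y)\mu(y,dz)\mu(y,dz')\mathbf{P}^Y(dy)$. $\|\rho\|_{\mathrm{TV}}=\sup_{\|f\|_\infty\le1}|\int f\,d\rho|$. *)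

theory Defs
  imports "HOL-Probability.Probability"
begin

abbreviation path_space :: "(int \<Rightarrow> 'a::polish_space) measure" where
  "path_space \<equiv> PiM UNIV (\<lambda>_. borel)"

abbreviation Omega :: "((int \<Rightarrow> 'e::polish_space) \<times> (int \<Rightarrow> 'f::polish_space)) measure" where
  "Omega \<equiv> path_space \<Otimes>\<^sub>M path_space"

definition X_at :: "int \<Rightarrow> (int \<Rightarrow> 'e) \<times> (int \<Rightarrow> 'f) \<Rightarrow> 'e" where
  "X_at n \<omega> = fst \<omega> n"

definition Y_at :: "int \<Rightarrow> (int \<Rightarrow> 'e) \<times> (int \<Rightarrow> 'f) \<Rightarrow> 'f" where
  "Y_at n \<omega> = snd \<omega> n"

definition Y_path :: "(int \<Rightarrow> 'e) \<times> (int \<Rightarrow> 'f) \<Rightarrow> int \<Rightarrow> 'f" where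
  "Y_path \<omega> = (\<lambda>k. Y_at k \<omega>)"

text \<open>The shift is invertible, so its iterates are indexed by all integers \<open>n\<close>:
  \<open>shift_path n\<close> and \<open>Theta n\<close> are the \<open>n\<close>-th powers of the shift on single paths
  and on pairs of paths.\<close>

definition shift_path :: "int \<Rightarrow> (int \<Rightarrow> 'a) \<Rightarrow> int \<Rightarrow> 'a" where
  "shift_path n y = (\<lambda>m. y (m + n))"

definition Theta :: "int \<Rightarrow> (int \<Rightarrow> 'e) \<times> (int \<Rightarrow> 'f) \<Rightarrow> (int \<Rightarrow> 'e) \<times> (int \<Rightarrow> 'f)" where
  "Theta n \<omega> = (shift_path n (fst \<omega>), shift_path n (snd \<omega>))"

lemma shift_path_0: "shift_path 0 y = y"
  by (simp add: shift_path_def)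

lemma shift_path_add: "shift_path m (shift_path n y) = shift_path (m + n) y"
  by (simp add: shift_path_def ac_simps)

lemma shift_path_int: "shift_path (int n) = (shift_path 1 :: (int \<Rightarrow> 'a) \<Rightarrow> int \<Rightarrow> 'a) ^^ n"
proof (induction n)
  case (Suc n)
  have "shift_path (int (Suc n)) y = shift_path 1 (shift_path (int n) y)" for y :: "int \<Rightarrow> 'a"
    by (simp add: shift_path_add)
  then show ?case
    using Suc by (simp add: fun_eq_iff)
qed (simp add: fun_eq_iff shift_path_0)

lemma Y_path_Theta: "Y_path (Theta n \<omega>) = shift_path n (Y_path \<omega>)"
  by (simp add: Y_path_def Y_at_def Theta_def shift_path_def)

definition FX :: "int set \<Rightarrow> ((int \<Rightarrow> 'e::polish_space) \<times> (int \<Rightarrow> 'f::polish_space)) measure" where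
  "FX I = sigma UNIV {X_at k -` A | k A. k \<in> I \<and> A \<in> sets borel}"

definition FY :: "int set \<Rightarrow> ((int \<Rightarrow> 'e::polish_space) \<times> (int \<Rightarrow> 'f::polish_space)) measure" where
  "FY I = sigma UNIV {Y_at k -` B | k B. k \<in> I \<and> B \<in> sets borel}"

definition sigma_join :: "'a measure \<Rightarrow> 'a measure \<Rightarrow> 'a measure" where
  "sigma_join F G = sigma (space F \<union> space G) (sets F \<union> sets G)"

definition tail_X :: "((int \<Rightarrow> 'e::polish_space) \<times> (int \<Rightarrow> 'f::polish_space)) set set" where
  "tail_X = (\<Inter>n::nat. sets (FX {int n..}))"

text \<open>\<open>tv_dist M N\<close> is the total variation norm of the signed measure \<open>M - N\<close>, normalised as
  the supremum over test functions bounded by 1 (so it takes values in \<open>[0, 2]\<close> for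
  probability measures). It is meant for finite measures on the same sigma-algebra.\<close>

definition tv_dist :: "'a measure \<Rightarrow> 'a measure \<Rightarrow> real" where
  "tv_dist M N = (SUP f\<in>{f \<in> borel_measurable M. \<forall>x\<in>space M. \<bar>f x\<bar> \<le> 1}.
     \<bar>(\<integral>x. f x \<partial>M) - (\<integral>x. f x \<partial>N)\<bar>)"

definition mutually_singular :: "'a measure \<Rightarrow> 'a measure \<Rightarrow> bool" where
  "mutually_singular M N \<longleftrightarrow>
     (\<exists>A\<in>sets M. emeasure M A = 0 \<and> emeasure N (space M - A) = 0)"

abbreviation cprob :: "'a measure \<Rightarrow> 'a measure \<Rightarrow> 'a set \<Rightarrow> 'a \<Rightarrow> real" where
  "cprob M F A \<equiv> real_cond_exp M F (indicat_real A)"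

definition invariant_law :: "('e::polish_space \<Rightarrow> 'e measure) \<Rightarrow> 'e measure \<Rightarrow> bool" where
  "invariant_law P \<pi> \<longleftrightarrow> (\<forall>A\<in>sets borel. (\<integral>z. measure (P z) A \<partial>\<pi>) = measure \<pi> A)"

text \<open>The conditions below determine the measure: the first two conditions on \<open>X\<close> fix the law
  of the signal, and the last one is conditional independence of the observations given the
  whole signal, with \<open>Y_at j\<close> distributed according to \<open>\<Phi> (X_at j)\<close>.\<close>

definition stationary_hmm_law ::
  "('e::polish_space \<Rightarrow> 'e measure) \<Rightarrow> 'e measure \<Rightarrow> ('e \<Rightarrow> 'f::polish_space measure)
   \<Rightarrow> ((int \<Rightarrow> 'e) \<times> (int \<Rightarrow> 'f)) measure \<Rightarrow> bool" where
  "stationary_hmm_law P \<pi> \<Phi> \<P> \<longleftrightarrow>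
     \<P> \<in> space (prob_algebra Omega) \<and>
     (\<forall>n. distr \<P> borel (X_at n) = \<pi>) \<and>
     (\<forall>n. \<forall>A\<in>sets borel. AE \<omega> in \<P>.
        cprob \<P> (FX {..n}) (X_at (n + 1) -` A) \<omega> = measure (P (X_at n \<omega>)) A) \<and>
     (\<forall>J B. finite J \<and> (\<forall>j\<in>J. B j \<in> sets borel) \<longrightarrow>
        (AE \<omega> in \<P>. cprob \<P> (FX UNIV) (\<Inter>j\<in>J. Y_at j -` B j) \<omega>
           = (\<Prod>j\<in>J. measure (\<Phi> (X_at j \<omega>)) (B j))))"

text \<open>The law of a time-inhomogeneous Markov chain started at \<open>z\<close>, where \<open>K n\<close> is the transition
  kernel from time \<open>n\<close> to time \<open>n + 1\<close>, given by the Ionescu-Tulcea theorem.\<close>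

definition markov_step ::
  "'a::polish_space \<Rightarrow> (nat \<Rightarrow> 'a \<Rightarrow> 'a measure) \<Rightarrow> nat \<Rightarrow> (nat \<Rightarrow> 'a) \<Rightarrow> 'a measure" where
  "markov_step z K i x = (case i of 0 \<Rightarrow> return borel z | Suc n \<Rightarrow> K n (x n))"

definition markov_chain ::
  "'a::polish_space \<Rightarrow> (nat \<Rightarrow> 'a \<Rightarrow> 'a measure) \<Rightarrow> (nat \<Rightarrow> 'a) measure" where
  "markov_chain z K =
     projective_family.lim UNIV (Ionescu_Tulcea.CI (markov_step z K) (\<lambda>_. borel)) (\<lambda>_. borel)"

text \<open>The law of \<open>(X_at n, Y_at n)\<close>, \<open>n \<ge> 0\<close>, given \<open>X_at 0 = z\<close> lives on the sigma-algebra generated by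
  these variables. One-sided paths are extended to negative times in an
  arbitrary way, which this sigma-algebra does not see.\<close>

definition hmm_law_from ::
  "('e::polish_space \<Rightarrow> 'e measure) \<Rightarrow> ('e \<Rightarrow> 'f::polish_space measure)
   \<Rightarrow> 'e \<Rightarrow> ((int \<Rightarrow> 'e) \<times> (int \<Rightarrow> 'f)) measure" where
  "hmm_law_from P \<Phi> z =
     markov_chain z (\<lambda>_. P) \<bind>
       (\<lambda>x. distr (PiM UNIV (\<lambda>n. \<Phi> (x n))) (sigma_join (FX {0..}) (FY {0..}))
          (\<lambda>u. (\<lambda>k. x (nat k), \<lambda>k. u (nat k))))"

definition ergodic ::
  "('e::polish_space \<Rightarrow> 'e measure) \<Rightarrow> 'e measure \<Rightarrow> ('e \<Rightarrow> 'f::polish_space measure) \<Rightarrow> bool" where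
  "ergodic P \<pi> \<Phi> \<longleftrightarrow>
     (AE z in \<pi>. (\<lambda>n. tv_dist (distr (hmm_law_from P \<Phi> z) borel (X_at (int n))) \<pi>) \<longlonglongrightarrow> 0)"

definition nondegenerate :: "('e::polish_space \<Rightarrow> 'f::polish_space measure) \<Rightarrow> bool" where
  "nondegenerate \<Phi> \<longleftrightarrow>
     (\<exists>\<phi>\<in>space (prob_algebra borel). \<exists>g\<in>borel_measurable (borel \<Otimes>\<^sub>M borel).
        (\<forall>z u. (0::real) < g (z, u)) \<and>
        (\<forall>z. \<forall>A\<in>sets borel. emeasure (\<Phi> z) A = (\<integral>\<^sup>+u. indicator A u * ennreal (g (z, u)) \<partial>\<phi>)))"

definition conditional_signal ::
  "((int \<Rightarrow> 'e::polish_space) \<times> (int \<Rightarrow> 'f::polish_space)) measure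
   \<Rightarrow> ('e \<Rightarrow> (int \<Rightarrow> 'f) \<Rightarrow> 'e measure) \<Rightarrow> ((int \<Rightarrow> 'f) \<Rightarrow> 'e measure) \<Rightarrow> bool" where
  "conditional_signal \<P> PX \<mu> \<longleftrightarrow>
     (\<lambda>(z, y). PX z y) \<in> borel \<Otimes>\<^sub>M path_space \<rightarrow>\<^sub>M prob_algebra borel \<and>
     \<mu> \<in> path_space \<rightarrow>\<^sub>M prob_algebra borel \<and>
     (\<forall>y. \<forall>A\<in>sets borel. (\<integral>z. measure (PX z y) A \<partial>\<mu> y) = measure (\<mu> (shift_path 1 y)) A) \<and>
     (\<forall>n. \<forall>A\<in>sets borel. AE \<omega> in \<P>.
        measure (PX (X_at n \<omega>) (Y_path (Theta n \<omega>))) A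
          = cprob \<P> (sigma_join (FX {..n}) (FY UNIV)) (X_at (n + 1) -` A) \<omega>) \<and>
     (\<forall>n. \<forall>A\<in>sets borel. AE \<omega> in \<P>.
        measure (\<mu> (Y_path (Theta n \<omega>))) A = cprob \<P> (FY UNIV) (X_at n -` A) \<omega>)"

definition obs_law ::
  "((int \<Rightarrow> 'e::polish_space) \<times> (int \<Rightarrow> 'f::polish_space)) measure \<Rightarrow> (int \<Rightarrow> 'f) measure" where
  "obs_law \<P> = distr \<P> path_space Y_path"

text \<open>The quenched law of the conditional signal, as a measure on the sigma-algebra generated by
  \<open>X_at n\<close>, \<open>n \<ge> 0\<close>. The \<open>X\<close>-coordinates at negative times and the \<open>Y\<close>-coordinates of the paths in the
  image are irrelevant for this sigma-algebra.\<close>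

definition quenched_law ::
  "('e::polish_space \<Rightarrow> (int \<Rightarrow> 'f::polish_space) \<Rightarrow> 'e measure)
   \<Rightarrow> 'e \<Rightarrow> (int \<Rightarrow> 'f) \<Rightarrow> ((int \<Rightarrow> 'e) \<times> (int \<Rightarrow> 'f)) measure" where
  "quenched_law PX z y =
     distr (markov_chain z (\<lambda>n x. PX x (shift_path (int n) y))) (FX {0..}) (\<lambda>x. (\<lambda>k. x (nat k), y))"

text \<open>The measure \<open>(\<mu> \<otimes> \<mu>) P\<^sup>Y\<close>, with \<open>Q\<close> in the role of \<open>P\<^sup>Y\<close>.\<close>

definition coupled_law ::
  "((int \<Rightarrow> 'f::polish_space) \<Rightarrow> 'e::polish_space measure) \<Rightarrow> (int \<Rightarrow> 'f) measure
   \<Rightarrow> ('e \<times> 'e \<times> (int \<Rightarrow> 'f)) measure" where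
  "coupled_law \<mu> Q =
     Q \<bind> (\<lambda>y. \<mu> y \<bind> (\<lambda>z'. \<mu> y \<bind> (\<lambda>z. return (borel \<Otimes>\<^sub>M borel \<Otimes>\<^sub>M path_space) (z, z', y))))"

end

(*
  The limit D(z, z', y) of the total variation distance between the quenched laws of X_n started at z and z'
  is a bounded function that can only grow on average along two independent conditional signals in the same
  environment. The law of the pair and its environment is stationary, so D is constant along almost every
  path. If the two quenched laws overlap at some time, an optimal coupling places a positive mass on the
  diagonal, where D = 0, and the remaining mass on pairs where D has its initial value; hence D = 0. Tail events are
  trivial because their conditional probabilities given X_n vary by at most D.

  That overlap comes from the filtering model. With probability one the quenched law of X_n given X_0 = z dominates
  the unconditional law P^n(z, .), and these laws overlap for large n by ergodicity. The domination amounts to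
  the statement that making X_n independent of the observations given X_0 yields an absolutely continuous
  law. By nondegeneracy finitely many observations may be resampled from a fixed law without changing
  null sets, and by ergodicity the observations after a late time m are almost independent of X_n.
*)

theory Submission
  imports Defs
begin

section \<open>Markov chains on path space\<close>

text \<open>Only stationarity of the pair together with its environment is used, not ergodicity of
  the pair. Growth on average gives one inequality between means; comparing second moments, whose
  means agree by stationarity, turns it into a vanishing variance. The obstacle in the last part is
  that the two hypotheses speak different languages. Equivalence of observation laws preserves null
  sets but no bounds, and only for finitely many coordinates; ergodicity gives bounds that vanish
  only in the limit, as the number of resampled coordinates tends to infinity. They meet in the set
  \<open>S\<close> of late states from which a given event, after resampling, has positive mass. It
  is null for the chain restarted at \<open>x\<close>, so under the chain started at
  \<open>z\<close> its mass is at most the total variation distance between the two laws of the late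
  state. Off \<open>S\<close> the event is null again, with the original observations. Domination is
  needed in one direction only: singularity of two measures passes to any measures they dominate, so
  the overlapping unconditional laws force the conditional ones to overlap.\<close>

lemma measure_eqI_PiM_cylinders:
  fixes M N :: "('i \<Rightarrow> 'a::topological_space) measure"
  assumes M: "sets M = sets (PiM UNIV (\<lambda>_. borel))" and N: "sets N = sets (PiM UNIV (\<lambda>_. borel))"
    and fin: "finite_measure M"
    and eq: "\<And>J A. finite J \<Longrightarrow> (\<And>i. A i \<in> sets borel) \<Longrightarrow>
      emeasure M {x. \<forall>i\<in>J. x i \<in> A i} = emeasure N {x. \<forall>i\<in>J. x i \<in> A i}"
  shows "M = N"
proof (rule measure_eqI_PiM_infinite[OF M N _ fin])
  fix A :: "'i \<Rightarrow> 'a set" and J :: "'i set"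
  assume J: "finite J" "J \<subseteq> UNIV" and A: "\<And>i. i \<in> J \<Longrightarrow> A i \<in> sets borel"
  define A' where "A' i = (if i \<in> J then A i else UNIV)" for i
  have *: "prod_emb UNIV (\<lambda>_. borel) J (Pi\<^sub>E J A) = {x. \<forall>i\<in>J. x i \<in> A' i}"
    by (auto simp: prod_emb_def A'_def PiE_iff)
  show "emeasure M (prod_emb UNIV (\<lambda>_. borel) J (Pi\<^sub>E J A)) = emeasure N (prod_emb UNIV (\<lambda>_. borel) J (Pi\<^sub>E J A))"
    unfolding * using A by (intro eq J) (auto simp: A'_def)
qed

text \<open>Every finite set of times lies in an initial segment, and constraints on an initial
  segment are the events for which the law of a chain has a recursive formula.\<close>

lemma measure_eqI_seq_cylinders:
  fixes M N :: "(nat \<Rightarrow> 'a::topological_space) measure"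
  assumes M: "sets M = sets (PiM UNIV (\<lambda>_. borel))" and N: "sets N = sets (PiM UNIV (\<lambda>_. borel))"
    and fin: "finite_measure M"
    and eq: "\<And>n A. (\<And>i. A i \<in> sets borel) \<Longrightarrow>
      emeasure M {x. \<forall>i\<le>n. x i \<in> A i} = emeasure N {x. \<forall>i\<le>n. x i \<in> A i}"
  shows "M = N"
proof (rule measure_eqI_PiM_cylinders[OF M N fin])
  fix J :: "nat set" and A :: "nat \<Rightarrow> 'a set"
  assume J: "finite J" and A: "\<And>i. A i \<in> sets borel"
  define A' where "A' i = (if i \<in> J then A i else UNIV)" for i
  obtain n where n: "\<And>i. i \<in> J \<Longrightarrow> i \<le> n"
    using finite_nat_set_iff_bounded_le J by auto
  have "{x. \<forall>i\<in>J. x i \<in> A i} = {x. \<forall>i\<le>n. x i \<in> A' i}"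
    using n by (auto simp: A'_def)
  then show "emeasure M {x. \<forall>i\<in>J. x i \<in> A i} = emeasure N {x. \<forall>i\<in>J. x i \<in> A i}"
    using eq[of A' n] A by (simp add: A'_def)
qed

lemma sets_seq_cylinder [measurable]:
  assumes "\<And>i. A i \<in> sets borel"
  shows "{x :: nat \<Rightarrow> 'a::topological_space. \<forall>i\<le>n. x i \<in> A i} \<in> sets (PiM UNIV (\<lambda>_. borel))"
proof -
  have "{x \<in> space (PiM UNIV (\<lambda>_. borel)). \<forall>i\<in>{..n}. x i \<in> A i} \<in> sets (PiM UNIV (\<lambda>_. borel))"
    using assms by measurable
  also have "{x \<in> space (PiM UNIV (\<lambda>_. borel)). \<forall>i\<in>{..n}. x i \<in> A i} = {x. \<forall>i\<le>n. x i \<in> A i}"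
    by (auto simp: space_PiM)
  finally show ?thesis .
qed

lemma sets_seq_sigma_cylinders:
  "sets (PiM UNIV (\<lambda>_. borel) :: (nat \<Rightarrow> 'a::topological_space) measure) =
    sigma_sets UNIV {{x. \<forall>i\<le>n. x i \<in> A i} | n A. \<forall>i. A i \<in> sets borel}" (is "sets ?P = sigma_sets UNIV ?G")
proof (intro antisym)
  show "sets ?P \<subseteq> sigma_sets UNIV ?G"
    unfolding sets_PiM_single
  proof (simp add: PiE_def, rule sigma_sets_mono, safe)
    fix i :: nat and A :: "'a set" assume A: "A \<in> sets borel"
    have "{f. f i \<in> A} = {x. \<forall>j\<le>i. x j \<in> (if j = i then A else UNIV)}"
      by auto
    then show "{f. f i \<in> A} \<in> sigma_sets UNIV ?G"
      using A by (intro sigma_sets.Basic CollectI exI[of _ i] exI[of _ "\<lambda>j. if j = i then A else UNIV"]) auto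
  qed
  have "sigma_sets (space ?P) ?G \<subseteq> sets ?P"
    by (rule sets.sigma_sets_subset) auto
  then show "sigma_sets UNIV ?G \<subseteq> sets ?P"
    by (simp add: space_PiM)
qed

lemma Int_stable_seq_cylinders:
  "Int_stable {{x :: nat \<Rightarrow> 'a::topological_space. \<forall>i\<le>n. x i \<in> A i} | n A. \<forall>i. A i \<in> sets borel}"
proof (rule Int_stableI, safe)
  fix n m and A B :: "nat \<Rightarrow> 'a set" assume AB: "\<forall>i. A i \<in> sets borel" "\<forall>i. B i \<in> sets borel"
  show "\<exists>k C. {x. \<forall>i\<le>n. x i \<in> A i} \<inter> {x. \<forall>i\<le>m. x i \<in> B i} = {x. \<forall>i\<le>k. x i \<in> C i} \<and> (\<forall>i. C i \<in> sets borel)"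
    using AB
    by (intro exI[of _ "max n m"] exI[of _ "\<lambda>i. (if i \<le> n then A i else UNIV) \<inter> (if i \<le> m then B i else UNIV)"]) auto
qed

section \<open>Finite-dimensional laws of an inhomogeneous chain\<close>

context
  fixes K :: "nat \<Rightarrow> 'a::polish_space \<Rightarrow> 'a measure"
  assumes K [measurable]: "\<And>i. K i \<in> borel \<rightarrow>\<^sub>M prob_algebra borel"
begin

lemma Ionescu_Tulcea_markov_step: "Ionescu_Tulcea (markov_step z K) (\<lambda>_. borel)"
proof -
  have *: "markov_step z K i \<in> PiM {0..<i} (\<lambda>_. borel) \<rightarrow>\<^sub>M prob_algebra borel" for i
  proof (cases i)
    case 0
    have "(\<lambda>_. return borel z) \<in> PiM {0..<i} (\<lambda>_. borel) \<rightarrow>\<^sub>M prob_algebra borel"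
      by measurable
    with 0 show ?thesis by (simp add: markov_step_def [abs_def])
  next
    case (Suc n)
    have "(\<lambda>x. K n (x n)) \<in> PiM {0..<i} (\<lambda>_. borel) \<rightarrow>\<^sub>M prob_algebra borel"
      by (rule measurable_compose[OF measurable_component_singleton[where M="\<lambda>_. borel" and i=n] K[of n]]) (simp add: Suc)
    with Suc show ?thesis by (simp add: markov_step_def [abs_def])
  qed
  show ?thesis
    unfolding Ionescu_Tulcea_def
    using measurable_prob_algebraD[OF *] measurable_space[OF *] by (auto simp: space_prob_algebra)
qed

end

text \<open>The expectation of \<open>g\<close> at time \<open>n\<close> on the event that the chain
  visits \<open>A i\<close> at each time \<open>i\<close> up to \<open>n\<close>, unfolded by the
  first step. No measure on path space occurs in it, so measurability in the starting point is a
  plain induction.\<close>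

primrec cyl_integral :: "nat \<Rightarrow> (nat \<Rightarrow> 'a \<Rightarrow> 'a measure) \<Rightarrow> (nat \<Rightarrow> 'a set) \<Rightarrow> ('a \<Rightarrow> ennreal) \<Rightarrow> 'a \<Rightarrow> ennreal" where
  "cyl_integral 0 K A g z = indicator (A 0) z * g z"
| "cyl_integral (Suc n) K A g z =
     indicator (A 0) z * (\<integral>\<^sup>+x. cyl_integral n (\<lambda>i. K (Suc i)) (\<lambda>i. A (Suc i)) g x \<partial>K 0 z)"

text \<open>The Ionescu-Tulcea construction appends coordinates at the end, whereas the recursion
  peels them off at the front. This identity reconciles the two orders.\<close>

lemma cyl_integral_Suc_right:
  "cyl_integral (Suc n) K A g z =
    cyl_integral n K A (\<lambda>x. \<integral>\<^sup>+w. indicator (A (Suc n)) w * g w \<partial>K n x) z"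
proof (induction n arbitrary: z K A)
  case (Suc n)
  show ?case
    by (rule trans[OF cyl_integral.simps(2) trans[OF _ cyl_integral.simps(2)[symmetric]]]) (simp only: Suc.IH)
qed simp

lemma measurable_cyl_integral:
  assumes K: "\<And>i. K i \<in> borel \<rightarrow>\<^sub>M prob_algebra borel" and [measurable]: "\<And>i. A i \<in> sets borel"
    "g \<in> borel_measurable borel"
  shows "cyl_integral n K A g \<in> borel_measurable borel"
  using assms(1,2)
proof (induction n arbitrary: K A)
  case 0
  then show ?case by (simp cong: measurable_cong)
next
  case (Suc n)
  note [measurable] = Suc.prems measurable_prob_algebraD[OF Suc.prems(1)]
  have [measurable]: "cyl_integral n (\<lambda>i. K (Suc i)) (\<lambda>i. A (Suc i)) g \<in> borel_measurable borel"
    by (intro Suc) measurable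
  have "(\<lambda>z. indicator (A 0) z * (\<integral>\<^sup>+x. cyl_integral n (\<lambda>i. K (Suc i)) (\<lambda>i. A (Suc i)) g x \<partial>K 0 z)) \<in> borel_measurable borel"
    by measurable
  then show ?case by simp
qed

context
  fixes K :: "nat \<Rightarrow> 'a::polish_space \<Rightarrow> 'a measure"
  assumes K [measurable]: "\<And>i. K i \<in> borel \<rightarrow>\<^sub>M prob_algebra borel"
begin

text \<open>The function \<open>g\<close> at the last time carries the induction: integrating out
  the newest coordinate produces another function of the previous one, to which the induction
  hypothesis applies.\<close>

lemma nn_integral_markov_C:
  fixes z :: 'a
  defines "C \<equiv> Ionescu_Tulcea.C (markov_step z K) (\<lambda>_. borel)"
  assumes [measurable]: "\<And>i. A i \<in> sets borel" "g \<in> borel_measurable borel"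
  shows "(\<integral>\<^sup>+x. (\<Prod>i\<le>n. indicator (A i) (x i)) * g (x n) \<partial>C 0 (Suc n) (\<lambda>_. undefined)) = cyl_integral n K A g z"
  using assms(3)
proof (induction n arbitrary: g)
  case 0
  note [measurable] = 0
  interpret IT: Ionescu_Tulcea "markov_step z K" "\<lambda>_. borel" by (rule Ionescu_Tulcea_markov_step[OF K])
  have "C 0 (Suc 0) (\<lambda>_. undefined) = IT.eP 0 (\<lambda>_. undefined)"
    unfolding C_def IT.C.simps using bind_return[OF IT.measurable_eP, of "\<lambda>_. undefined" 0]
    by (simp add: space_PiM)
  also have "(\<integral>\<^sup>+x. (\<Prod>i\<le>0. indicator (A i) (x i)) * g (x 0) \<partial>\<dots>) = cyl_integral 0 K A g z"
    by (subst IT.nn_integral_eP) (simp_all add: markov_step_def nn_integral_return)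
  finally show ?case .
next
  case (Suc n)
  note [measurable] = Suc.prems measurable_prob_algebraD[OF K]
  interpret IT: Ionescu_Tulcea "markov_step z K" "\<lambda>_. borel" by (rule Ionescu_Tulcea_markov_step[OF K])
  let ?u = "\<lambda>_::nat. undefined :: 'a"
  have [measurable]: "(\<lambda>x. \<integral>\<^sup>+w. indicator (A (Suc n)) w * g w \<partial>K n x) \<in> borel_measurable borel"
    by measurable
  have u: "?u \<in> space (PiM {0..<0} (\<lambda>_. borel))" by (simp add: space_PiM)
  have eq: "(\<integral>\<^sup>+x. (\<Prod>i\<le>Suc n. indicator (A i) (x i)) * g (x (Suc n)) \<partial>IT.eP (0 + Suc n) \<omega>) =
    (\<Prod>i\<le>n. indicator (A i) (\<omega> i)) * (\<integral>\<^sup>+w. indicator (A (Suc n)) w * g w \<partial>K n (\<omega> n))"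
    if w: "\<omega> \<in> space (PiM {0..<Suc n} (\<lambda>_. borel))" for \<omega>
  proof -
    have [measurable_cong]: "sets (K n (\<omega> n)) = sets borel"
      using measurable_space[OF K, of "\<omega> n" n] by (simp add: space_prob_algebra)
    have "(\<integral>\<^sup>+x. (\<Prod>i\<le>Suc n. indicator (A i) (x i)) * g (x (Suc n)) \<partial>IT.eP (0 + Suc n) \<omega>) =
      (\<integral>\<^sup>+w. (\<Prod>i\<le>Suc n. indicator (A i) ((fun_upd \<omega> (Suc n) w) i)) * g w \<partial>K n (\<omega> n))"
      using w by (simp only: add_0) (subst IT.nn_integral_eP, simp_all add: markov_step_def)
    also have "\<dots> = (\<integral>\<^sup>+w. (\<Prod>i\<le>n. indicator (A i) (\<omega> i)) * (indicator (A (Suc n)) w * g w) \<partial>K n (\<omega> n))"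
      by (intro nn_integral_cong) (simp add: mult_ac)
    also have "\<dots> = (\<Prod>i\<le>n. indicator (A i) (\<omega> i)) * (\<integral>\<^sup>+w. indicator (A (Suc n)) w * g w \<partial>K n (\<omega> n))"
      by (subst nn_integral_cmult) simp_all
    finally show ?thesis .
  qed
  have mC: "C 0 (Suc n) ?u \<in> space (subprob_algebra (PiM {0..<0 + Suc n} (\<lambda>_. borel)))"
    unfolding C_def using IT.measurable_C u by (rule measurable_space)
  then have sC: "space (C 0 (Suc n) ?u) = space (PiM {0..<Suc n} (\<lambda>_. borel))"
    and [measurable_cong]: "sets (C 0 (Suc n) ?u) = sets (PiM {0..<Suc n} (\<lambda>_. borel))"
    by (auto simp: space_subprob_algebra dest: sets_eq_imp_space_eq)
  have C: "C 0 (Suc (Suc n)) ?u = C 0 (Suc n) ?u \<bind> IT.eP (0 + Suc n)"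
    unfolding C_def by (rule IT.C.simps)
  have "(\<integral>\<^sup>+x. (\<Prod>i\<le>Suc n. indicator (A i) (x i)) * g (x (Suc n)) \<partial>C 0 (Suc (Suc n)) ?u)
     = (\<integral>\<^sup>+\<omega>. \<integral>\<^sup>+x. (\<Prod>i\<le>Suc n. indicator (A i) (x i)) * g (x (Suc n)) \<partial>IT.eP (0 + Suc n) \<omega> \<partial>C 0 (Suc n) ?u)"
    unfolding C
    apply (rule nn_integral_bind[where B="PiM {0..<Suc (Suc n)} (\<lambda>_. borel)"])
    subgoal by measurable
    subgoal using IT.measurable_eP[of "Suc n"] by simp
    done
  also have "\<dots> = (\<integral>\<^sup>+\<omega>. (\<Prod>i\<le>n. indicator (A i) (\<omega> i)) * (\<integral>\<^sup>+w. indicator (A (Suc n)) w * g w \<partial>K n (\<omega> n)) \<partial>C 0 (Suc n) ?u)"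
    by (intro nn_integral_cong) (simp only: sC eq)
  also have "\<dots> = cyl_integral (Suc n) K A g z"
    unfolding cyl_integral_Suc_right by (rule Suc.IH) measurable
  finally show ?case .
qed

lemma sets_markov_chain [measurable_cong, simp]: "sets (markov_chain z K) = sets (PiM UNIV (\<lambda>_. borel))"
proof -
  interpret IT: Ionescu_Tulcea "markov_step z K" "\<lambda>_. borel" by (rule Ionescu_Tulcea_markov_step[OF K])
  show ?thesis unfolding markov_chain_def by simp
qed

lemma space_markov_chain [simp]: "space (markov_chain z K) = UNIV"
  using sets_eq_imp_space_eq[OF sets_markov_chain] by (simp add: space_PiM)

lemma emeasure_markov_chain_cylinder:
  assumes A [measurable]: "\<And>i. A i \<in> sets borel"
  shows "emeasure (markov_chain z K) {x. \<forall>i\<le>n. x i \<in> A i} = cyl_integral n K A (\<lambda>_. 1) z"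
proof -
  interpret IT: Ionescu_Tulcea "markov_step z K" "\<lambda>_. borel" by (rule Ionescu_Tulcea_markov_step[OF K])
  let ?J = "{0..<Suc n}" and ?u = "\<lambda>_::nat. undefined :: 'a"
  have 1: "{x. \<forall>i\<le>n. x i \<in> A i} = prod_emb UNIV (\<lambda>_. borel) ?J (Pi\<^sub>E ?J A)"
    by (auto simp: prod_emb_def PiE_iff less_Suc_eq_le)
  have m: "Pi\<^sub>E ?J A \<in> sets (PiM ?J (\<lambda>_. borel))"
    by (intro sets_PiM_I_finite) auto
  have mC: "IT.C 0 (Suc n) ?u \<in> space (subprob_algebra (PiM {0..<0 + Suc n} (\<lambda>_. borel)))"
    using IT.measurable_C by (rule measurable_space) (simp add: space_PiM)
  then have sC: "space (IT.C 0 (Suc n) ?u) = space (PiM {0..<Suc n} (\<lambda>_. borel))"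
    and sC': "sets (IT.C 0 (Suc n) ?u) = sets (PiM {0..<Suc n} (\<lambda>_. borel))"
    by (auto simp: space_subprob_algebra dest: sets_eq_imp_space_eq)
  have "emeasure (markov_chain z K) {x. \<forall>i\<le>n. x i \<in> A i} = emeasure (IT.CI ?J) (Pi\<^sub>E ?J A)"
    unfolding 1 markov_chain_def using m by (intro IT.lim) auto
  also have "\<dots> = emeasure (IT.C 0 (Suc n) ?u) (prod_emb ?J (\<lambda>_. borel) ?J (Pi\<^sub>E ?J A))"
    using m by (intro IT.emeasure_CI) auto
  also have "prod_emb ?J (\<lambda>_. borel) ?J (Pi\<^sub>E ?J A) = Pi\<^sub>E ?J A"
    by (auto simp: prod_emb_def PiE_iff extensional_def)
  also have "emeasure (IT.C 0 (Suc n) ?u) (Pi\<^sub>E ?J A) = (\<integral>\<^sup>+x. indicator (Pi\<^sub>E ?J A) x \<partial>IT.C 0 (Suc n) ?u)"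
    using m by (subst nn_integral_indicator) (simp_all add: sC' del: IT.C.simps)
  \<comment> \<open>The product tests only the coordinates up to \<open>n\<close>. It agrees with
    the indicator of the box because all points of the space are extensional.\<close>
  also have "\<dots> = (\<integral>\<^sup>+x. (\<Prod>i\<le>n. indicator (A i) (x i)) * 1 \<partial>IT.C 0 (Suc n) ?u)"
  proof (intro nn_integral_cong)
    fix x assume "x \<in> space (IT.C 0 (Suc n) ?u)"
    then have x: "x \<in> extensional ?J" unfolding sC by (auto simp: space_PiM PiE_iff)
    show "indicator (Pi\<^sub>E ?J A) x = (\<Prod>i\<le>n. indicator (A i) (x i) :: ennreal) * 1"
    proof (cases "x \<in> Pi\<^sub>E ?J A")
      case True
      then have "(\<Prod>i\<le>n. indicator (A i) (x i) :: ennreal) = 1" by (intro prod.neutral) (auto simp: PiE_iff less_Suc_eq_le)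
      with True show ?thesis by simp
    next
      case False
      with x obtain i where "i \<le> n" "x i \<notin> A i" by (auto simp: PiE_iff less_Suc_eq_le)
      then have "(\<Prod>i\<le>n. indicator (A i) (x i) :: ennreal) = 0" by (intro prod_zero bexI[of _ i]) auto
      with False show ?thesis by simp
    qed
  qed
  also have "\<dots> = cyl_integral n K A (\<lambda>_. 1) z"
    by (rule nn_integral_markov_C) measurable
  finally show ?thesis .
qed

lemma prob_space_markov_chain: "prob_space (markov_chain z K)"
proof
  show "emeasure (markov_chain z K) (space (markov_chain z K)) = 1"
    using emeasure_markov_chain_cylinder[where A="\<lambda>_. UNIV" and n=0 and z=z] by simp
qed

lemma measurable_markov_chain [measurable]:
  "(\<lambda>z. markov_chain z K) \<in> borel \<rightarrow>\<^sub>M prob_algebra (PiM UNIV (\<lambda>_. borel))"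
proof (rule measurable_prob_algebra_generated[OF sets_seq_sigma_cylinders Int_stable_seq_cylinders])
  show "prob_space (markov_chain z K)" for z by (rule prob_space_markov_chain)
  fix B :: "(nat \<Rightarrow> 'a) set" assume "B \<in> {{x. \<forall>i\<le>n. x i \<in> A i} | n A. \<forall>i. A i \<in> sets borel}"
  then obtain n A where B: "B = {x. \<forall>i\<le>n. x i \<in> A i}" and A: "\<And>i. (A i :: 'a set) \<in> sets borel" by auto
  show "(\<lambda>z. emeasure (markov_chain z K) B) \<in> borel_measurable borel"
    unfolding B emeasure_markov_chain_cylinder[OF A] by (intro measurable_cyl_integral K A) auto
qed auto

end

lemma prob_kernelD:
  assumes "K \<in> M \<rightarrow>\<^sub>M prob_algebra N" "x \<in> space M"
  shows "prob_space (K x)" "sets (K x) = sets N" "space (K x) = space N"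
  using measurable_space[OF assms] by (auto simp: space_prob_algebra dest: sets_eq_imp_space_eq)

lemma measurable_comb_seq' [measurable (raw)]:
  assumes [measurable]: "f \<in> M \<rightarrow>\<^sub>M PiM UNIV (\<lambda>_. N)" "g \<in> M \<rightarrow>\<^sub>M PiM UNIV (\<lambda>_. N)"
  shows "(\<lambda>x. comb_seq n (f x) (g x)) \<in> M \<rightarrow>\<^sub>M PiM UNIV (\<lambda>_. N)"
proof (rule measurable_PiM_single')
  show "(\<lambda>x. comb_seq n (f x) (g x) i) \<in> M \<rightarrow>\<^sub>M N" for i
    by (cases "i < n") (simp_all add: comb_seq_def)
  show "(\<lambda>x i. comb_seq n (f x) (g x) i) \<in> space M \<rightarrow> (\<Pi>\<^sub>E i\<in>UNIV. space N)"
    using measurable_space[OF assms(1)] measurable_space[OF assms(2)]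
    by (auto simp: comb_seq_def space_PiM PiE_iff)
qed

lemma nn_integral_bind_prob_algebra:
  assumes "M \<in> space (prob_algebra A)" "K \<in> A \<rightarrow>\<^sub>M prob_algebra B" "f \<in> borel_measurable B"
  shows "(\<integral>\<^sup>+x. f x \<partial>(M \<bind> K)) = (\<integral>\<^sup>+x. \<integral>\<^sup>+y. f y \<partial>K x \<partial>M)"
proof (rule nn_integral_bind[OF assms(3)])
  show "K \<in> M \<rightarrow>\<^sub>M subprob_algebra B"
    using assms(1) measurable_prob_algebraD[OF assms(2)] by (simp add: space_prob_algebra cong: measurable_cong_sets)
qed

lemma measurable_nn_integral_kernel:
  assumes "K \<in> M \<rightarrow>\<^sub>M prob_algebra N" "(\<lambda>(x, y). f x y) \<in> borel_measurable (M \<Otimes>\<^sub>M N)"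
  shows "(\<lambda>x. \<integral>\<^sup>+y. f x y \<partial>K x) \<in> borel_measurable M"
  using nn_integral_measurable_subprob_algebra2[OF assms(2) measurable_prob_algebraD[OF assms(1)]] by simp

section \<open>First-step decomposition, Markov property and marginals\<close>

primrec iter_kernel :: "nat \<Rightarrow> (nat \<Rightarrow> 'a::topological_space \<Rightarrow> 'a measure) \<Rightarrow> 'a \<Rightarrow> 'a measure" where
  "iter_kernel 0 K z = return borel z"
| "iter_kernel (Suc n) K z = K 0 z \<bind> iter_kernel n (\<lambda>i. K (Suc i))"

context
  fixes K :: "nat \<Rightarrow> 'a::polish_space \<Rightarrow> 'a measure"
  assumes K [measurable]: "\<And>i. K i \<in> borel \<rightarrow>\<^sub>M prob_algebra borel"
begin

text \<open>On a cylinder over an initial segment both sides equal \<open>cyl_integral\<close>,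
  whose recursion is exactly one step of the chain. A segment of length one constrains only the
  start and is treated apart.\<close>

lemma markov_chain_first_step:
  "markov_chain z K = K 0 z \<bind> (\<lambda>x. distr (markov_chain x (\<lambda>i. K (Suc i))) (PiM UNIV (\<lambda>_. borel)) (case_nat z))"
proof (rule measure_eqI_seq_cylinders)
  let ?S = "PiM UNIV (\<lambda>_. borel) :: (nat \<Rightarrow> 'a) measure"
  let ?f = "\<lambda>x. distr (markov_chain x (\<lambda>i. K (Suc i))) ?S (case_nat z)"
  have K0: "K 0 z \<in> space (prob_algebra borel)"
    using measurable_space[OF K, of z 0] by simp
  have f: "?f \<in> borel \<rightarrow>\<^sub>M prob_algebra ?S"
    using measurable_markov_chain[of "\<lambda>i. K (Suc i)"] by measurable
  show "sets (K 0 z \<bind> ?f) = sets ?S"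
    using K0 f by (rule sets_bind')
  show "finite_measure (markov_chain z K)"
    using prob_space_markov_chain[OF K] by (rule prob_space.finite_measure)
  fix n and A :: "nat \<Rightarrow> 'a set" assume A [measurable]: "\<And>i. A i \<in> sets borel"
  have "emeasure (K 0 z \<bind> ?f) {x. \<forall>i\<le>n. x i \<in> A i} =
    (\<integral>\<^sup>+x. emeasure (?f x) {x. \<forall>i\<le>n. x i \<in> A i} \<partial>K 0 z)"
    using K0 f by (rule emeasure_bind_prob_algebra) measurable
  also have "\<dots> = cyl_integral n K A (\<lambda>_. 1) z"
  proof (cases n)
    case 0
    have [simp]: "{x. x 0 \<in> A 0} \<in> sets ?S"
      using sets_seq_cylinder[of A 0, OF A] by simp
    have *: "case_nat z -` {x. \<forall>i\<le>0. x i \<in> A i} = (if z \<in> A 0 then UNIV else {})"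
      by auto
    have "emeasure (?f x) {x. \<forall>i\<le>0. x i \<in> A i} = indicator (A 0) z" for x
      using prob_space.emeasure_space_1[OF prob_space_markov_chain[of "\<lambda>i. K (Suc i)", OF K], of x]
      by (subst emeasure_distr) (auto simp: * space_markov_chain[of "\<lambda>i. K (Suc i)"])
    then show ?thesis
      using 0 prob_space.emeasure_space_1[OF prob_kernelD(1)[OF K], of z 0] by simp
  next
    case (Suc m)
    have "emeasure (?f x) {x. \<forall>i\<le>n. x i \<in> A i} =
      indicator (A 0) z * cyl_integral m (\<lambda>i. K (Suc i)) (\<lambda>i. A (Suc i)) (\<lambda>_. 1) x" for x
    proof -
      have *: "case_nat z -` {x. \<forall>i\<le>n. x i \<in> A i} = (if z \<in> A 0 then {x. \<forall>i\<le>m. x i \<in> A (Suc i)} else {})"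
        by (auto simp: Suc all_conj_distrib split: nat.split)
      have "emeasure (?f x) {x. \<forall>i\<le>n. x i \<in> A i} =
        emeasure (markov_chain x (\<lambda>i. K (Suc i))) (case_nat z -` {x. \<forall>i\<le>n. x i \<in> A i} \<inter> UNIV)"
        by (subst emeasure_distr) (simp_all add: space_markov_chain[of "\<lambda>i. K (Suc i)"])
      then show ?thesis
        unfolding * by (simp add: emeasure_markov_chain_cylinder[of "\<lambda>i. K (Suc i)"])
    qed
    moreover have "cyl_integral m (\<lambda>i. K (Suc i)) (\<lambda>i. A (Suc i)) (\<lambda>_. 1) \<in> borel_measurable borel"
      by (rule measurable_cyl_integral) measurable
    ultimately show ?thesis
      using prob_kernelD(2)[OF K, of z 0]
      by (simp add: Suc nn_integral_cmult cong: measurable_cong_sets)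
  qed
  finally show "emeasure (markov_chain z K) {x. \<forall>i\<le>n. x i \<in> A i} = emeasure (K 0 z \<bind> ?f) {x. \<forall>i\<le>n. x i \<in> A i}"
    by (simp add: emeasure_markov_chain_cylinder[OF K])
qed (simp add: sets_markov_chain[OF K])

lemma nn_integral_markov_chain_first_step:
  assumes [measurable]: "f \<in> borel_measurable (PiM UNIV (\<lambda>_. borel))"
  shows "(\<integral>\<^sup>+w. f w \<partial>markov_chain z K) =
    (\<integral>\<^sup>+x. \<integral>\<^sup>+w. f (case_nat z w) \<partial>markov_chain x (\<lambda>i. K (Suc i)) \<partial>K 0 z)"
proof -
  note [measurable] = measurable_markov_chain[of "\<lambda>i. K (Suc i)", OF K]
  have K0: "K 0 z \<in> space (prob_algebra borel)"
    using measurable_space[OF K, of z 0] by simp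
  show ?thesis
    by (subst markov_chain_first_step, subst nn_integral_bind_prob_algebra[OF K0])
       (measurable, simp_all add: nn_integral_distr sets_markov_chain[of "\<lambda>i. K (Suc i)"] cong: measurable_cong_sets)
qed

end

context
  fixes K :: "nat \<Rightarrow> 'a::polish_space \<Rightarrow> 'a measure"
  assumes K [measurable]: "\<And>i. K i \<in> borel \<rightarrow>\<^sub>M prob_algebra borel"
begin

lemma AE_markov_chain_start: "AE x in markov_chain z K. x 0 = z"
proof -
  have "{w \<in> space (PiM UNIV (\<lambda>_. borel)). w 0 \<noteq> z} \<in> sets (PiM UNIV (\<lambda>_. borel) :: (nat \<Rightarrow> 'a) measure)"
    by measurable
  then have [simp, measurable]: "{w. w 0 \<noteq> z} \<in> sets (PiM UNIV (\<lambda>_. borel) :: (nat \<Rightarrow> 'a) measure)"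
    by (simp add: space_PiM)
  have "(\<integral>\<^sup>+w. indicator {w. w 0 \<noteq> z} w \<partial>markov_chain z K) =
    (\<integral>\<^sup>+x. \<integral>\<^sup>+w. indicator {w. w 0 \<noteq> z} (case_nat z w) \<partial>markov_chain x (\<lambda>i. K (Suc i)) \<partial>K 0 z)"
    by (rule nn_integral_markov_chain_first_step[OF K]) measurable
  then have "emeasure (markov_chain z K) {w. w 0 \<noteq> z} = 0"
    by (subst (asm) nn_integral_indicator) (auto simp: sets_markov_chain[OF K])
  then show ?thesis
    by (intro AE_I[of _ _ "{w. w 0 \<noteq> z}"]) (auto simp: sets_markov_chain[OF K])
qed

end

context
  fixes K :: "nat \<Rightarrow> 'a::polish_space \<Rightarrow> 'a measure"
  assumes K [measurable]: "\<And>i. K i \<in> borel \<rightarrow>\<^sub>M prob_algebra borel"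
begin

text \<open>The first step moves the time origin of the kernels, hence the induction is over all
  kernel sequences at once. At index \<open>n\<close> the spliced path is read from
  \<open>w\<close>, which starts in \<open>x n\<close> almost surely, so nothing is lost at the
  seam.\<close>

lemma nn_integral_markov_chain_Markov:
  assumes [measurable]: "f \<in> borel_measurable (PiM UNIV (\<lambda>_. borel))"
  shows "(\<integral>\<^sup>+w. f w \<partial>markov_chain z K) =
    (\<integral>\<^sup>+x. \<integral>\<^sup>+w. f (comb_seq n x w) \<partial>markov_chain (x n) (\<lambda>i. K (i + n)) \<partial>markov_chain z K)"
  using K assms
proof (induction n arbitrary: f z K)
  case 0
  note [measurable] = \<open>f \<in> _\<close>
  have [simp]: "comb_seq 0 x w = w" for x w :: "nat \<Rightarrow> 'a"
    by (simp add: comb_seq_def fun_eq_iff)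
  have "(\<integral>\<^sup>+x. \<integral>\<^sup>+w. f (comb_seq 0 x w) \<partial>markov_chain (x 0) (\<lambda>i. K (i + 0)) \<partial>markov_chain z K) =
    (\<integral>\<^sup>+x. \<integral>\<^sup>+w. f w \<partial>markov_chain z K \<partial>markov_chain z K)"
    using AE_markov_chain_start[of K z, OF 0(1)] by (intro nn_integral_cong_AE) auto
  also have "\<dots> = (\<integral>\<^sup>+w. f w \<partial>markov_chain z K)"
    using prob_space.emeasure_space_1[OF prob_space_markov_chain[OF 0(1)]] by simp
  finally show ?case ..
next
  case (Suc n)
  note [measurable] = \<open>f \<in> _\<close> \<open>\<And>i. K i \<in> _\<close>
  have m: "(\<lambda>z. markov_chain z (\<lambda>i. K (i + Suc n))) \<in> borel \<rightarrow>\<^sub>M prob_algebra (PiM UNIV (\<lambda>_. borel))"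
    by (rule measurable_markov_chain) measurable
  have m': "(\<lambda>x. markov_chain (x (Suc n)) (\<lambda>i. K (i + Suc n))) \<in> PiM UNIV (\<lambda>_. borel) \<rightarrow>\<^sub>M prob_algebra (PiM UNIV (\<lambda>_. borel))"
    by (rule measurable_compose[OF _ m]) measurable
  have mm: "(\<lambda>x. \<integral>\<^sup>+w. f (comb_seq (Suc n) x w) \<partial>markov_chain (x (Suc n)) (\<lambda>i. K (i + Suc n))) \<in> borel_measurable (PiM UNIV (\<lambda>_. borel))"
    by (rule measurable_nn_integral_kernel[OF m']) measurable
  have comb: "comb_seq (Suc n) (case_nat z x) w = case_nat z (comb_seq n x w)" for x w and z :: 'a
    by (auto simp: comb_seq_def fun_eq_iff split: nat.split)
  have "(\<integral>\<^sup>+w. f w \<partial>markov_chain z K) =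
    (\<integral>\<^sup>+x. \<integral>\<^sup>+w. f (case_nat z w) \<partial>markov_chain x (\<lambda>i. K (Suc i)) \<partial>K 0 z)"
    by (rule nn_integral_markov_chain_first_step) measurable
  also have "\<dots> = (\<integral>\<^sup>+x. \<integral>\<^sup>+w. \<integral>\<^sup>+v. f (case_nat z (comb_seq n w v)) \<partial>markov_chain (w n) (\<lambda>i. K (Suc (i + n)))
       \<partial>markov_chain x (\<lambda>i. K (Suc i)) \<partial>K 0 z)"
    by (subst Suc.IH[where f="\<lambda>w. f (case_nat z w)"]) simp_all
  also have "\<dots> = (\<integral>\<^sup>+x. \<integral>\<^sup>+w. f (comb_seq (Suc n) x w) \<partial>markov_chain (x (Suc n)) (\<lambda>i. K (i + Suc n)) \<partial>markov_chain z K)"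
    by (subst nn_integral_markov_chain_first_step[where f="\<lambda>x. \<integral>\<^sup>+w. f (comb_seq (Suc n) x w) \<partial>markov_chain (x (Suc n)) (\<lambda>i. K (i + Suc n))"])
       (use mm in \<open>simp_all add: comb\<close>)
  finally show ?case .
qed

lemma measurable_iter_kernel [measurable]: "iter_kernel n K \<in> borel \<rightarrow>\<^sub>M prob_algebra borel"
  using K
proof (induction n arbitrary: K)
  case (Suc n)
  have "(\<lambda>z. K 0 z \<bind> iter_kernel n (\<lambda>i. K (Suc i))) \<in> borel \<rightarrow>\<^sub>M prob_algebra borel"
    by (rule measurable_bind_prob_space[OF Suc.prems Suc.IH]) (rule Suc.prems)
  then show ?case by (simp cong: measurable_cong)
qed (simp cong: measurable_cong)

end

context
  fixes K :: "nat \<Rightarrow> 'a::polish_space \<Rightarrow> 'a measure"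
  assumes K [measurable]: "\<And>i. K i \<in> borel \<rightarrow>\<^sub>M prob_algebra borel"
begin

lemma nn_integral_iter_kernel_Suc:
  assumes [measurable]: "f \<in> borel_measurable borel"
  shows "(\<integral>\<^sup>+x. f x \<partial>iter_kernel (Suc n) K z) = (\<integral>\<^sup>+x. \<integral>\<^sup>+w. f w \<partial>iter_kernel n (\<lambda>i. K (Suc i)) x \<partial>K 0 z)"
  unfolding iter_kernel.simps
  by (rule nn_integral_bind_prob_algebra[OF measurable_space[OF K] measurable_iter_kernel[of "\<lambda>i. K (Suc i)", OF K] assms]) simp

end

context
  fixes K :: "nat \<Rightarrow> 'a::polish_space \<Rightarrow> 'a measure"
  assumes K [measurable]: "\<And>i. K i \<in> borel \<rightarrow>\<^sub>M prob_algebra borel"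
begin

lemma nn_integral_iter_kernel_add:
  assumes [measurable]: "f \<in> borel_measurable borel"
  shows "(\<integral>\<^sup>+x. f x \<partial>iter_kernel (n + m) K z) =
    (\<integral>\<^sup>+x. \<integral>\<^sup>+w. f w \<partial>iter_kernel m (\<lambda>i. K (i + n)) x \<partial>iter_kernel n K z)"
  using K
proof (induction n arbitrary: z K)
  case 0
  have "iter_kernel m K \<in> borel \<rightarrow>\<^sub>M prob_algebra borel"
    by (rule measurable_iter_kernel[OF 0])
  from measurable_nn_integral_kernel[OF this, of "\<lambda>_. f"] show ?case
    by (simp add: nn_integral_return)
next
  case (Suc n)
  have "iter_kernel m (\<lambda>i. K (i + Suc n)) \<in> borel \<rightarrow>\<^sub>M prob_algebra borel"
    by (rule measurable_iter_kernel) (rule Suc)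
  from measurable_nn_integral_kernel[OF this, of "\<lambda>_. f"]
  have "(\<lambda>x. \<integral>\<^sup>+w. f w \<partial>iter_kernel m (\<lambda>i. K (i + Suc n)) x) \<in> borel_measurable borel" by simp
  then show ?case
    using Suc.IH[of "\<lambda>i. K (Suc i)", OF Suc.prems]
    by (simp add: nn_integral_iter_kernel_Suc[OF Suc.prems] del: iter_kernel.simps)
qed

lemma nn_integral_markov_chain_marginal:
  assumes [measurable]: "f \<in> borel_measurable borel"
  shows "(\<integral>\<^sup>+w. f (w n) \<partial>markov_chain z K) = (\<integral>\<^sup>+x. f x \<partial>iter_kernel n K z)"
  using K
proof (induction n arbitrary: z K)
  case 0
  have "(\<integral>\<^sup>+w. f (w 0) \<partial>markov_chain z K) = (\<integral>\<^sup>+w. f z \<partial>markov_chain z K)"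
    using AE_markov_chain_start[of K z, OF 0] by (intro nn_integral_cong_AE) auto
  with prob_space.emeasure_space_1[OF prob_space_markov_chain[OF 0]] show ?case
    by (simp add: nn_integral_return)
next
  case (Suc n)
  have "(\<integral>\<^sup>+w. f (w (Suc n)) \<partial>markov_chain z K) =
    (\<integral>\<^sup>+x. \<integral>\<^sup>+w. f (case_nat z w (Suc n)) \<partial>markov_chain x (\<lambda>i. K (Suc i)) \<partial>K 0 z)"
    by (rule nn_integral_markov_chain_first_step[OF Suc.prems]) measurable
  also have "\<dots> = (\<integral>\<^sup>+x. \<integral>\<^sup>+w. f w \<partial>iter_kernel n (\<lambda>i. K (Suc i)) x \<partial>K 0 z)"
    using Suc.IH[of "\<lambda>i. K (Suc i)", OF Suc.prems] by simp
  finally show ?case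
    by (simp add: nn_integral_iter_kernel_Suc[OF Suc.prems] del: iter_kernel.simps)
qed

lemma distr_markov_chain_marginal:
  "distr (markov_chain z K) borel (\<lambda>w. w n) = iter_kernel n K z"
proof (rule measure_eqI)
  note [simp] = prob_kernelD(2,3)[OF measurable_iter_kernel[OF K], simplified]
  show "sets (distr (markov_chain z K) borel (\<lambda>w. w n)) = sets (iter_kernel n K z)"
    by simp
  fix A assume "A \<in> sets (distr (markov_chain z K) borel (\<lambda>w. w n))"
  then have [measurable]: "A \<in> sets borel" by simp
  have [measurable]: "(\<lambda>w. w n) \<in> markov_chain z K \<rightarrow>\<^sub>M borel"
    by (simp add: sets_markov_chain[OF K] cong: measurable_cong_sets)
  have "(\<integral>\<^sup>+w. indicator A (w n) \<partial>markov_chain z K) = (\<integral>\<^sup>+x. indicator A x \<partial>iter_kernel n K z)"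
    by (rule nn_integral_markov_chain_marginal) measurable
  also have "(\<integral>\<^sup>+w. indicator A (w n) \<partial>markov_chain z K) = (\<integral>\<^sup>+x. indicator A x \<partial>distr (markov_chain z K) borel (\<lambda>w. w n))"
    by (subst nn_integral_distr) auto
  finally show "emeasure (distr (markov_chain z K) borel (\<lambda>w. w n)) A = emeasure (iter_kernel n K z) A"
    by simp
qed

end

section \<open>Total variation distance\<close>

text \<open>Half the scale of \<open>tv_dist\<close>: for probability measures the values lie
  between 0 and 1, and mutual singularity forces the value 1. A supremum over events can be cut down
  to countably many, which gives measurability in the two measures.\<close>

definition tvd :: "'a measure \<Rightarrow> 'a measure \<Rightarrow> real" where
  "tvd M N = (SUP A\<in>sets M. \<bar>measure M A - measure N A\<bar>)"

lemma abs_diff_le_one: "0 \<le> a \<Longrightarrow> a \<le> 1 \<Longrightarrow> 0 \<le> b \<Longrightarrow> b \<le> 1 \<Longrightarrow> \<bar>a - b\<bar> \<le> (1::real)"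
  by (auto simp: abs_if)

context
  fixes M N :: "'a measure"
  assumes M: "prob_space M" and N: "prob_space N"
begin

interpretation M: prob_space M by (rule M)
interpretation N: prob_space N by (rule N)

lemma bdd_above_tvd: "bdd_above ((\<lambda>A. \<bar>measure M A - measure N A\<bar>) ` \<A>)"
  by (intro bdd_aboveI2[of _ _ 1] abs_diff_le_one) auto

lemma tvd_upper: "A \<in> sets M \<Longrightarrow> \<bar>measure M A - measure N A\<bar> \<le> tvd M N"
  unfolding tvd_def by (rule cSUP_upper[OF _ bdd_above_tvd])

lemma tvd_nonneg: "0 \<le> tvd M N"
  using tvd_upper[of "{}"] by simp

lemma tvd_le_1: "tvd M N \<le> 1"
  unfolding tvd_def by (intro cSUP_least abs_diff_le_one) auto

end

lemma tvd_leI: "(\<And>A. A \<in> sets M \<Longrightarrow> \<bar>measure M A - measure N A\<bar> \<le> c) \<Longrightarrow> tvd M N \<le> c"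
  unfolding tvd_def by (intro cSUP_least) auto

lemma obtain_open_outer_approx:
  fixes M :: "'a::polish_space measure"
  assumes "finite_measure M" "sets M = sets borel" "A \<in> sets borel" "0 < e"
  obtains U where "open U" "A \<subseteq> U" "measure M U < measure M A + e"
proof -
  interpret finite_measure M by fact
  have "emeasure M A = (INF U \<in> {U. A \<subseteq> U \<and> open U}. emeasure M U)"
    using assms emeasure_finite by (intro outer_regular) auto
  moreover have "emeasure M A < emeasure M A + ennreal e"
    using assms(4) emeasure_eq_measure[of A]
    by (simp add: ennreal_plus[symmetric] ennreal_less_iff add_nonneg_pos del: ennreal_plus)
  ultimately obtain U where "A \<subseteq> U" "open U" "emeasure M U < emeasure M A + ennreal e"
    by (auto simp: INF_less_iff)
  with assms(4) that show ?thesis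
    by (auto simp: emeasure_eq_measure ennreal_plus[symmetric] ennreal_less_iff simp del: ennreal_plus)
qed

text \<open>Outer regularity reduces the supremum over all Borel sets to one over a countable
  family of open sets, which makes the distance measurable in its arguments.\<close>

lemma ex_countable_tvd_family:
  "\<exists>\<U>::'a::polish_space set set. countable \<U> \<and> {} \<in> \<U> \<and> \<U> \<subseteq> sets borel \<and>
    (\<forall>M N. prob_space M \<longrightarrow> prob_space N \<longrightarrow> sets M = sets borel \<longrightarrow> sets N = sets borel \<longrightarrow>
      tvd M N = (SUP U\<in>\<U>. \<bar>measure M U - measure N U\<bar>))"
proof -
  obtain B :: "'a set set" where B: "countable B" "topological_basis B"
    using ex_countable_basis by auto
  \<comment> \<open>Finite unions of basis sets are countably many, and every nonempty open set is
    an increasing union of them.\<close>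
  define \<U> where "\<U> = Union ` {F. finite F \<and> F \<subseteq> B}"
  have cU: "countable \<U>"
    unfolding \<U>_def by (intro countable_image countable_Collect_finite_subset B)
  have ne: "{} \<in> \<U>" unfolding \<U>_def by (intro image_eqI[of _ _ "{}"]) auto
  have oU: "open U" if "U \<in> \<U>" for U
    using that B(2) unfolding \<U>_def by (auto intro!: open_Union topological_basis_open)
  then have bU: "\<U> \<subseteq> sets borel" by auto
  have "tvd M N = (SUP U\<in>\<U>. \<bar>measure M U - measure N U\<bar>)"
    if M: "prob_space M" and N: "prob_space N" and [simp]: "sets M = sets borel" "sets N = sets borel"
    for M N :: "'a measure"
  proof -
    interpret M: prob_space M by (rule M)
    interpret N: prob_space N by (rule N)
    define c where "c = (SUP U\<in>\<U>. \<bar>measure M U - measure N U\<bar>)"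
    have 1: "\<bar>measure M U - measure N U\<bar> \<le> c" if "U \<in> \<U>" for U
      unfolding c_def using that by (rule cSUP_upper[OF _ bdd_above_tvd[OF M N]])
    have 2: "\<bar>measure M U - measure N U\<bar> \<le> c" if U: "open U" for U
    proof (cases "U = {}")
      case False
      obtain B' where B': "B' \<subseteq> B" "U = \<Union>B'"
        using B(2) U unfolding topological_basis_def by blast
      with False have "B' \<noteq> {}" by auto
      moreover have "countable B'" using B(1) B'(1) by (rule countable_subset[rotated])
      ultimately obtain f where f: "B' = range (f :: nat \<Rightarrow> _)"
        using uncountable_def by metis
      define V where "V n = \<Union>(f ` {..n})" for n
      have V: "V n \<in> \<U>" for n
        unfolding V_def \<U>_def using f B' by (intro image_eqI[of _ _ "f ` {..n}"]) auto
      have inc: "incseq V" unfolding V_def incseq_def by force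
      have UV: "U = (\<Union>n. V n)" unfolding V_def B' f by auto
      have "(\<lambda>n. measure M (V n)) \<longlonglongrightarrow> measure M U"
        unfolding UV using V bU inc by (intro M.finite_Lim_measure_incseq) auto
      moreover have "(\<lambda>n. measure N (V n)) \<longlonglongrightarrow> measure N U"
        unfolding UV using V bU inc by (intro N.finite_Lim_measure_incseq) auto
      ultimately have "(\<lambda>n. \<bar>measure M (V n) - measure N (V n)\<bar>) \<longlonglongrightarrow> \<bar>measure M U - measure N U\<bar>"
        by (intro tendsto_intros)
      then show ?thesis
        by (rule LIMSEQ_le_const2) (auto intro: 1 V)
    qed (use 1[OF ne] in simp)
    have "\<bar>measure M A - measure N A\<bar> \<le> c" if A: "A \<in> sets borel" for A
    proof (rule field_le_epsilon)
      fix e :: real assume "0 < e"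
      then have e: "0 < e / 2" by simp
      from obtain_open_outer_approx[OF M.finite_measure_axioms _ A e] obtain U1
        where U1: "open U1" "A \<subseteq> U1" "measure M U1 < measure M A + e / 2" by auto
      from obtain_open_outer_approx[OF N.finite_measure_axioms _ A e] obtain U2
        where U2: "open U2" "A \<subseteq> U2" "measure N U2 < measure N A + e / 2" by auto
      \<comment> \<open>One open set has to serve both measures, so the two outer approximations are
        intersected.\<close>
      let ?U = "U1 \<inter> U2"
      have "measure M ?U \<le> measure M U1" "measure N ?U \<le> measure N U2"
        "measure M A \<le> measure M ?U" "measure N A \<le> measure N ?U"
        using U1 U2 A by (auto intro!: M.finite_measure_mono N.finite_measure_mono)
      moreover have "\<bar>measure M ?U - measure N ?U\<bar> \<le> c"
        using U1 U2 by (intro 2) auto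
      ultimately show "\<bar>measure M A - measure N A\<bar> \<le> c + e"
        using U1(3) U2(3) by linarith
    qed
    then have "tvd M N \<le> c" by (intro tvd_leI) auto
    moreover have "c \<le> tvd M N"
      unfolding c_def using ne bU by (intro cSUP_least tvd_upper M N) auto
    ultimately show ?thesis unfolding c_def by simp
  qed
  with cU ne bU show ?thesis by blast
qed

lemma measurable_tvd:
  fixes k l :: "'b \<Rightarrow> 'a::polish_space measure"
  assumes k [measurable]: "k \<in> M \<rightarrow>\<^sub>M prob_algebra borel" and l [measurable]: "l \<in> M \<rightarrow>\<^sub>M prob_algebra borel"
  shows "(\<lambda>x. tvd (k x) (l x)) \<in> borel_measurable M"
proof -
  obtain \<U> :: "'a set set" where U: "countable \<U>" "\<U> \<subseteq> sets borel"
    and eq: "\<And>M N. prob_space M \<Longrightarrow> prob_space N \<Longrightarrow> sets M = sets borel \<Longrightarrow> sets N = sets borel \<Longrightarrow>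
      tvd M N = (SUP U\<in>\<U>. \<bar>measure M U - measure N U\<bar>)"
    using ex_countable_tvd_family by blast
  have "(\<lambda>x. SUP U\<in>\<U>. \<bar>measure (k x) U - measure (l x) U\<bar>) \<in> borel_measurable M"
  proof (rule borel_measurable_cSUP[OF U(1)])
    fix A assume "A \<in> \<U>"
    then have [measurable]: "A \<in> sets borel" using U by auto
    show "(\<lambda>x. \<bar>measure (k x) A - measure (l x) A\<bar>) \<in> borel_measurable M" by measurable
  next
    fix x assume "x \<in> space M"
    then show "bdd_above ((\<lambda>A. \<bar>measure (k x) A - measure (l x) A\<bar>) ` \<U>)"
      using prob_kernelD(1)[OF k] prob_kernelD(1)[OF l] by (intro bdd_above_tvd)
  qed
  then show ?thesis
    by (rule measurable_cong[THEN iffD2, rotated])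
       (intro eq prob_kernelD[OF k] prob_kernelD[OF l]; assumption)
qed

section \<open>Densities, common part and excess parts\<close>

lemma obtain_common_density:
  assumes M: "prob_space M" and N: "prob_space N" and MN: "sets M = sets N"
  obtains \<rho> p q where "prob_space \<rho>" "sets \<rho> = sets M"
    "p \<in> borel_measurable \<rho>" "\<And>x. 0 \<le> p x" "M = density \<rho> (\<lambda>x. ennreal (p x))"
    "q \<in> borel_measurable \<rho>" "\<And>x. 0 \<le> q x" "N = density \<rho> (\<lambda>x. ennreal (q x))"
proof -
  interpret M: prob_space M by (rule M)
  interpret N: prob_space N by (rule N)
  \<comment> \<open>The even mixture dominates both measures. Written as a bind over a fair coin, it
    is a probability measure at once.\<close>
  let ?b = "measure_pmf (bernoulli_pmf (1/2))" and ?k = "\<lambda>b. if b then M else N"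
  define \<rho> where "\<rho> = ?b \<bind> ?k"
  have k: "?k \<in> count_space UNIV \<rightarrow>\<^sub>M prob_algebra M"
    using M N MN by (auto simp: space_prob_algebra)
  have b: "?b \<in> space (prob_algebra (count_space UNIV))"
    by (simp add: space_prob_algebra measure_pmf.prob_space_axioms)
  have \<rho>: "prob_space \<rho>" "sets \<rho> = sets M"
    unfolding \<rho>_def by (rule prob_space_bind'[OF b k], rule sets_bind'[OF b k])
  interpret \<rho>: prob_space \<rho> by (rule \<rho>)
  have e: "emeasure \<rho> A = ennreal (1/2) * emeasure M A + ennreal (1/2) * emeasure N A" if "A \<in> sets M" for A
    unfolding \<rho>_def emeasure_bind_prob_algebra[OF b k that]
    by (subst nn_integral_bernoulli_pmf) (auto simp: mult.commute)
  have 1: "\<exists>p. p \<in> borel_measurable \<rho> \<and> (\<forall>x. 0 \<le> p x) \<and> M' = density \<rho> (\<lambda>x. ennreal (p x))"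
    if ac: "absolutely_continuous \<rho> M'" "sets M' = sets \<rho>" "finite_measure M'" for M'
  proof -
    obtain D where "D \<in> borel_measurable \<rho>" "AE x in \<rho>. RN_deriv \<rho> M' x = ennreal (D x)" "\<And>x. 0 \<le> D x"
      using \<rho>.real_RN_deriv[OF ac(3) ac(1,2)] by metis
    moreover from this have "M' = density \<rho> (\<lambda>x. ennreal (D x))"
      using \<rho>.density_RN_deriv[OF ac(1,2)] by (subst (asm) density_cong) auto
    ultimately show ?thesis by auto
  qed
  have "absolutely_continuous \<rho> M" "absolutely_continuous \<rho> N"
    unfolding absolutely_continuous_def null_sets_def using e \<rho>(2) MN by (auto simp: add_eq_0_iff_both_eq_0)
  from 1[OF this(1)] 1[OF this(2)] \<rho> MN M.finite_measure_axioms N.finite_measure_axioms that show thesis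
    by auto
qed

locale density_pair = \<rho>: prob_space \<rho> for \<rho> :: "'a measure" +
  fixes p q :: "'a \<Rightarrow> real" and M N :: "'a measure"
  assumes p [measurable]: "p \<in> borel_measurable \<rho>" and p0: "\<And>x. 0 \<le> p x"
    and q [measurable]: "q \<in> borel_measurable \<rho>" and q0: "\<And>x. 0 \<le> q x"
    and M: "M = density \<rho> (\<lambda>x. ennreal (p x))" and N: "N = density \<rho> (\<lambda>x. ennreal (q x))"
    and prob_M: "prob_space M" and prob_N: "prob_space N"
begin

sublocale M: prob_space M by (rule prob_M)
sublocale N: prob_space N by (rule prob_N)

text \<open>\<open>u\<close> and \<open>v\<close> are the excesses of the two densities over their
  common part. Both have the same mass \<open>a\<close>, because both densities integrate to 1; this
  mass turns out to be the total variation distance.\<close>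

definition "u x = p x - min (p x) (q x)"
definition "v x = q x - min (p x) (q x)"
definition "a = (\<integral>x. u x \<partial>\<rho>)"

lemma uv [measurable]: "u \<in> borel_measurable \<rho>" "v \<in> borel_measurable \<rho>"
  unfolding u_def [abs_def] v_def [abs_def] by measurable

lemma uv0: "0 \<le> u x" "0 \<le> v x" "u x \<le> p x" "v x \<le> q x"
  using p0 q0 by (auto simp: u_def v_def min_def)

lemma int_p: "integrable \<rho> p" "(\<integral>x. p x \<partial>\<rho>) = 1"
proof -
  have "(\<integral>\<^sup>+x. ennreal (p x) \<partial>\<rho>) = emeasure M (space M)"
    unfolding M by (subst emeasure_density) (auto intro!: nn_integral_cong)
  then have *: "(\<integral>\<^sup>+x. ennreal (p x) \<partial>\<rho>) = 1" using M.emeasure_space_1 by simp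
  then show "integrable \<rho> p" using p0 by (intro integrableI_nonneg) auto
  then show "(\<integral>x. p x \<partial>\<rho>) = 1" using * p0 by (subst integral_eq_nn_integral) auto
qed

lemma int_q: "integrable \<rho> q" "(\<integral>x. q x \<partial>\<rho>) = 1"
proof -
  have "(\<integral>\<^sup>+x. ennreal (q x) \<partial>\<rho>) = emeasure N (space N)"
    unfolding N by (subst emeasure_density) (auto intro!: nn_integral_cong)
  then have *: "(\<integral>\<^sup>+x. ennreal (q x) \<partial>\<rho>) = 1" using N.emeasure_space_1 by simp
  then show "integrable \<rho> q" using q0 by (intro integrableI_nonneg) auto
  then show "(\<integral>x. q x \<partial>\<rho>) = 1" using * q0 by (subst integral_eq_nn_integral) auto
qed

lemma int_uv: "integrable \<rho> u" "integrable \<rho> v"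
  using uv0 p0 q0
  by (auto intro: Bochner_Integration.integrable_bound[OF int_p(1)] Bochner_Integration.integrable_bound[OF int_q(1)])

lemma int_min: "integrable \<rho> (\<lambda>x. min (p x) (q x))"
  using Bochner_Integration.integrable_diff[OF int_p(1) int_uv(1)] by (simp add: u_def)

lemma a_v: "a = (\<integral>x. v x \<partial>\<rho>)"
  unfolding a_def u_def v_def using int_p int_q int_min by simp

lemma a_eq: "a = 1 - (\<integral>x. min (p x) (q x) \<partial>\<rho>)"
  unfolding a_def u_def using int_p int_min by simp

lemma a_nonneg: "0 \<le> a" unfolding a_def by (rule Bochner_Integration.integral_nonneg) (rule uv0)

lemma int_mult:
  fixes f h :: "'a \<Rightarrow> real"
  assumes [measurable]: "h \<in> borel_measurable \<rho>" and h: "\<And>x. \<bar>h x\<bar> \<le> 1" and f: "integrable \<rho> f"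
  shows "integrable \<rho> (\<lambda>x. f x * h x)"
proof (rule Bochner_Integration.integrable_bound[OF f])
  show "(\<lambda>x. f x * h x) \<in> borel_measurable \<rho>" using f by measurable
  show "AE x in \<rho>. norm (f x * h x) \<le> norm (f x)"
    using mult_left_mono[OF h, of "\<bar>f _\<bar>"] by (auto simp: abs_mult)
qed

lemma integral_diff:
  assumes h [measurable]: "h \<in> borel_measurable \<rho>" and h1: "\<And>x. \<bar>h x\<bar> \<le> 1"
  shows "(\<integral>x. h x \<partial>M) - (\<integral>x. h x \<partial>N) = (\<integral>x. u x * h x \<partial>\<rho>) - (\<integral>x. v x * h x \<partial>\<rho>)"
proof -
  note i = int_mult[OF h h1]
  have "(\<integral>x. h x \<partial>M) - (\<integral>x. h x \<partial>N) = (\<integral>x. p x * h x \<partial>\<rho>) - (\<integral>x. q x * h x \<partial>\<rho>)"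
    unfolding M N using p0 q0 by (simp add: integral_density)
  also have "\<dots> = (\<integral>x. p x * h x - q x * h x \<partial>\<rho>)"
    using i[OF int_p(1)] i[OF int_q(1)] by simp
  also have "\<dots> = (\<integral>x. u x * h x - v x * h x \<partial>\<rho>)"
    by (intro Bochner_Integration.integral_cong) (auto simp: u_def v_def algebra_simps)
  also have "\<dots> = (\<integral>x. u x * h x \<partial>\<rho>) - (\<integral>x. v x * h x \<partial>\<rho>)"
    using i[OF int_uv(1)] i[OF int_uv(2)] by simp
  finally show ?thesis .
qed

text \<open>Once the common part has cancelled, each of the two remaining integrals lies between 0
  and \<open>a\<close>.\<close>

lemma integral_diff_le_a:
  assumes [measurable]: "h \<in> borel_measurable \<rho>" and h: "\<And>x. 0 \<le> h x" "\<And>x. h x \<le> 1"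
  shows "\<bar>(\<integral>x. h x \<partial>M) - (\<integral>x. h x \<partial>N)\<bar> \<le> a"
proof -
  have h': "\<bar>h x\<bar> \<le> 1" for x using h[of x] by simp
  have "0 \<le> (\<integral>x. u x * h x \<partial>\<rho>)" "0 \<le> (\<integral>x. v x * h x \<partial>\<rho>)"
    using uv0 h by (auto intro!: Bochner_Integration.integral_nonneg)
  moreover have "(\<integral>x. u x * h x \<partial>\<rho>) \<le> a" unfolding a_def
    using uv0 h h' int_uv by (intro integral_mono int_mult) (auto intro: mult_left_le)
  moreover have "(\<integral>x. v x * h x \<partial>\<rho>) \<le> a" unfolding a_v
    using uv0 h h' int_uv by (intro integral_mono int_mult) (auto intro: mult_left_le)
  ultimately show ?thesis
    unfolding integral_diff[OF assms(1) h'] by linarith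
qed

text \<open>The set where \<open>q\<close> is smaller than \<open>p\<close> attains the supremum:
  all of the mass of \<open>u\<close> sits there and \<open>v\<close> vanishes there.\<close>

lemma a_le_tvd: "a \<le> tvd M N"
proof -
  define A where "A = {x \<in> space \<rho>. q x < p x}"
  have A [measurable]: "A \<in> sets \<rho>" unfolding A_def by measurable
  have AM: "A \<in> sets M" unfolding M by simp
  have "measure M A - measure N A = (\<integral>x. indicator A x \<partial>M) - (\<integral>x. indicator A x \<partial>N)"
    unfolding M N using sets.sets_into_space[OF A] by (simp add: Int_absorb2)
  also have "\<dots> = (\<integral>x. u x * indicator A x \<partial>\<rho>) - (\<integral>x. v x * indicator A x \<partial>\<rho>)"
    by (rule integral_diff) (auto split: split_indicator)
  also have "(\<integral>x. u x * indicator A x \<partial>\<rho>) = a"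
    unfolding a_def by (intro Bochner_Integration.integral_cong) (auto simp: u_def A_def split: split_indicator)
  also have "(\<integral>x. v x * indicator A x \<partial>\<rho>) = (\<integral>x. 0 \<partial>\<rho>)"
    by (intro Bochner_Integration.integral_cong) (auto simp: v_def A_def split: split_indicator)
  finally have "a = measure M A - measure N A" by simp
  also have "\<dots> \<le> tvd M N" using tvd_upper[OF prob_M prob_N AM] by simp
  finally show ?thesis .
qed

lemma prob_space_density_part:
  assumes f: "integrable \<rho> f" "\<And>x. 0 \<le> f x" "(\<integral>x. f x \<partial>\<rho>) = a" and a: "a \<noteq> 0"
  shows "prob_space (density \<rho> (\<lambda>x. ennreal (f x / a)))"
proof
  have "(\<integral>\<^sup>+x. ennreal (f x / a) \<partial>\<rho>) = ennreal (\<integral>x. f x / a \<partial>\<rho>)"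
    using f a_nonneg by (intro nn_integral_eq_integral) auto
  then have "(\<integral>\<^sup>+x. ennreal (f x / a) \<partial>\<rho>) = 1"
    using f(3) a by simp
  moreover have "(\<lambda>x. ennreal (f x / a)) \<in> borel_measurable \<rho>"
    using f(1) by measurable
  ultimately show "emeasure (density \<rho> (\<lambda>x. ennreal (f x / a))) (space (density \<rho> (\<lambda>x. ennreal (f x / a)))) = 1"
    by (simp add: emeasure_density cong: nn_integral_cong)
qed

text \<open>The off-diagonal half of a maximal coupling: \<open>U\<close> and \<open>V\<close> are
  the normalised excesses and \<open>c\<close> is their mass. Non-singularity is what makes
  \<open>c\<close> smaller than 1. Absolute continuity is recorded because almost sure statements
  about \<open>M\<close> and \<open>N\<close> have to be carried over to \<open>U\<close> and
  \<open>V\<close>.\<close>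

lemma disjoint_parts:
  assumes ns: "\<not> mutually_singular M N"
  shows "\<exists>U V c. prob_space U \<and> prob_space V \<and> sets U = sets M \<and> sets V = sets N \<and>
    absolutely_continuous M U \<and> absolutely_continuous N V \<and> 0 \<le> c \<and> c < (1::real) \<and>
    (\<forall>h\<in>borel_measurable \<rho>. (\<forall>x. \<bar>h x\<bar> \<le> 1) \<longrightarrow>
      (\<integral>x. h x \<partial>M) - (\<integral>x. h x \<partial>N) = c * ((\<integral>x. h x \<partial>U) - (\<integral>x. h x \<partial>V)))"
proof -
  have a1: "a < 1"
  proof (rule ccontr)
    assume "\<not> a < 1"
    moreover have "0 \<le> (\<integral>x. min (p x) (q x) \<partial>\<rho>)"
      using p0 q0 by (intro Bochner_Integration.integral_nonneg) auto
    ultimately have "(\<integral>x. min (p x) (q x) \<partial>\<rho>) = 0" unfolding a_eq by simp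
    then have 0: "AE x in \<rho>. min (p x) (q x) = 0"
      using p0 q0 int_min by (subst (asm) integral_nonneg_eq_0_iff_AE) auto
    \<comment> \<open>With no common mass the densities live on disjoint sets up to a null set, and
      this set separates the measures.\<close>
    define A where "A = {x \<in> space \<rho>. p x = 0}"
    have A [measurable]: "A \<in> sets \<rho>" unfolding A_def by measurable
    have "emeasure M A = (\<integral>\<^sup>+x. ennreal (p x) * indicator A x \<partial>\<rho>)"
      unfolding M by (subst emeasure_density) auto
    also have "\<dots> = (\<integral>\<^sup>+x. 0 \<partial>\<rho>)"
      by (intro nn_integral_cong) (auto simp: A_def split: split_indicator)
    finally have "emeasure M A = (\<integral>\<^sup>+x. 0 \<partial>\<rho>)" .
    moreover have "emeasure N (space M - A) = (\<integral>\<^sup>+x. 0 \<partial>\<rho>)"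
    proof -
      have "emeasure N (space M - A) = (\<integral>\<^sup>+x. ennreal (q x) * indicator (space \<rho> - A) x \<partial>\<rho>)"
        unfolding M N by (subst emeasure_density) auto
      also have "\<dots> = (\<integral>\<^sup>+x. 0 \<partial>\<rho>)"
        using 0 p0 q0 by (intro nn_integral_cong_AE) (auto simp: A_def min_def split: split_indicator if_splits)
      finally show ?thesis .
    qed
    ultimately have "mutually_singular M N"
      unfolding mutually_singular_def by (intro bexI[of _ A]) (auto simp: M)
    with ns show False by simp
  qed
  show ?thesis
  proof (cases "a = 0")
    \<comment> \<open>Without excess the two measures integrate bounded functions alike, so any two
      laws serve, with factor 0; the normalisation by \<open>a\<close> would divide by zero.\<close>
    case True
    have "(\<integral>x. h x \<partial>M) - (\<integral>x. h x \<partial>N) = 0" if h: "h \<in> borel_measurable \<rho>" "\<And>x. \<bar>h x\<bar> \<le> 1" for h :: "'a \<Rightarrow> real"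
    proof -
      have "AE x in \<rho>. u x = 0" using True uv0 int_uv unfolding a_def
        by (subst (asm) integral_nonneg_eq_0_iff_AE) auto
      then have "(\<integral>x. u x * h x \<partial>\<rho>) = (\<integral>x. 0 \<partial>\<rho>)"
        using h by (intro integral_cong_AE) auto
      moreover have "AE x in \<rho>. v x = 0" using True uv0 int_uv unfolding a_v
        by (subst (asm) integral_nonneg_eq_0_iff_AE) auto
      then have "(\<integral>x. v x * h x \<partial>\<rho>) = (\<integral>x. 0 \<partial>\<rho>)"
        using h by (intro integral_cong_AE) auto
      ultimately show ?thesis unfolding integral_diff[OF h] by simp
    qed
    then show ?thesis using prob_M prob_N
      by (intro exI[of _ M] exI[of _ N] exI[of _ 0]) (auto simp: absolutely_continuous_def)
  next
    case False
    with a_nonneg have a: "0 < a" by simp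
    let ?U = "density \<rho> (\<lambda>x. ennreal (u x / a))" and ?V = "density \<rho> (\<lambda>x. ennreal (v x / a))"
    have 1: "(\<integral>x. h x \<partial>M) - (\<integral>x. h x \<partial>N) = a * ((\<integral>x. h x \<partial>?U) - (\<integral>x. h x \<partial>?V))"
      if h [measurable]: "h \<in> borel_measurable \<rho>" "\<And>x. \<bar>h x\<bar> \<le> 1" for h :: "'a \<Rightarrow> real"
      unfolding integral_diff[OF h] using uv0 a by (simp add: integral_density field_simps)
    have "emeasure ?U A = 0" if A: "A \<in> sets \<rho>" "emeasure M A = 0" for A
    proof -
      have "AE x in \<rho>. x \<in> A \<longrightarrow> ennreal (p x) = 0"
        using A p0 unfolding M by (subst (asm) emeasure_density)
          (auto simp: nn_integral_0_iff_AE split: split_indicator)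
      then have "AE x in \<rho>. x \<in> A \<longrightarrow> u x = 0"
        by eventually_elim (metis ennreal_eq_0_iff order_antisym_conv order_trans uv0(1,3))
      then show ?thesis
        using A by (subst emeasure_density) (auto simp: nn_integral_0_iff_AE split: split_indicator)
    qed
    moreover have "emeasure ?V A = 0" if A: "A \<in> sets \<rho>" "emeasure N A = 0" for A
    proof -
      have "AE x in \<rho>. x \<in> A \<longrightarrow> ennreal (q x) = 0"
        using A q0 unfolding N by (subst (asm) emeasure_density)
          (auto simp: nn_integral_0_iff_AE split: split_indicator)
      then have "AE x in \<rho>. x \<in> A \<longrightarrow> v x = 0"
        by eventually_elim (metis ennreal_eq_0_iff order_antisym_conv order_trans uv0(2,4))
      then show ?thesis
        using A by (subst emeasure_density) (auto simp: nn_integral_0_iff_AE split: split_indicator)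
    qed
    ultimately have "absolutely_continuous M ?U" "absolutely_continuous N ?V"
      by (auto simp: absolutely_continuous_def null_sets_def M N)
    moreover have "prob_space ?U" "prob_space ?V"
      by (rule prob_space_density_part[OF int_uv(1) uv0(1) a_def[symmetric] False],
          rule prob_space_density_part[OF int_uv(2) uv0(2) a_v[symmetric] False])
    ultimately show ?thesis using 1 a a1
      by (intro exI[of _ ?U] exI[of _ ?V] exI[of _ a]) (auto simp: M N)
  qed
qed

end

text \<open>Passes from events to functions with values in the unit interval without losing a
  factor. Contraction under kernels and the bound for tail events both depend on this constant being
  1.\<close>

lemma abs_integral_diff_le_tvd:
  assumes M: "prob_space M" and N: "prob_space N" and MN: "sets M = sets N"
    and h: "h \<in> borel_measurable M" "\<And>x. 0 \<le> h x" "\<And>x. h x \<le> 1"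
  shows "\<bar>(\<integral>x. h x \<partial>M) - (\<integral>x. h x \<partial>N)\<bar> \<le> tvd M N"
proof -
  from obtain_common_density[OF M N MN] obtain \<rho> p q where d: "prob_space \<rho>" "sets \<rho> = sets M"
    "p \<in> borel_measurable \<rho>" "\<And>x. 0 \<le> p x" "M = density \<rho> (\<lambda>x. ennreal (p x))"
    "q \<in> borel_measurable \<rho>" "\<And>x. 0 \<le> q x" "N = density \<rho> (\<lambda>x. ennreal (q x))" by metis
  interpret density_pair \<rho> p q M N
    using d M N by (intro density_pair.intro density_pair_axioms.intro)
  have "h \<in> borel_measurable \<rho>" using h(1) measurable_cong_sets[OF d(2) refl] by blast
  from integral_diff_le_a[OF this h(2,3)] a_le_tvd show ?thesis by linarith
qed

lemma ex_disjoint_parts: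
  assumes M: "prob_space M" and N: "prob_space N" and MN: "sets M = sets N" and ns: "\<not> mutually_singular M N"
  obtains U V c where "prob_space U" "prob_space V" "sets U = sets M" "sets V = sets M"
    "absolutely_continuous M U" "absolutely_continuous N V" "0 \<le> c" "c < (1::real)"
    "\<And>h. h \<in> borel_measurable M \<Longrightarrow> (\<And>x. \<bar>h x\<bar> \<le> 1) \<Longrightarrow>
      (\<integral>x. h x \<partial>M) - (\<integral>x. h x \<partial>N) = c * ((\<integral>x. h x \<partial>U) - (\<integral>x. h x \<partial>V))"
proof -
  from obtain_common_density[OF M N MN] obtain \<rho> p q where d: "prob_space \<rho>" "sets \<rho> = sets M"
    "p \<in> borel_measurable \<rho>" "\<And>x. 0 \<le> p x" "M = density \<rho> (\<lambda>x. ennreal (p x))"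
    "q \<in> borel_measurable \<rho>" "\<And>x. 0 \<le> q x" "N = density \<rho> (\<lambda>x. ennreal (q x))" by metis
  interpret density_pair \<rho> p q M N
    using d M N by (intro density_pair.intro density_pair_axioms.intro)
  have *: "borel_measurable \<rho> = (borel_measurable M :: ('a \<Rightarrow> real) set)"
    using d(2) by (rule measurable_cong_sets) simp
  show thesis
    using disjoint_parts[OF ns] MN unfolding * by (auto intro: that)
qed

lemma tv_dist_le_tvd:
  assumes M: "prob_space M" and N: "prob_space N" and MN: "sets M = sets N"
  shows "tv_dist M N \<le> 2 * tvd M N"
proof -
  interpret M: prob_space M by (rule M)
  interpret N: prob_space N by (rule N)
  note sp = sets_eq_imp_space_eq[OF MN]
  note cg = measurable_cong_sets[OF MN refl]
  show ?thesis unfolding tv_dist_def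
  proof (intro cSUP_least)
    show "{f \<in> borel_measurable M. \<forall>x\<in>space M. \<bar>f x\<bar> \<le> (1::real)} \<noteq> {}"
      by (auto intro!: exI[of _ "\<lambda>_. 0"])
    fix f :: "'a \<Rightarrow> real" assume "f \<in> {f \<in> borel_measurable M. \<forall>x\<in>space M. \<bar>f x\<bar> \<le> 1}"
    then have f [measurable]: "f \<in> borel_measurable M" and f1: "\<And>x. x \<in> space M \<Longrightarrow> \<bar>f x\<bar> \<le> 1" by auto
    have [measurable]: "f \<in> borel_measurable N" using f unfolding cg .
    \<comment> \<open>The affine map carries test functions bounded by 1 to functions into the unit
      interval and halves the difference of the integrals. The value 0 off the space makes the
      bounds hold everywhere.\<close>
    define h where "h x = (if x \<in> space M then (f x + 1) / 2 else 0)" for x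
    have h: "h \<in> borel_measurable M" unfolding h_def [abs_def] by measurable
    have h01: "0 \<le> h x" "h x \<le> 1" for x using f1[of x] by (auto simp: h_def abs_le_iff)
    have i: "integrable M f" "integrable N f"
      using f1 sp by (auto intro!: M.integrable_const_bound[where B=1] N.integrable_const_bound[where B=1])
    have "(\<integral>x. h x \<partial>M) = (\<integral>x. (f x + 1) / 2 \<partial>M)" "(\<integral>x. h x \<partial>N) = (\<integral>x. (f x + 1) / 2 \<partial>N)"
      by (rule Bochner_Integration.integral_cong[OF refl], simp add: h_def sp)+
    then have "(\<integral>x. f x \<partial>M) - (\<integral>x. f x \<partial>N) = 2 * ((\<integral>x. h x \<partial>M) - (\<integral>x. h x \<partial>N))"
      using i M.prob_space N.prob_space by (simp add: field_simps)
    with abs_integral_diff_le_tvd[OF M N MN h h01]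
    show "\<bar>(\<integral>x. f x \<partial>M) - (\<integral>x. f x \<partial>N)\<bar> \<le> 2 * tvd M N"
      by (simp add: abs_mult)
  qed
qed

lemma tvd_le_tv_dist:
  assumes M: "prob_space M" and N: "prob_space N" and MN: "sets M = sets N"
  shows "tvd M N \<le> tv_dist M N"
proof (rule tvd_leI)
  interpret M: prob_space M by (rule M)
  interpret N: prob_space N by (rule N)
  note sp = sets_eq_imp_space_eq[OF MN]
  note cg = measurable_cong_sets[OF MN refl]
  fix A assume A: "A \<in> sets M"
  have b: "\<bar>\<integral>x. f x \<partial>M\<bar> \<le> 1" "\<bar>\<integral>x. f x \<partial>N\<bar> \<le> 1" if "f \<in> borel_measurable M" "\<forall>x\<in>space M. \<bar>f x\<bar> \<le> 1" for f :: "'a \<Rightarrow> real"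
  proof -
    have "integrable M f" "integrable N f"
      using that sp cg by (auto intro!: M.integrable_const_bound[where B=1] N.integrable_const_bound[where B=1])
    moreover have "f x \<le> 1" "-1 \<le> f x" if "x \<in> space M" for x
      using \<open>\<forall>x\<in>space M. \<bar>f x\<bar> \<le> 1\<close> that by (auto simp: abs_le_iff minus_le_iff)
    ultimately show "\<bar>\<integral>x. f x \<partial>M\<bar> \<le> 1" "\<bar>\<integral>x. f x \<partial>N\<bar> \<le> 1" using sp
      by (auto simp: abs_le_iff minus_le_iff intro!: M.integral_le_const N.integral_le_const M.integral_ge_const N.integral_ge_const)
  qed
  have "\<bar>(\<integral>x. indicator A x \<partial>M) - (\<integral>x. indicator A x \<partial>N)\<bar> \<le> tv_dist M N"
    unfolding tv_dist_def
  proof (rule cSUP_upper)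
    show "indicator A \<in> {f \<in> borel_measurable M. \<forall>x\<in>space M. \<bar>f x\<bar> \<le> (1::real)}"
      using A by (auto split: split_indicator)
    show "bdd_above ((\<lambda>f. \<bar>(\<integral>x. f x \<partial>M) - (\<integral>x. f x \<partial>N)\<bar>) ` {f \<in> borel_measurable M. \<forall>x\<in>space M. \<bar>f x\<bar> \<le> (1::real)})"
      by (rule bdd_aboveI2[where M=2]) (use b abs_triangle_ineq4 in fastforce)
  qed
  moreover have "A \<inter> space M = A" "A \<inter> space N = A"
    using A sp sets.sets_into_space by auto
  ultimately show "\<bar>measure M A - measure N A\<bar> \<le> tv_dist M N" by simp
qed

section \<open>Markov chains in random environments\<close>

lemma measurable_shift_path [measurable]: "shift_path n \<in> path_space \<rightarrow>\<^sub>M path_space"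
  unfolding shift_path_def [abs_def] by (rule measurable_PiM_single') (auto simp: space_PiM)

definition env_kernel :: "('e \<Rightarrow> (int \<Rightarrow> 'f) \<Rightarrow> 'e measure) \<Rightarrow> (int \<Rightarrow> 'f) \<Rightarrow> nat \<Rightarrow> 'e \<Rightarrow> 'e measure" where
  "env_kernel PX y i x = PX x (shift_path (int i) y)"

definition quenched_marginal ::
  "('e::topological_space \<Rightarrow> (int \<Rightarrow> 'f) \<Rightarrow> 'e measure) \<Rightarrow> nat \<Rightarrow> 'e \<Rightarrow> (int \<Rightarrow> 'f) \<Rightarrow> 'e measure" where
  "quenched_marginal PX n z y = iter_kernel n (env_kernel PX y) z"

text \<open>All the time-inhomogeneity sits in the environment, so restarting the chain at time
  \<open>n\<close> amounts to shifting the environment by \<open>n\<close>.\<close>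

lemma env_kernel_shift: "(\<lambda>i. env_kernel PX y (i + n)) = env_kernel PX (shift_path (int n) y)"
  by (simp add: env_kernel_def fun_eq_iff shift_path_add)

lemma env_kernel_Suc: "(\<lambda>i. env_kernel PX y (Suc i)) = env_kernel PX (shift_path 1 y)"
  using env_kernel_shift[of PX y 1] by simp

text \<open>The function D of the overview. \<open>lim\<close> is meaningful here because the
  distances decrease in \<open>n\<close>, as shown in \<open>tendsto_merging\<close>.\<close>

definition merging ::
  "('e::topological_space \<Rightarrow> (int \<Rightarrow> 'f) \<Rightarrow> 'e measure) \<Rightarrow> 'e \<Rightarrow> 'e \<Rightarrow> (int \<Rightarrow> 'f) \<Rightarrow> real" where
  "merging PX z z' y = lim (\<lambda>n. tvd (quenched_marginal PX n z y) (quenched_marginal PX n z' y))"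

section \<open>Contraction and coupling bounds for kernels\<close>

lemma measure_bind_kernel:
  assumes M: "M \<in> space (prob_algebra N)" and k: "k \<in> N \<rightarrow>\<^sub>M prob_algebra L" and A: "A \<in> sets L"
  shows "measure (M \<bind> k) A = (\<integral>x. measure (k x) A \<partial>M)"
proof -
  have sM: "sets M = sets N" "prob_space M" using M by (auto simp: space_prob_algebra)
  then interpret prob_space M by simp
  interpret subprob_space M by unfold_locales
  have "k \<in> M \<rightarrow>\<^sub>M subprob_algebra L"
    using measurable_prob_algebraD[OF k] sM(1) by (simp cong: measurable_cong_sets)
  then show ?thesis using A by (rule measure_bind)
qed

lemma measurable_measure_kernel:
  assumes M: "M \<in> space (prob_algebra N)" and k [measurable]: "k \<in> N \<rightarrow>\<^sub>M prob_algebra L" and [measurable]: "A \<in> sets L"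
  shows "(\<lambda>x. measure (k x) A) \<in> borel_measurable M"
proof -
  have "(\<lambda>x. measure (k x) A) \<in> borel_measurable N" by measurable
  moreover have "sets M = sets N" using M by (simp add: space_prob_algebra)
  ultimately show ?thesis by (simp cong: measurable_cong_sets)
qed

text \<open>An event tested after the kernel is a function into the unit interval tested before
  it.\<close>

lemma tvd_bind_le:
  fixes k :: "'a::polish_space \<Rightarrow> 'b::polish_space measure"
  assumes M: "M \<in> space (prob_algebra borel)" and N: "N \<in> space (prob_algebra borel)"
    and k: "k \<in> borel \<rightarrow>\<^sub>M prob_algebra borel"
  shows "tvd (M \<bind> k) (N \<bind> k) \<le> tvd M N"
proof (rule tvd_leI)
  fix A assume "A \<in> sets (M \<bind> k)"
  then have A: "A \<in> sets borel" unfolding sets_bind'[OF M k] .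
  have "prob_space (k x)" for x using prob_kernelD(1)[OF k, of x] by simp
  then show "\<bar>measure (M \<bind> k) A - measure (N \<bind> k) A\<bar> \<le> tvd M N"
    unfolding measure_bind_kernel[OF M k A] measure_bind_kernel[OF N k A]
    using M N by (intro abs_integral_diff_le_tvd measurable_measure_kernel[OF M k A])
      (auto simp: space_prob_algebra prob_space.prob_le_1)
qed

text \<open>Whatever \<open>M\<close> and \<open>N\<close> have in common cancels; the rest is
  \<open>c\<close> times the difference of \<open>U\<close> and \<open>V\<close>, and these are
  coupled independently. The product coupling is chosen because it lets almost sure statements be
  checked one coordinate at a time.\<close>

lemma tvd_bind_le_coupling:
  fixes k :: "'a::polish_space \<Rightarrow> 'b::polish_space measure"
  assumes M: "M \<in> space (prob_algebra borel)" and N: "N \<in> space (prob_algebra borel)"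
    and U: "U \<in> space (prob_algebra borel)" and V: "V \<in> space (prob_algebra borel)"
    and k: "k \<in> borel \<rightarrow>\<^sub>M prob_algebra borel" and c: "0 \<le> c"
    and eq: "\<And>h. h \<in> borel_measurable borel \<Longrightarrow> (\<And>x. \<bar>h x\<bar> \<le> 1) \<Longrightarrow>
      (\<integral>x. h x \<partial>M) - (\<integral>x. h x \<partial>N) = c * ((\<integral>x. h x \<partial>U) - (\<integral>x. h x \<partial>V) :: real)"
  shows "tvd (M \<bind> k) (N \<bind> k) \<le> c * (\<integral>w. tvd (k (fst w)) (k (snd w)) \<partial>(U \<Otimes>\<^sub>M V))"
proof (rule tvd_leI)
  have sU [measurable_cong]: "sets U = sets borel" and sV [measurable_cong]: "sets V = sets borel"
    and pU: "prob_space U" and pV: "prob_space V"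
    using U V by (auto simp: space_prob_algebra)
  interpret U: prob_space U by (rule pU)
  interpret V: prob_space V by (rule pV)
  interpret UV: pair_prob_space U V ..
  have pk: "prob_space (k x)" "sets (k x) = sets borel" for x using prob_kernelD(1,2)[OF k, of x] by simp_all
  fix A assume "A \<in> sets (M \<bind> k)"
  then have A: "A \<in> sets borel" unfolding sets_bind'[OF M k] .
  define h where "h x = measure (k x) A" for x
  have h [measurable]: "h \<in> borel_measurable borel" unfolding h_def using k A by measurable
  have h1: "\<bar>h x\<bar> \<le> 1" for x using pk by (simp add: h_def prob_space.prob_le_1)
  have [measurable]: "(\<lambda>w. tvd (k (fst w)) (k (snd w))) \<in> borel_measurable (U \<Otimes>\<^sub>M V)"
    by (intro measurable_tvd measurable_compose[OF _ k]) measurable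
  have i: "integrable (U \<Otimes>\<^sub>M V) (\<lambda>w. h (fst w))" "integrable (U \<Otimes>\<^sub>M V) (\<lambda>w. h (snd w))"
    "integrable (U \<Otimes>\<^sub>M V) (\<lambda>w. tvd (k (fst w)) (k (snd w)))"
    using h1 tvd_le_1[OF pk(1) pk(1)] tvd_nonneg[OF pk(1) pk(1)]
    by (auto intro!: UV.integrable_const_bound[where B=1])
  have "(\<integral>x. h x \<partial>U) - (\<integral>x. h x \<partial>V) = (\<integral>w. h (fst w) \<partial>(U \<Otimes>\<^sub>M V)) - (\<integral>w. h (snd w) \<partial>(U \<Otimes>\<^sub>M V))"
  proof -
    have "distr (U \<Otimes>\<^sub>M V) V snd = V"
    proof (rule measure_eqI)
      fix A assume "A \<in> sets (distr (U \<Otimes>\<^sub>M V) V snd)"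
      then have A: "A \<in> sets V" by simp
      then have "snd -` A \<inter> space (U \<Otimes>\<^sub>M V) = space U \<times> A"
        by (auto simp: space_pair_measure dest: sets.sets_into_space)
      with A show "emeasure (distr (U \<Otimes>\<^sub>M V) V snd) A = emeasure V A"
        by (simp add: emeasure_distr V.emeasure_pair_measure_Times U.emeasure_space_1)
    qed simp
    then have "(\<integral>x. h x \<partial>V) = (\<integral>w. h (snd w) \<partial>(U \<Otimes>\<^sub>M V))"
      using integral_distr[of snd "U \<Otimes>\<^sub>M V" V h] by simp
    moreover have "(\<integral>x. h x \<partial>U) = (\<integral>w. h (fst w) \<partial>(U \<Otimes>\<^sub>M V))"
      using integral_distr[of fst "U \<Otimes>\<^sub>M V" U h] V.distr_pair_fst[of U] by simp
    ultimately show ?thesis by simp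
  qed
  also have "\<dots> = (\<integral>w. h (fst w) - h (snd w) \<partial>(U \<Otimes>\<^sub>M V))"
    using i by simp
  finally have *: "(\<integral>x. h x \<partial>U) - (\<integral>x. h x \<partial>V) = (\<integral>w. h (fst w) - h (snd w) \<partial>(U \<Otimes>\<^sub>M V))" .
  have "\<bar>\<integral>w. h (fst w) - h (snd w) \<partial>(U \<Otimes>\<^sub>M V)\<bar> \<le> (\<integral>w. \<bar>h (fst w) - h (snd w)\<bar> \<partial>(U \<Otimes>\<^sub>M V))"
    by (rule integral_abs_bound)
  also have "\<dots> \<le> (\<integral>w. tvd (k (fst w)) (k (snd w)) \<partial>(U \<Otimes>\<^sub>M V))"
    using i pk A by (intro integral_mono) (auto simp: h_def intro!: tvd_upper)
  finally show "\<bar>measure (M \<bind> k) A - measure (N \<bind> k) A\<bar> \<le> c * (\<integral>w. tvd (k (fst w)) (k (snd w)) \<partial>(U \<Otimes>\<^sub>M V))"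
    unfolding measure_bind_kernel[OF M k A] measure_bind_kernel[OF N k A] h_def[symmetric] eq[OF h h1] *
    using c by (simp add: abs_mult mult_left_mono)
qed

locale random_environment_kernel =
  fixes PX :: "'e::polish_space \<Rightarrow> (int \<Rightarrow> 'f::polish_space) \<Rightarrow> 'e measure"
  assumes PX: "(\<lambda>(z, y). PX z y) \<in> borel \<Otimes>\<^sub>M path_space \<rightarrow>\<^sub>M prob_algebra borel"
begin

abbreviation "Qm \<equiv> quenched_marginal PX"

lemma measurable_PX [measurable (raw)]:
  assumes "f \<in> M \<rightarrow>\<^sub>M borel" "g \<in> M \<rightarrow>\<^sub>M path_space"
  shows "(\<lambda>x. PX (f x) (g x)) \<in> M \<rightarrow>\<^sub>M prob_algebra borel"
  using measurable_compose[OF measurable_Pair[OF assms] PX] by simp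

lemma measurable_env_kernel [measurable]: "env_kernel PX y i \<in> borel \<rightarrow>\<^sub>M prob_algebra borel"
  unfolding env_kernel_def [abs_def] by (rule measurable_PX) (auto simp: space_PiM)

text \<open>Joint measurability in state and environment does not follow from measurability for each
  fixed environment, so the induction is redone with the environment as an argument that is shifted
  at every step.\<close>

lemma measurable_Qm': "(\<lambda>(z, y). Qm n z y) \<in> borel \<Otimes>\<^sub>M path_space \<rightarrow>\<^sub>M prob_algebra borel"
  unfolding quenched_marginal_def
proof (induction n)
  case (Suc n)
  have "(\<lambda>w. PX (fst w) (snd w) \<bind> (\<lambda>x. iter_kernel n (env_kernel PX (shift_path 1 (snd w))) x)) \<in>
    borel \<Otimes>\<^sub>M path_space \<rightarrow>\<^sub>M prob_algebra borel"
  proof (rule measurable_bind_prob_space2)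
    show "(\<lambda>w. PX (fst w) (snd w)) \<in> borel \<Otimes>\<^sub>M path_space \<rightarrow>\<^sub>M prob_algebra borel" by measurable
    have "(\<lambda>(w, x). (x, shift_path 1 (snd w))) \<in> (borel \<Otimes>\<^sub>M path_space) \<Otimes>\<^sub>M borel \<rightarrow>\<^sub>M borel \<Otimes>\<^sub>M path_space"
      by measurable
    from measurable_compose[OF this Suc]
    show "(\<lambda>(w, x). iter_kernel n (env_kernel PX (shift_path 1 (snd w))) x) \<in> (borel \<Otimes>\<^sub>M path_space) \<Otimes>\<^sub>M borel \<rightarrow>\<^sub>M prob_algebra borel"
      by (simp add: case_prod_beta')
  qed
  moreover have "iter_kernel (Suc n) (env_kernel PX y) z =
    PX z y \<bind> (\<lambda>x. iter_kernel n (env_kernel PX (shift_path 1 y)) x)" for z y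
    by (simp add: env_kernel_Suc) (simp add: env_kernel_def shift_path_0)
  ultimately show ?case
    by (simp only: case_prod_beta')
qed (simp add: case_prod_beta')

lemma measurable_Qm [measurable (raw)]:
  assumes "f \<in> M \<rightarrow>\<^sub>M borel" "g \<in> M \<rightarrow>\<^sub>M path_space"
  shows "(\<lambda>x. Qm n (f x) (g x)) \<in> M \<rightarrow>\<^sub>M prob_algebra borel"
  using measurable_compose[OF measurable_Pair[OF assms] measurable_Qm'] by simp

lemma Qm_in [simp]: "Qm n z y \<in> space (prob_algebra borel)"
  using measurable_space[OF measurable_Qm', of "(z, y)"] by (simp add: space_pair_measure space_PiM)

lemma prob_Qm [simp]: "prob_space (Qm n z y)" and sets_Qm [simp, measurable_cong]: "sets (Qm n z y) = sets borel"
  using Qm_in[of n z y] by (auto simp: space_prob_algebra simp del: Qm_in)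

lemma space_Qm [simp]: "space (Qm n z y) = UNIV"
  using sets_eq_imp_space_eq[OF sets_Qm] by simp

lemma nn_integral_Qm_add:
  "f \<in> borel_measurable borel \<Longrightarrow>
    (\<integral>\<^sup>+x. f x \<partial>Qm (n + m) z y) = (\<integral>\<^sup>+x. \<integral>\<^sup>+w. f w \<partial>Qm m x (shift_path (int n) y) \<partial>Qm n z y)"
  unfolding quenched_marginal_def
  by (subst nn_integral_iter_kernel_add) (simp_all add: env_kernel_shift measurable_env_kernel)

lemma Qm_add: "Qm (n + m) z y = Qm n z y \<bind> (\<lambda>x. Qm m x (shift_path (int n) y))"
proof (rule measure_eqI)
  have k: "(\<lambda>x. Qm m x (shift_path (int n) y)) \<in> borel \<rightarrow>\<^sub>M prob_algebra borel"
    by (rule measurable_Qm) (auto simp: space_PiM)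
  show "sets (Qm (n + m) z y) = sets (Qm n z y \<bind> (\<lambda>x. Qm m x (shift_path (int n) y)))"
    by (simp add: sets_bind'[OF Qm_in k])
  fix A assume "A \<in> sets (Qm (n + m) z y)"
  then have [measurable]: "A \<in> sets borel" by simp
  show "emeasure (Qm (n + m) z y) A = emeasure (Qm n z y \<bind> (\<lambda>x. Qm m x (shift_path (int n) y))) A"
    using nn_integral_Qm_add[of "indicator A" n m z y] by (simp add: emeasure_bind_prob_algebra[OF Qm_in k])
qed

lemma tvd_Qm_bounds: "0 \<le> tvd (Qm n z y) (Qm n z' y)" "tvd (Qm n z y) (Qm n z' y) \<le> 1"
  by (simp_all add: tvd_nonneg tvd_le_1)

lemma tendsto_merging: "(\<lambda>n. tvd (Qm n z y) (Qm n z' y)) \<longlonglongrightarrow> merging PX z z' y"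
proof -
  have "decseq (\<lambda>n. tvd (Qm n z y) (Qm n z' y))"
  proof (rule decseq_SucI)
    fix n
    have "tvd (Qm (n + 1) z y) (Qm (n + 1) z' y) \<le> tvd (Qm n z y) (Qm n z' y)"
      unfolding Qm_add by (intro tvd_bind_le measurable_Qm) (auto simp: space_PiM)
    then show "tvd (Qm (Suc n) z y) (Qm (Suc n) z' y) \<le> tvd (Qm n z y) (Qm n z' y)" by simp
  qed
  then obtain L where "(\<lambda>n. tvd (Qm n z y) (Qm n z' y)) \<longlonglongrightarrow> L"
    by (rule decseq_convergent[where B=0]) (auto simp: tvd_Qm_bounds)
  then show ?thesis unfolding merging_def by (simp add: limI)
qed

lemma merging_bounds: "0 \<le> merging PX z z' y" "merging PX z z' y \<le> 1"
proof -
  show "0 \<le> merging PX z z' y"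
    using tendsto_merging[of z y z'] by (rule LIMSEQ_le_const) (simp add: tvd_Qm_bounds)
  show "merging PX z z' y \<le> 1"
    using tendsto_merging[of z y z'] by (rule LIMSEQ_le_const2) (simp add: tvd_Qm_bounds)
qed

lemma measurable_merging [measurable (raw)]:
  assumes [measurable]: "f \<in> M \<rightarrow>\<^sub>M borel" "f' \<in> M \<rightarrow>\<^sub>M borel" "g \<in> M \<rightarrow>\<^sub>M path_space"
  shows "(\<lambda>x. merging PX (f x) (f' x) (g x)) \<in> borel_measurable M"
  unfolding merging_def by (intro borel_measurable_lim_metric measurable_tvd measurable_Qm) measurable

text \<open>The coupling bound passes to the limit by dominated convergence. It has two uses: with
  \<open>c = 1\<close> and the quenched laws themselves for \<open>U\<close> and \<open>V\<close> it
  says that \<open>merging\<close> grows on average; with the disjoint parts it yields a strict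
  contraction.\<close>

lemma merging_le_coupling:
  assumes U: "U \<in> space (prob_algebra borel)" and V: "V \<in> space (prob_algebra borel)" and c: "0 \<le> c"
    and eq: "\<And>h. h \<in> borel_measurable borel \<Longrightarrow> (\<And>x. \<bar>h x\<bar> \<le> 1) \<Longrightarrow>
      (\<integral>x. h x \<partial>Qm n z y) - (\<integral>x. h x \<partial>Qm n z' y) = c * ((\<integral>x. h x \<partial>U) - (\<integral>x. h x \<partial>V) :: real)"
  shows "merging PX z z' y \<le> c * (\<integral>w. merging PX (fst w) (snd w) (shift_path (int n) y) \<partial>(U \<Otimes>\<^sub>M V))"
proof (rule LIMSEQ_le)
  have [measurable_cong]: "sets U = sets borel" "sets V = sets borel"
    and pU: "prob_space U" and pV: "prob_space V"
    using U V by (auto simp: space_prob_algebra)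
  interpret U: prob_space U by (rule pU)
  interpret V: prob_space V by (rule pV)
  interpret UV: pair_prob_space U V ..
  let ?y = "shift_path (int n) y"
  have [measurable]: "(\<lambda>_. ?y) \<in> M \<rightarrow>\<^sub>M path_space" for M :: "'z measure" by (simp add: space_PiM)
  show "(\<lambda>j. tvd (Qm (n + j) z y) (Qm (n + j) z' y)) \<longlonglongrightarrow> merging PX z z' y"
    using LIMSEQ_ignore_initial_segment[OF tendsto_merging[of z y z'], where k=n] by (simp add: add.commute)
  show "(\<lambda>j. c * (\<integral>w. tvd (Qm j (fst w) ?y) (Qm j (snd w) ?y) \<partial>(U \<Otimes>\<^sub>M V))) \<longlonglongrightarrow>
    c * (\<integral>w. merging PX (fst w) (snd w) ?y \<partial>(U \<Otimes>\<^sub>M V))"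
    using tvd_Qm_bounds
    by (intro tendsto_mult_left integral_dominated_convergence[where w="\<lambda>_. 1"] measurable_tvd)
       (auto intro!: tendsto_merging measurable_merging measurable_Qm)
  show "\<exists>N. \<forall>j\<ge>N. tvd (Qm (n + j) z y) (Qm (n + j) z' y) \<le> c * (\<integral>w. tvd (Qm j (fst w) ?y) (Qm j (snd w) ?y) \<partial>(U \<Otimes>\<^sub>M V))"
    unfolding Qm_add by (intro exI allI impI tvd_bind_le_coupling U V c eq Qm_in measurable_Qm) auto
qed

text \<open>The disjoint parts are absolutely continuous with respect to the quenched laws, so
  \<open>merging\<close> keeps its starting value d on almost every pair drawn from them. The
  coupling bound becomes d \<le> c d with c < 1.\<close>

lemma merging_eq_0I:
  assumes const: "AE x in Qm n z y. AE x' in Qm n z' y. merging PX x x' (shift_path (int n) y) = merging PX z z' y"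
    and ns: "\<not> mutually_singular (Qm n z y) (Qm n z' y)"
  shows "merging PX z z' y = 0"
proof -
  have "sets (Qm n z y) = sets (Qm n z' y)" by simp
  from ex_disjoint_parts[OF prob_Qm prob_Qm this ns] obtain U V c
    where UV: "prob_space U" "prob_space V" "sets U = sets (Qm n z y)" "sets V = sets (Qm n z y)"
    "absolutely_continuous (Qm n z y) U" "absolutely_continuous (Qm n z' y) V" "0 \<le> c" "c < (1::real)"
    "\<And>h. h \<in> borel_measurable (Qm n z y) \<Longrightarrow> (\<And>x. \<bar>h x\<bar> \<le> 1) \<Longrightarrow>
      (\<integral>x. h x \<partial>Qm n z y) - (\<integral>x. h x \<partial>Qm n z' y) = c * ((\<integral>x. h x \<partial>U) - (\<integral>x. h x \<partial>V))" by metis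
  have U: "U \<in> space (prob_algebra borel)" and V: "V \<in> space (prob_algebra borel)"
    using UV by (auto simp: space_prob_algebra)
  have [measurable_cong]: "sets U = sets borel" "sets V = sets borel" using UV by auto
  interpret U: prob_space U by (rule UV)
  interpret V: prob_space V by (rule UV)
  interpret UV: pair_prob_space U V ..
  let ?y = "shift_path (int n) y" and ?d = "merging PX z z' y"
  have [measurable]: "(\<lambda>_. ?y) \<in> M \<rightarrow>\<^sub>M path_space" for M :: "'z measure" by (simp add: space_PiM)
  have "AE x in U. AE x' in Qm n z' y. merging PX x x' ?y = ?d"
    using const UV by (intro absolutely_continuous_AE[OF _ UV(5)]) auto
  then have "AE x in U. AE x' in V. merging PX x x' ?y = ?d"
    by eventually_elim (use UV in \<open>intro absolutely_continuous_AE[OF _ UV(6)]; auto\<close>)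
  moreover have "{w \<in> space (U \<Otimes>\<^sub>M V). merging PX (fst w) (snd w) ?y = ?d} \<in> sets (U \<Otimes>\<^sub>M V)"
    by measurable
  ultimately have "AE w in U \<Otimes>\<^sub>M V. merging PX (fst w) (snd w) ?y = ?d"
    by (intro UV.AE_pair_measure) auto
  then have "(\<integral>w. merging PX (fst w) (snd w) ?y \<partial>(U \<Otimes>\<^sub>M V)) = (\<integral>w. ?d \<partial>(U \<Otimes>\<^sub>M V))"
    by (intro integral_cong_AE) auto
  also have "\<dots> = ?d" by (simp add: UV.prob_space)
  finally have "?d \<le> c * ?d"
    using merging_le_coupling[OF U V UV(7), of n z y z'] UV(9) by (simp cong: measurable_cong_sets)
  with UV(8) merging_bounds(1)[of z z' y] show ?thesis
    by (metis less_eq_real_def mult_le_cancel_right1 not_less)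
qed

end

section \<open>Stationarity of the pair in its environment\<close>

locale stationary_environment = random_environment_kernel PX
  for PX :: "'e::polish_space \<Rightarrow> (int \<Rightarrow> 'f::polish_space) \<Rightarrow> 'e measure" +
  fixes \<mu> :: "(int \<Rightarrow> 'f) \<Rightarrow> 'e measure" and Q :: "(int \<Rightarrow> 'f) measure"
  assumes mu [measurable]: "\<mu> \<in> path_space \<rightarrow>\<^sub>M prob_algebra borel"
    and inv: "\<And>y A. A \<in> sets borel \<Longrightarrow> (\<integral>z. measure (PX z y) A \<partial>\<mu> y) = measure (\<mu> (shift_path 1 y)) A"
    and Q: "Q \<in> space (prob_algebra path_space)"
    and stat: "distr Q path_space (shift_path 1) = Q"
begin

lemma mu_in [simp]: "\<mu> y \<in> space (prob_algebra borel)"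
  using measurable_space[OF mu, of y] by (simp add: space_PiM)

lemma prob_mu [simp]: "prob_space (\<mu> y)" and sets_mu [simp, measurable_cong]: "sets (\<mu> y) = sets borel"
  using mu_in[of y] by (auto simp: space_prob_algebra simp del: mu_in)

lemma prob_Q: "prob_space Q" and sets_Q [simp, measurable_cong]: "sets Q = sets path_space"
  using Q by (auto simp: space_prob_algebra)

lemma mu_bind_PX: "\<mu> y \<bind> (\<lambda>z. PX z y) = \<mu> (shift_path 1 y)"
proof (rule measure_eqI)
  have k: "(\<lambda>z. PX z y) \<in> borel \<rightarrow>\<^sub>M prob_algebra borel"
    by (rule measurable_PX) (auto simp: space_PiM)
  show "sets (\<mu> y \<bind> (\<lambda>z. PX z y)) = sets (\<mu> (shift_path 1 y))"
    by (simp add: sets_bind'[OF mu_in k])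
  interpret b: prob_space "\<mu> y \<bind> (\<lambda>z. PX z y)" by (rule prob_space_bind'[OF mu_in k])
  interpret m: prob_space "\<mu> (shift_path 1 y)" by simp
  fix A assume "A \<in> sets (\<mu> y \<bind> (\<lambda>z. PX z y))"
  then have "A \<in> sets borel" by (simp add: sets_bind'[OF mu_in k])
  then show "emeasure (\<mu> y \<bind> (\<lambda>z. PX z y)) A = emeasure (\<mu> (shift_path 1 y)) A"
    by (simp add: b.emeasure_eq_measure m.emeasure_eq_measure measure_bind_kernel[OF mu_in k] inv)
qed

lemma nn_integral_Qm_Suc:
  assumes f: "f \<in> borel_measurable borel"
  shows "(\<integral>\<^sup>+x. f x \<partial>Qm (Suc n) z y) = (\<integral>\<^sup>+x. \<integral>\<^sup>+w. f w \<partial>Qm n x (shift_path 1 y) \<partial>PX z y)"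
  using nn_integral_iter_kernel_Suc[of "env_kernel PX y", OF measurable_env_kernel f, of n z]
  by (simp add: quenched_marginal_def env_kernel_Suc del: iter_kernel.simps) (simp add: env_kernel_def shift_path_0)

lemma nn_integral_mu_Qm:
  assumes f [measurable]: "f \<in> borel_measurable borel"
  shows "(\<integral>\<^sup>+z. \<integral>\<^sup>+x. f x \<partial>Qm n z y \<partial>\<mu> y) = (\<integral>\<^sup>+x. f x \<partial>\<mu> (shift_path (int n) y))"
proof (induction n arbitrary: y)
  case 0
  then show ?case by (simp add: quenched_marginal_def nn_integral_return shift_path_0)
next
  case (Suc n)
  have k: "(\<lambda>z. PX z y) \<in> borel \<rightarrow>\<^sub>M prob_algebra borel"
    by (rule measurable_PX) (auto simp: space_PiM)
  have "(\<lambda>x. Qm n x (shift_path 1 y)) \<in> borel \<rightarrow>\<^sub>M prob_algebra borel"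
    by (rule measurable_Qm) (auto simp: space_PiM)
  then have m: "(\<lambda>x. \<integral>\<^sup>+w. f w \<partial>Qm n x (shift_path 1 y)) \<in> borel_measurable borel"
    by (rule measurable_nn_integral_kernel) measurable
  have "(\<integral>\<^sup>+z. \<integral>\<^sup>+x. f x \<partial>Qm (Suc n) z y \<partial>\<mu> y) =
    (\<integral>\<^sup>+x. \<integral>\<^sup>+w. f w \<partial>Qm n x (shift_path 1 y) \<partial>(\<mu> y \<bind> (\<lambda>z. PX z y)))"
    by (simp add: nn_integral_Qm_Suc f nn_integral_bind_prob_algebra[OF mu_in k m])
  also have "\<dots> = (\<integral>\<^sup>+x. f x \<partial>\<mu> (shift_path (int (Suc n)) y))"
    by (simp add: mu_bind_PX Suc shift_path_add add.commute)
  finally show ?case .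
qed

lemma nn_integral_Q_shift:
  assumes f: "f \<in> borel_measurable path_space"
  shows "(\<integral>\<^sup>+y. f (shift_path (int n) y) \<partial>Q) = (\<integral>\<^sup>+y. f y \<partial>Q)"
proof (induction n)
  case (Suc n)
  have [measurable]: "(\<lambda>y. f (shift_path (int n) y)) \<in> borel_measurable path_space"
    using f by measurable
  have "(\<integral>\<^sup>+y. f (shift_path (int n) y) \<partial>distr Q path_space (shift_path 1)) = (\<integral>\<^sup>+y. f (shift_path (int n) (shift_path 1 y)) \<partial>Q)"
    by (subst nn_integral_distr) (auto simp: measurable_cong_sets[OF sets_Q refl])
  with Suc show ?case by (simp add: stat shift_path_add add.commute)
qed (simp add: shift_path_0)

text \<open>Given the environment the two copies move independently, so a product law is carried to
  a product law. Rectangles suffice for the comparison, and there the integrals separate into single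
  copies.\<close>

lemma mu_pair_bind_Qm:
  "(\<mu> y \<Otimes>\<^sub>M \<mu> y) \<bind> (\<lambda>w. Qm n (fst w) y \<Otimes>\<^sub>M Qm n (snd w) y) =
    \<mu> (shift_path (int n) y) \<Otimes>\<^sub>M \<mu> (shift_path (int n) y)"
proof (rule pair_measure_eqI[symmetric])
  let ?y = "shift_path (int n) y"
  interpret m: prob_space "\<mu> y" by simp
  have M: "\<mu> y \<Otimes>\<^sub>M \<mu> y \<in> space (prob_algebra (borel \<Otimes>\<^sub>M borel))"
    by (auto simp: space_prob_algebra prob_space_pair cong: sets_pair_measure_cong)
  have [measurable]: "(\<lambda>_. y) \<in> M \<rightarrow>\<^sub>M path_space" for M :: "'z measure" by (simp add: space_PiM)
  have k: "(\<lambda>w. Qm n (fst w) y \<Otimes>\<^sub>M Qm n (snd w) y) \<in> borel \<Otimes>\<^sub>M borel \<rightarrow>\<^sub>M prob_algebra (borel \<Otimes>\<^sub>M borel)"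
    by measurable
  show "sigma_finite_measure (\<mu> ?y)" "sigma_finite_measure (\<mu> ?y)"
    by (simp_all add: prob_space_imp_sigma_finite)
  show "sets (\<mu> ?y \<Otimes>\<^sub>M \<mu> ?y) = sets ((\<mu> y \<Otimes>\<^sub>M \<mu> y) \<bind> (\<lambda>w. Qm n (fst w) y \<Otimes>\<^sub>M Qm n (snd w) y))"
    unfolding sets_bind'[OF M k] by (simp cong: sets_pair_measure_cong)
  fix A B assume "A \<in> sets (\<mu> ?y)" "B \<in> sets (\<mu> ?y)"
  then have [measurable]: "A \<in> sets borel" "B \<in> sets borel" by auto
  have me [measurable]: "(\<lambda>z. emeasure (Qm n z y) C) \<in> borel_measurable borel" if "C \<in> sets borel" for C
  proof -
    have "(\<lambda>z. Qm n z y) \<in> borel \<rightarrow>\<^sub>M subprob_algebra borel"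
      by (rule measurable_prob_algebraD) measurable
    from measurable_compose[OF this measurable_emeasure_subprob_algebra[OF that]] show ?thesis .
  qed
  have e: "(\<integral>\<^sup>+z. emeasure (Qm n z y) C \<partial>\<mu> y) = emeasure (\<mu> ?y) C" if "C \<in> sets borel" for C
    using nn_integral_mu_Qm[where f="indicator C" and n=n and y=y] that by simp
  have "emeasure ((\<mu> y \<Otimes>\<^sub>M \<mu> y) \<bind> (\<lambda>w. Qm n (fst w) y \<Otimes>\<^sub>M Qm n (snd w) y)) (A \<times> B) =
    (\<integral>\<^sup>+w. emeasure (Qm n (fst w) y \<Otimes>\<^sub>M Qm n (snd w) y) (A \<times> B) \<partial>(\<mu> y \<Otimes>\<^sub>M \<mu> y))"
    by (rule emeasure_bind_prob_algebra[OF M k]) measurable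
  also have "\<dots> = (\<integral>\<^sup>+w. emeasure (Qm n (fst w) y) A * emeasure (Qm n (snd w) y) B \<partial>(\<mu> y \<Otimes>\<^sub>M \<mu> y))"
    by (intro nn_integral_cong sigma_finite_measure.emeasure_pair_measure_Times)
       (auto simp: prob_space_imp_sigma_finite)
  also have "\<dots> = (\<integral>\<^sup>+z. \<integral>\<^sup>+z'. emeasure (Qm n z y) A * emeasure (Qm n z' y) B \<partial>\<mu> y \<partial>\<mu> y)"
    by (subst m.nn_integral_fst[symmetric]) auto
  also have "\<dots> = (\<integral>\<^sup>+z. emeasure (Qm n z y) A * emeasure (\<mu> ?y) B \<partial>\<mu> y)"
    by (intro nn_integral_cong) (simp add: nn_integral_cmult e)
  also have "\<dots> = emeasure (\<mu> ?y) A * emeasure (\<mu> ?y) B"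
    by (simp add: nn_integral_multc e)
  finally show "emeasure (\<mu> ?y) A * emeasure (\<mu> ?y) B =
    emeasure ((\<mu> y \<Otimes>\<^sub>M \<mu> y) \<bind> (\<lambda>w. Qm n (fst w) y \<Otimes>\<^sub>M Qm n (snd w) y)) (A \<times> B)" ..
qed

text \<open>With f the later value and d \<ge> 0 the starting value, the mean of f is at least d, so
  expanding the square bounds the mean of (f - d)^2 by the mean of f^2 minus d^2. The sum form
  avoids subtraction of extended numbers.\<close>

lemma merging_jensen:
  "(\<integral>\<^sup>+w. ennreal ((merging PX (fst w) (snd w) (shift_path (int n) y) - merging PX z z' y)\<^sup>2) \<partial>(Qm n z y \<Otimes>\<^sub>M Qm n z' y)) +
    ennreal ((merging PX z z' y)\<^sup>2)
   \<le> (\<integral>\<^sup>+w. ennreal ((merging PX (fst w) (snd w) (shift_path (int n) y))\<^sup>2) \<partial>(Qm n z y \<Otimes>\<^sub>M Qm n z' y))"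
proof -
  interpret U: prob_space "Qm n z y" by simp
  interpret V: prob_space "Qm n z' y" by simp
  interpret E: pair_prob_space "Qm n z y" "Qm n z' y" ..
  let ?E = "Qm n z y \<Otimes>\<^sub>M Qm n z' y"
  have [measurable]: "(\<lambda>_. shift_path (int n) y) \<in> M \<rightarrow>\<^sub>M path_space" for M :: "'z measure" by (simp add: space_PiM)
  define f where "f w = merging PX (fst w) (snd w) (shift_path (int n) y)" for w
  define d where "d = merging PX z z' y"
  have f [measurable]: "f \<in> borel_measurable ?E" unfolding f_def by measurable
  have f01: "0 \<le> f w" "f w \<le> 1" for w using merging_bounds by (auto simp: f_def)
  have d01: "0 \<le> d" "d \<le> 1" using merging_bounds by (auto simp: d_def)
  have i: "integrable ?E f" "integrable ?E (\<lambda>w. (f w)\<^sup>2)"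
    using f01 by (auto intro!: E.integrable_const_bound[where B=1] simp: abs_square_le_1 power_le_one)
  have "d \<le> 1 * (\<integral>w. f w \<partial>?E)"
    unfolding d_def f_def by (rule merging_le_coupling) auto
  then have df: "d \<le> (\<integral>w. f w \<partial>?E)" by simp
  have "(\<integral>w. (f w - d)\<^sup>2 \<partial>?E) = (\<integral>w. (f w)\<^sup>2 - 2 * d * f w + d\<^sup>2 \<partial>?E)"
    by (intro Bochner_Integration.integral_cong) (auto simp: power2_eq_square algebra_simps)
  also have "\<dots> = (\<integral>w. (f w)\<^sup>2 \<partial>?E) - 2 * d * (\<integral>w. f w \<partial>?E) + d\<^sup>2"
    using i by (simp add: E.prob_space)
  also have "\<dots> \<le> (\<integral>w. (f w)\<^sup>2 \<partial>?E) - 2 * d * d + d\<^sup>2"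
    using df d01 by (intro add_mono diff_mono mult_left_mono order_refl) auto
  finally have *: "(\<integral>w. (f w - d)\<^sup>2 \<partial>?E) + d\<^sup>2 \<le> (\<integral>w. (f w)\<^sup>2 \<partial>?E)"
    by (simp add: power2_eq_square)
  have i': "integrable ?E (\<lambda>w. (f w - d)\<^sup>2)"
    using i by (simp add: power2_diff mult.assoc)
  have "(\<integral>\<^sup>+w. ennreal ((f w - d)\<^sup>2) \<partial>?E) + ennreal (d\<^sup>2) = ennreal ((\<integral>w. (f w - d)\<^sup>2 \<partial>?E) + d\<^sup>2)"
    using nn_integral_eq_integral[OF i'] by simp
  also have "\<dots> \<le> ennreal (\<integral>w. (f w)\<^sup>2 \<partial>?E)"
    using * by (rule ennreal_leI)
  also have "\<dots> = (\<integral>\<^sup>+w. ennreal ((f w)\<^sup>2) \<partial>?E)"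
    using nn_integral_eq_integral[OF i(2)] by simp
  finally show ?thesis unfolding f_def d_def .
qed

text \<open>The square of \<^term>\<open>merging PX\<close> has the same integral before and after \<^term>\<open>n\<close> steps, so the
  variance in the previous lemma must vanish almost everywhere.\<close>

lemma AE_merging_constant_pair:
  "AE y in Q. AE w in \<mu> y \<Otimes>\<^sub>M \<mu> y. AE w' in Qm n (fst w) y \<Otimes>\<^sub>M Qm n (snd w) y.
    merging PX (fst w') (snd w') (shift_path (int n) y) = merging PX (fst w) (snd w) y"
proof -
  interpret Q: prob_space Q by (rule prob_Q)
  let ?m = "\<lambda>y. \<mu> y \<Otimes>\<^sub>M \<mu> y" and ?E = "\<lambda>w y. Qm n (fst w) y \<Otimes>\<^sub>M Qm n (snd w) y"
  let ?f = "\<lambda>w y. merging PX (fst w) (snd w) y"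
  let ?V = "\<lambda>w y. \<integral>\<^sup>+w'. ennreal ((?f w' (shift_path (int n) y) - ?f w y)\<^sup>2) \<partial>?E w y"
  let ?G = "\<lambda>y. \<integral>\<^sup>+w. ennreal ((?f w y)\<^sup>2) \<partial>?m y"
  have m [measurable]: "?m \<in> path_space \<rightarrow>\<^sub>M prob_algebra (borel \<Otimes>\<^sub>M borel)" by measurable
  have M: "?m y \<in> space (prob_algebra (borel \<Otimes>\<^sub>M borel))" for y
    by (auto simp: space_prob_algebra prob_space_pair cong: sets_pair_measure_cong)
  have sM [measurable_cong]: "sets (?m y) = sets (borel \<Otimes>\<^sub>M borel)" for y
    using M[of y] by (auto simp: space_prob_algebra)
  have E: "(\<lambda>(y, w). ?E w y) \<in> path_space \<Otimes>\<^sub>M (borel \<Otimes>\<^sub>M borel) \<rightarrow>\<^sub>M prob_algebra (borel \<Otimes>\<^sub>M borel)"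
    by (simp add: case_prod_beta')
  have mV [measurable]: "(\<lambda>(y, w). ?V w y) \<in> borel_measurable (path_space \<Otimes>\<^sub>M (borel \<Otimes>\<^sub>M borel))"
    unfolding case_prod_beta'
    by (rule measurable_nn_integral_kernel[OF E[unfolded case_prod_beta']]) measurable
  have mf [measurable]: "(\<lambda>(y, w). ennreal ((?f w y)\<^sup>2)) \<in> borel_measurable (path_space \<Otimes>\<^sub>M (borel \<Otimes>\<^sub>M borel))"
    unfolding case_prod_beta' by measurable
  have mG [measurable]: "?G \<in> borel_measurable path_space"
    by (rule measurable_nn_integral_kernel[OF m mf])
  have mVV [measurable]: "(\<lambda>y. \<integral>\<^sup>+w. ?V w y \<partial>?m y) \<in> borel_measurable path_space"
    by (rule measurable_nn_integral_kernel[OF m mV])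
  have [measurable]: "(\<lambda>_. y) \<in> M \<rightarrow>\<^sub>M path_space" for M :: "'z measure" and y by (simp add: space_PiM)
  have mV1: "(\<lambda>w. ?V w y) \<in> borel_measurable (borel \<Otimes>\<^sub>M borel)" for y
    using measurable_compose[OF measurable_Pair1' mV, of y] by (simp add: space_PiM)
  have mV1' [measurable]: "(\<lambda>w. ?V w y) \<in> borel_measurable (?m y)" for y
    using mV1 by (simp add: measurable_cong_sets[OF sM refl])
  have mf1 [measurable]: "(\<lambda>w. ennreal ((?f w y)\<^sup>2)) \<in> borel_measurable (borel \<Otimes>\<^sub>M borel)" for y
    by measurable
  have mf1' [measurable]: "(\<lambda>w. ennreal ((?f w y)\<^sup>2)) \<in> borel_measurable (?m y)" for y
    using mf1 by (simp add: measurable_cong_sets[OF sM refl])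
  have k: "(\<lambda>w. ?E w y) \<in> borel \<Otimes>\<^sub>M borel \<rightarrow>\<^sub>M prob_algebra (borel \<Otimes>\<^sub>M borel)" for y
    by measurable
  have 1: "(\<integral>\<^sup>+w. ?V w y \<partial>?m y) + ?G y \<le> ?G (shift_path (int n) y)" for y
  proof -
    have "(\<integral>\<^sup>+w. ?V w y \<partial>?m y) + ?G y = (\<integral>\<^sup>+w. ?V w y + ennreal ((?f w y)\<^sup>2) \<partial>?m y)"
      by (subst nn_integral_add[OF mV1' mf1']) simp
    also have "\<dots> \<le> (\<integral>\<^sup>+w. \<integral>\<^sup>+w'. ennreal ((?f w' (shift_path (int n) y))\<^sup>2) \<partial>?E w y \<partial>?m y)"
      by (intro nn_integral_mono merging_jensen)
    also have "\<dots> = ?G (shift_path (int n) y)"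
      by (subst mu_pair_bind_Qm[symmetric], subst nn_integral_bind_prob_algebra[OF M k mf1]) simp
    finally show ?thesis .
  qed
  have "(\<integral>\<^sup>+y. \<integral>\<^sup>+w. ?V w y \<partial>?m y \<partial>Q) + (\<integral>\<^sup>+y. ?G y \<partial>Q) = (\<integral>\<^sup>+y. (\<integral>\<^sup>+w. ?V w y \<partial>?m y) + ?G y \<partial>Q)"
    using mG mVV by (subst nn_integral_add) (simp_all add: measurable_cong_sets[OF sets_Q refl])
  also have "\<dots> \<le> (\<integral>\<^sup>+y. ?G (shift_path (int n) y) \<partial>Q)"
    by (intro nn_integral_mono 1)
  also have "\<dots> = (\<integral>\<^sup>+y. ?G y \<partial>Q)"
    by (rule nn_integral_Q_shift[OF mG])
  finally have le: "(\<integral>\<^sup>+y. \<integral>\<^sup>+w. ?V w y \<partial>?m y \<partial>Q) + (\<integral>\<^sup>+y. ?G y \<partial>Q) \<le> (\<integral>\<^sup>+y. ?G y \<partial>Q)" .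
  \<comment> \<open>Boundedness makes the integral of \<open>?G\<close> finite, so that it can be
    cancelled from both sides of \<open>le\<close>.\<close>
  have "?G y \<le> 1" for y
  proof -
    interpret prob_space "?m y" using M[of y] by (simp add: space_prob_algebra)
    have "?G y \<le> (\<integral>\<^sup>+w. 1 \<partial>?m y)"
      using merging_bounds by (intro nn_integral_mono) (simp add: power_le_one)
    then show ?thesis by (simp add: emeasure_space_1)
  qed
  then have "(\<integral>\<^sup>+y. ?G y \<partial>Q) \<le> (\<integral>\<^sup>+y. 1 \<partial>Q)" by (intro nn_integral_mono)
  then have "(\<integral>\<^sup>+y. ?G y \<partial>Q) < \<top>" by (simp add: Q.emeasure_space_1 le_less_trans)
  with le have "(\<integral>\<^sup>+y. \<integral>\<^sup>+w. ?V w y \<partial>?m y \<partial>Q) = 0"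
    using ennreal_add_left_cancel_le[of "\<integral>\<^sup>+y. ?G y \<partial>Q" "\<integral>\<^sup>+y. \<integral>\<^sup>+w. ?V w y \<partial>?m y \<partial>Q" 0]
    by (simp only: add.commute[of _ "\<integral>\<^sup>+y. ?G y \<partial>Q"] add_0_right le_zero_eq) auto
  then have "AE y in Q. (\<integral>\<^sup>+w. ?V w y \<partial>?m y) = 0"
    using mVV by (subst (asm) nn_integral_0_iff_AE) (auto simp: measurable_cong_sets[OF sets_Q refl])
  then show ?thesis
  proof eventually_elim
    fix y assume "(\<integral>\<^sup>+w. ?V w y \<partial>?m y) = 0"
    then have "AE w in ?m y. ?V w y = 0"
      by (subst (asm) nn_integral_0_iff_AE) auto
    then show "AE w in ?m y. AE w' in ?E w y. ?f w' (shift_path (int n) y) = ?f w y"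
    proof eventually_elim
      fix w assume "?V w y = 0"
      then have "AE w' in ?E w y. ennreal ((?f w' (shift_path (int n) y) - ?f w y)\<^sup>2) = 0"
        by (subst (asm) nn_integral_0_iff_AE) auto
      then show "AE w' in ?E w y. ?f w' (shift_path (int n) y) = ?f w y"
        by eventually_elim (simp add: ennreal_eq_0_iff)
    qed
  qed
qed

lemma AE_merging_constant:
  "AE y in Q. AE z' in \<mu> y. AE z in \<mu> y. \<forall>n. AE x in Qm n z y. AE x' in Qm n z' y.
    merging PX x x' (shift_path (int n) y) = merging PX z z' y"
proof -
  \<comment> \<open>\<open>coupled_law\<close> draws \<open>z'\<close> first and \<open>z\<close>
    second. Symmetry of \<open>merging\<close> allows the coordinates to be exchanged to reach that
    order.\<close>
  have sym: "merging PX z z' y = merging PX z' z y" for z z' y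
    unfolding merging_def tvd_def by (simp add: abs_minus_commute)
  have "AE y in Q. \<forall>n. AE w in \<mu> y \<Otimes>\<^sub>M \<mu> y. AE w' in Qm n (fst w) y \<Otimes>\<^sub>M Qm n (snd w) y.
    merging PX (fst w') (snd w') (shift_path (int n) y) = merging PX (fst w) (snd w) y"
    using AE_merging_constant_pair by (simp add: AE_all_countable)
  then show ?thesis
  proof eventually_elim
    fix y assume *: "\<forall>n. AE w in \<mu> y \<Otimes>\<^sub>M \<mu> y. AE w' in Qm n (fst w) y \<Otimes>\<^sub>M Qm n (snd w) y.
      merging PX (fst w') (snd w') (shift_path (int n) y) = merging PX (fst w) (snd w) y"
    interpret m: prob_space "\<mu> y" by simp
    interpret mm: pair_prob_space "\<mu> y" "\<mu> y" ..
    have "AE w in \<mu> y \<Otimes>\<^sub>M \<mu> y. \<forall>n. AE w' in Qm n (fst w) y \<Otimes>\<^sub>M Qm n (snd w) y.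
      merging PX (fst w') (snd w') (shift_path (int n) y) = merging PX (fst w) (snd w) y"
      using * by (simp add: AE_all_countable)
    then have "AE w in \<mu> y \<Otimes>\<^sub>M \<mu> y. \<forall>n. AE x' in Qm n (fst w) y. AE x in Qm n (snd w) y.
      merging PX x' x (shift_path (int n) y) = merging PX (fst w) (snd w) y"
    proof eventually_elim
      case (elim w)
      show ?case
      proof
        fix n
        interpret U: prob_space "Qm n (fst w) y" by simp
        interpret V: prob_space "Qm n (snd w) y" by simp
        interpret E: pair_prob_space "Qm n (fst w) y" "Qm n (snd w) y" ..
        show "AE x' in Qm n (fst w) y. AE x in Qm n (snd w) y.
          merging PX x' x (shift_path (int n) y) = merging PX (fst w) (snd w) y"
          using E.AE_pair[OF elim[rule_format, of n]] by simp
      qed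
    qed
    from mm.AE_pair[OF this]
    show "AE z' in \<mu> y. AE z in \<mu> y. \<forall>n. AE x in Qm n z y. AE x' in Qm n z' y.
      merging PX x x' (shift_path (int n) y) = merging PX z z' y"
    proof eventually_elim
      case (elim z')
      then show ?case
      proof eventually_elim
        case (elim z)
        show ?case
        proof
          fix n
          interpret U: prob_space "Qm n z' y" by simp
          interpret V: prob_space "Qm n z y" by simp
          interpret E: pair_prob_space "Qm n z' y" "Qm n z y" ..
          have [measurable]: "(\<lambda>_. shift_path (int n) y) \<in> M \<rightarrow>\<^sub>M path_space" for M :: "'z measure" by (simp add: space_PiM)
          have "{w \<in> space (Qm n z' y \<Otimes>\<^sub>M Qm n z y). merging PX (fst w) (snd w) (shift_path (int n) y) = merging PX z' z y}
            \<in> sets (Qm n z' y \<Otimes>\<^sub>M Qm n z y)"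
            by measurable
          from E.AE_commute[OF this] elim[rule_format, of n, unfolded fst_conv snd_conv]
          show "AE x in Qm n z y. AE x' in Qm n z' y.
            merging PX x x' (shift_path (int n) y) = merging PX z z' y"
            by (simp add: sym[of _ _ "shift_path (int n) y"] sym[of _ _ y])
        qed
      qed
    qed
  qed
qed

text \<open>Merging at all later pairs is kept along with merging at the start, because the zero-one
  law for tail events compares conditional probabilities at every later time.\<close>

lemma AE_merging_0:
  assumes "AE y in Q. AE z' in \<mu> y. AE z in \<mu> y. \<exists>n. \<not> mutually_singular (Qm n z y) (Qm n z' y)"
  shows "AE y in Q. AE z' in \<mu> y. AE z in \<mu> y. merging PX z z' y = 0 \<and>
    (\<forall>n. AE x in Qm n z y. AE x' in Qm n z' y. merging PX x x' (shift_path (int n) y) = 0)"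
  using assms AE_merging_constant
proof eventually_elim
  case (elim y)
  then show ?case
  proof eventually_elim
    case (elim z')
    then show ?case
    proof eventually_elim
      case (elim z)
      then obtain n where "\<not> mutually_singular (Qm n z y) (Qm n z' y)" by auto
      with elim(2) have "merging PX z z' y = 0" by (intro merging_eq_0I) auto
      with elim(2) show ?case by simp
    qed
  qed
qed

end

section \<open>Tail events\<close>

lemma space_FX [simp]: "space (FX I) = UNIV"
  by (simp add: FX_def space_measure_of_conv)

lemma sets_FX: "sets (FX I) = sigma_sets UNIV {X_at k -` A | k A. k \<in> I \<and> A \<in> sets borel}"
  unfolding FX_def by (rule sets_measure_of) auto

lemma measurable_X_at_FX: "k \<in> I \<Longrightarrow> X_at k \<in> FX I \<rightarrow>\<^sub>M borel"
  by (rule measurableI) (auto simp: sets_FX)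

lemma measurable_FX_I:
  fixes f :: "'a \<Rightarrow> (int \<Rightarrow> 'e::polish_space) \<times> (int \<Rightarrow> 'f::polish_space)"
  assumes c: "\<And>k. k \<in> I \<Longrightarrow> (\<lambda>x. X_at k (f x)) \<in> M \<rightarrow>\<^sub>M borel"
  shows "f \<in> M \<rightarrow>\<^sub>M FX I"
  unfolding FX_def
proof (rule measurable_measure_of)
  fix B :: "((int \<Rightarrow> 'e) \<times> (int \<Rightarrow> 'f)) set" assume "B \<in> {X_at k -` A | k A. k \<in> I \<and> A \<in> sets borel}"
  then obtain k A where B: "B = X_at k -` A" "k \<in> I" "A \<in> sets borel" by auto
  have "f -` B \<inter> space M = (\<lambda>x. X_at k (f x)) -` A \<inter> space M" using B by auto
  with measurable_sets[OF c[OF B(2)] B(3)] show "f -` B \<inter> space M \<in> sets M" by simp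
qed auto

text \<open>Preimages under the map that reads the signal from time \<open>n\<close> on form a
  sigma-algebra, and this sigma-algebra contains the generators.\<close>

lemma sets_FX_atLeast_obtain:
  fixes A :: "((int \<Rightarrow> 'e::polish_space) \<times> (int \<Rightarrow> 'f::polish_space)) set"
  assumes "A \<in> sets (FX {int n..})"
  obtains T where "T \<in> sets (PiM UNIV (\<lambda>_::nat. borel))" "A = {\<omega>. (\<lambda>k. X_at (int (n + k)) \<omega>) \<in> T}"
proof -
  let ?f = "\<lambda>(\<omega> :: (int \<Rightarrow> 'e) \<times> (int \<Rightarrow> 'f)) k. X_at (int (n + k)) \<omega>" and ?S = "PiM UNIV (\<lambda>_::nat. borel :: 'e measure)"
  let ?V = "vimage_algebra UNIV ?f ?S"
  have "sigma_sets (space ?V) {X_at k -` A | k A. k \<in> {int n..} \<and> A \<in> sets borel} \<subseteq> sets ?V"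
  proof (rule sets.sigma_sets_subset, safe)
    fix k and A :: "'e set" assume k: "int n \<le> k" and A: "A \<in> sets borel"
    define T where "T = {x \<in> space ?S. x (nat (k - int n)) \<in> A}"
    have "T \<in> sets ?S" unfolding T_def using A by measurable
    moreover have "X_at k -` A = ?f -` T \<inter> UNIV"
      using k by (auto simp: T_def space_PiM X_at_def)
    ultimately show "X_at k -` A \<in> sets ?V" using in_vimage_algebra[of T ?S ?f UNIV] by simp
  qed
  with assms have "A \<in> sets ?V" by (auto simp: sets_FX)
  then obtain T where "T \<in> sets ?S" "A = ?f -` T \<inter> UNIV"
    by (auto simp: sets_vimage_algebra2 space_PiM)
  then show thesis by (intro that[of T]) auto
qed

context random_environment_kernel
begin

abbreviation "Qchain z y \<equiv> markov_chain z (env_kernel PX y)"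

lemma Qchain_simps [simp, measurable_cong]:
  "sets (Qchain z y) = sets (PiM UNIV (\<lambda>_. borel))" "space (Qchain z y) = UNIV" "prob_space (Qchain z y)"
  by (simp_all add: sets_markov_chain space_markov_chain prob_space_markov_chain measurable_env_kernel)

lemma quenched_law_eq: "quenched_law PX z y = distr (Qchain z y) (FX {0..}) (\<lambda>x. (\<lambda>k. x (nat k), y))"
  unfolding quenched_law_def env_kernel_def [abs_def] ..

lemma measurable_embed: "(\<lambda>x. (\<lambda>k. x (nat k), y)) \<in> Qchain z y' \<rightarrow>\<^sub>M FX {0..}"
proof (rule measurable_FX_I)
  fix k :: int
  have "(\<lambda>x. x (nat k)) \<in> Qchain z y' \<rightarrow>\<^sub>M borel" by measurable
  then show "(\<lambda>x. X_at k (\<lambda>k. x (nat k), y)) \<in> Qchain z y' \<rightarrow>\<^sub>M borel"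
    by (simp add: X_at_def)
qed

lemma distr_quenched_law_X_at: "distr (quenched_law PX z y) borel (X_at (int n)) = Qm n z y"
proof -
  have "distr (quenched_law PX z y) borel (X_at (int n)) = distr (Qchain z y) borel (\<lambda>x. x n)"
    unfolding quenched_law_eq
    by (subst distr_distr[OF measurable_X_at_FX measurable_embed]) (auto simp: comp_def X_at_def)
  also have "\<dots> = Qm n z y"
    unfolding quenched_marginal_def by (rule distr_markov_chain_marginal) measurable
  finally show ?thesis .
qed

text \<open>\<open>T n\<close> is a tail event seen as a set of paths that start at time \<open>n\<close>.\<close>

definition tail_family :: "(nat \<Rightarrow> (nat \<Rightarrow> 'e) set) \<Rightarrow> bool" where
  "tail_family T \<longleftrightarrow> (\<forall>n. T n \<in> sets (PiM UNIV (\<lambda>_. borel))) \<and>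
    (\<forall>n k w. w \<in> T n \<longleftrightarrow> (\<lambda>j. w (k + j)) \<in> T (n + k))"

text \<open>Lets every bound proved at time 0 be applied to the restarted chain at a later
  time.\<close>

lemma tail_family_shift: "tail_family T \<Longrightarrow> tail_family (\<lambda>i. T (m + i))"
  unfolding tail_family_def by (metis add.assoc)

lemma measurable_Qchain_shift:
  "(\<lambda>x. Qchain x (shift_path (int n) y)) \<in> borel \<rightarrow>\<^sub>M prob_algebra (PiM UNIV (\<lambda>_. borel))"
  by (rule measurable_markov_chain) measurable

lemma measurable_Qchain_tail [measurable]:
  "tail_family T \<Longrightarrow> (\<lambda>x. measure (Qchain x (shift_path (int n) y)) (T n)) \<in> borel_measurable borel"
  by (rule measurable_compose[OF measurable_Qchain_shift measurable_measure_prob_algebra]) (simp add: tail_family_def)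

text \<open>The Markov property at time \<open>n\<close>, split between an event of the times before
  \<open>n\<close> and a tail event. The hypothesis on \<open>comb_seq\<close> expresses that
  \<open>B\<close> does not look at coordinates from \<open>n\<close> on.\<close>

lemma emeasure_Qchain_tail_Int:
  assumes T: "tail_family T" and B [measurable]: "B \<in> sets (PiM UNIV (\<lambda>_. borel))"
    and Bn: "\<And>x w. comb_seq n x w \<in> B \<longleftrightarrow> x \<in> B"
  shows "emeasure (Qchain z y) (B \<inter> T 0) =
    (\<integral>\<^sup>+x. indicator B x * ennreal (measure (Qchain (x n) (shift_path (int n) y)) (T n)) \<partial>Qchain z y)"
proof -
  have T0 [measurable]: "T n \<in> sets (PiM UNIV (\<lambda>_. borel))" for n using T by (auto simp: tail_family_def)
  have 1: "comb_seq n x w \<in> T 0 \<longleftrightarrow> w \<in> T n" for x w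
  proof -
    have "comb_seq n x w \<in> T 0 \<longleftrightarrow> (\<lambda>j. comb_seq n x w (n + j)) \<in> T (0 + n)"
      using T unfolding tail_family_def by blast
    then show ?thesis by (simp add: comb_seq_def)
  qed
  have "emeasure (Qchain z y) (B \<inter> T 0) = (\<integral>\<^sup>+x. indicator (B \<inter> T 0) x \<partial>Qchain z y)"
    by simp
  also have "\<dots> = (\<integral>\<^sup>+x. \<integral>\<^sup>+w. indicator (B \<inter> T 0) (comb_seq n x w) \<partial>Qchain (x n) (shift_path (int n) y) \<partial>Qchain z y)"
    by (subst nn_integral_markov_chain_Markov[where n=n]) (simp_all add: env_kernel_shift)
  also have "\<dots> = (\<integral>\<^sup>+x. indicator B x * ennreal (measure (Qchain (x n) (shift_path (int n) y)) (T n)) \<partial>Qchain z y)"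
  proof (intro nn_integral_cong)
    fix x
    interpret prob_space "Qchain (x n) (shift_path (int n) y)" by simp
    have "(\<integral>\<^sup>+w. indicator (B \<inter> T 0) (comb_seq n x w) \<partial>Qchain (x n) (shift_path (int n) y)) =
      (\<integral>\<^sup>+w. indicator B x * indicator (T n) w \<partial>Qchain (x n) (shift_path (int n) y))"
      by (intro nn_integral_cong) (auto simp: 1 Bn split: split_indicator)
    also have "\<dots> = indicator B x * ennreal (prob (T n))"
      by (subst nn_integral_cmult) (simp_all add: emeasure_eq_measure)
    finally show "(\<integral>\<^sup>+w. indicator (B \<inter> T 0) (comb_seq n x w) \<partial>Qchain (x n) (shift_path (int n) y)) =
      indicator B x * ennreal (prob (T n))" .
  qed
  finally show ?thesis .
qed

lemma measure_Qchain_tail: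
  assumes T: "tail_family T"
  shows "measure (Qchain z y) (T 0) = (\<integral>x. measure (Qchain x (shift_path (int n) y)) (T n) \<partial>Qm n z y)"
proof -
  let ?f = "\<lambda>x. measure (Qchain x (shift_path (int n) y)) (T n)"
  interpret c: prob_space "Qchain z y" by simp
  interpret q: prob_space "Qm n z y" by simp
  have f [measurable]: "?f \<in> borel_measurable borel" using T by measurable
  have "ennreal (measure (Qchain z y) (T 0)) = emeasure (Qchain z y) (UNIV \<inter> T 0)"
    by (simp add: c.emeasure_eq_measure)
  also have "\<dots> = (\<integral>\<^sup>+x. indicator UNIV x * ennreal (?f (x n)) \<partial>Qchain z y)"
    by (rule emeasure_Qchain_tail_Int[OF T]) (auto simp: space_PiM intro: sets.top[of "PiM UNIV (\<lambda>_. borel)", simplified])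
  also have "\<dots> = (\<integral>\<^sup>+x. ennreal (?f x) \<partial>Qm n z y)"
    unfolding quenched_marginal_def
    using nn_integral_markov_chain_marginal[where K="env_kernel PX y" and f="\<lambda>x. ennreal (?f x)" and n=n and z=z] by simp
  also have "\<dots> = ennreal (\<integral>x. ?f x \<partial>Qm n z y)"
    by (intro nn_integral_eq_integral q.integrable_const_bound[where B=1])
       (auto simp: prob_space.prob_le_1 measurable_cong_sets[OF sets_Qm refl])
  finally show ?thesis by (simp add: integral_nonneg_AE)
qed

text \<open>For each \<open>n\<close>, both probabilities are integrals of one and the same function
  into the unit interval against the two laws at time \<open>n\<close>. Their difference is thus
  below the distance at every \<open>n\<close>, and hence below its limit.\<close>

lemma tail_diff_le_merging:
  assumes T: "tail_family T"
  shows "\<bar>measure (Qchain z y) (T 0) - measure (Qchain z' y) (T 0)\<bar> \<le> merging PX z z' y"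
proof (rule LIMSEQ_le_const[OF tendsto_merging], intro exI allI impI)
  fix n
  show "\<bar>measure (Qchain z y) (T 0) - measure (Qchain z' y) (T 0)\<bar> \<le> tvd (Qm n z y) (Qm n z' y)"
    unfolding measure_Qchain_tail[OF T, of _ _ n] using T
    by (intro abs_integral_diff_le_tvd) (auto simp: prob_space.prob_le_1 measurable_cong_sets[OF sets_Qm refl])
qed

text \<open>The conditional probability of the tail event given the state at any time is almost
  surely the constant \<open>c\<close>. The event is therefore independent of every finite stretch
  of the path, and so of itself.\<close>

lemma measure_Qchain_tail_zero_one:
  assumes T: "tail_family T" and m0: "merging PX z z' y = 0"
    and mn: "\<And>n. AE x in Qm n z y. AE x' in Qm n z' y. merging PX x x' (shift_path (int n) y) = 0"
  shows "measure (Qchain z y) (T 0) = measure (Qchain z' y) (T 0)"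
    and "measure (Qchain z y) (T 0) = (measure (Qchain z y) (T 0))\<^sup>2"
proof -
  let ?S = "PiM UNIV (\<lambda>_. borel) :: (nat \<Rightarrow> 'e) measure"
  have T0 [measurable]: "T n \<in> sets ?S" for n using T by (auto simp: tail_family_def)
  have [simp, measurable]: "UNIV \<in> sets ?S" using sets.top[of ?S] by (simp add: space_PiM)
  define c where "c = measure (Qchain z' y) (T 0)"
  show eq: "measure (Qchain z y) (T 0) = measure (Qchain z' y) (T 0)"
    using tail_diff_le_merging[OF T, of z y z'] m0 by simp
  interpret Z: prob_space "Qchain z y" by simp
  have const: "AE x in Qm n z y. measure (Qchain x (shift_path (int n) y)) (T n) = c" for n
    using mn[of n]
  proof eventually_elim
    case (elim x)
    let ?f = "\<lambda>x. measure (Qchain x (shift_path (int n) y)) (T n)"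
    interpret q: prob_space "Qm n z' y" by simp
    have [measurable]: "?f \<in> borel_measurable borel" using T by measurable
    \<comment> \<open>For a fixed typical \<open>x\<close>, almost every \<open>x'\<close> gives the
      same value; averaging over the chain from \<open>z'\<close> identifies this value as
      \<open>c\<close>.\<close>
    have "AE x' in Qm n z' y. ?f x' = ?f x"
      using elim
    proof eventually_elim
      case (elim x')
      with tail_diff_le_merging[OF tail_family_shift[OF T, of n], of x "shift_path (int n) y" x']
      show ?case by simp
    qed
    then have "(\<integral>x'. ?f x' \<partial>Qm n z' y) = (\<integral>x'. ?f x \<partial>Qm n z' y)"
      by (intro integral_cong_AE) auto
    with q.prob_space show ?case unfolding c_def measure_Qchain_tail[OF T, of z' y n] by simp
  qed
  have ind: "emeasure (Qchain z y) (B \<inter> T 0) = ennreal c * emeasure (Qchain z y) B"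
    if B [measurable]: "B \<in> sets ?S" and Bn: "\<And>x w. comb_seq m x w \<in> B \<longleftrightarrow> x \<in> B" for B m
  proof -
    have "AE x in distr (Qchain z y) borel (\<lambda>w. w m). measure (Qchain x (shift_path (int m) y)) (T m) = c"
      using const[of m] unfolding quenched_marginal_def by (subst distr_markov_chain_marginal) measurable
    then have "AE x in Qchain z y. measure (Qchain (x m) (shift_path (int m) y)) (T m) = c"
      by (rule AE_distrD[rotated]) measurable
    then have "emeasure (Qchain z y) (B \<inter> T 0) = (\<integral>\<^sup>+x. ennreal c * indicator B x \<partial>Qchain z y)"
      unfolding emeasure_Qchain_tail_Int[OF T B Bn]
      by (intro nn_integral_cong_AE) (auto simp: mult.commute)
    then show ?thesis by (simp add: nn_integral_cmult)
  qed
  \<comment> \<open>Independence of all cylinders is stated as equality of two measures, which can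
    then be evaluated at \<open>T 0\<close> itself.\<close>
  have "density (Qchain z y) (indicator (T 0)) = density (Qchain z y) (\<lambda>_. ennreal c)"
  proof (rule measure_eqI_seq_cylinders)
    show "finite_measure (density (Qchain z y) (indicator (T 0)))"
    proof
      have "emeasure (Qchain z y) (T 0) \<noteq> \<infinity>" by simp
      then show "emeasure (density (Qchain z y) (indicator (T 0))) (space (density (Qchain z y) (indicator (T 0)))) \<noteq> \<infinity>"
        by (simp add: emeasure_density)
    qed
    fix n and A :: "nat \<Rightarrow> 'e set" assume [measurable]: "\<And>i. A i \<in> sets borel"
    let ?B = "{x. \<forall>i\<le>n. x i \<in> A i}"
    have B [measurable]: "?B \<in> sets ?S" by measurable
    have "emeasure (Qchain z y) (?B \<inter> T 0) = ennreal c * emeasure (Qchain z y) ?B"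
    proof (rule ind[OF B])
      \<comment> \<open>The cylinder constrains times up to and including \<open>n\<close>, so the
        splice must come at \<open>Suc n\<close>.\<close>
      show "comb_seq (Suc n) x w \<in> ?B \<longleftrightarrow> x \<in> ?B" for x w :: "nat \<Rightarrow> 'e" by (auto simp: comb_seq_def)
    qed
    then show "emeasure (density (Qchain z y) (indicator (T 0))) ?B = emeasure (density (Qchain z y) (\<lambda>_. ennreal c)) ?B"
      by (simp add: emeasure_density nn_integral_cmult indicator_inter_arith[symmetric] Int_commute)
  qed simp_all
  then have "emeasure (density (Qchain z y) (indicator (T 0))) (T 0) = emeasure (density (Qchain z y) (\<lambda>_. ennreal c)) (T 0)"
    by simp
  then have "emeasure (Qchain z y) (T 0) = ennreal c * emeasure (Qchain z y) (T 0)"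
    by (simp add: emeasure_density nn_integral_cmult indicator_inter_arith[symmetric])
  then have "measure (Qchain z y) (T 0) = c * measure (Qchain z y) (T 0)"
    by (simp add: Z.emeasure_eq_measure c_def ennreal_mult[symmetric])
  with eq show "measure (Qchain z y) (T 0) = (measure (Qchain z y) (T 0))\<^sup>2"
    by (simp add: c_def power2_eq_square)
qed

lemma tail_X_obtain:
  assumes A: "A \<in> (tail_X :: ((int \<Rightarrow> 'e) \<times> (int \<Rightarrow> 'f)) set set)"
  obtains T where "tail_family T" "\<And>z y. measure (quenched_law PX z y) A = measure (Qchain z y) (T 0)"
proof -
  have "\<exists>T. T \<in> sets (PiM UNIV (\<lambda>_::nat. borel)) \<and> A = {\<omega>. (\<lambda>k. X_at (int (n + k)) \<omega>) \<in> T}" for n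
  proof -
    have "A \<in> sets (FX {int n..})" using A by (auto simp: tail_X_def)
    then show ?thesis by (rule sets_FX_atLeast_obtain) auto
  qed
  then obtain T where T: "\<And>n. T n \<in> sets (PiM UNIV (\<lambda>_::nat. borel))"
    "\<And>n. A = {\<omega>. (\<lambda>k. X_at (int (n + k)) \<omega>) \<in> T n}" by metis
  have "w \<in> T n \<longleftrightarrow> (\<lambda>j. w (k + j)) \<in> T (n + k)" for n k w
  proof -
    \<comment> \<open>A two-sided path whose signal from time \<open>n\<close> on is
      \<open>w\<close>. Earlier coordinates are filled with \<open>w 0\<close>, since
      \<open>nat\<close> truncates; neither they nor the observations affect membership in a tail
      event.\<close>
    define \<omega> where "\<omega> = ((\<lambda>i. w (nat (i - int n))), undefined :: int \<Rightarrow> 'f)"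
    have "\<omega> \<in> A \<longleftrightarrow> w \<in> T n" by (subst T(2)[of n]) (simp add: \<omega>_def X_at_def)
    moreover have "\<omega> \<in> A \<longleftrightarrow> (\<lambda>j. w (k + j)) \<in> T (n + k)"
      by (subst T(2)[of "n + k"]) (simp add: \<omega>_def X_at_def nat_add_distrib add.assoc)
    ultimately show ?thesis by simp
  qed
  with T(1) have "tail_family T" by (auto simp: tail_family_def)
  moreover have "measure (quenched_law PX z y) A = measure (Qchain z y) (T 0)" for z y
  proof -
    have "A \<in> sets (FX {int 0..})" using A unfolding tail_X_def by blast
    then have "A \<in> sets (FX {0..})" by simp
    moreover have "(\<lambda>x. (\<lambda>k. x (nat k), y)) -` A \<inter> space (Qchain z y) = T 0"
      by (subst T(2)[of 0]) (auto simp: X_at_def)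
    ultimately show ?thesis
      unfolding quenched_law_eq by (simp add: measure_distr[OF measurable_embed])
  qed
  ultimately show thesis by (rule that)
qed

lemma quenched_law_tail_zero_one:
  assumes A: "A \<in> tail_X" and m: "merging PX z z' y = 0"
    "\<And>n. AE x in Qm n z y. AE x' in Qm n z' y. merging PX x x' (shift_path (int n) y) = 0"
  shows "measure (quenched_law PX z y) A = (measure (quenched_law PX z y) A)\<^sup>2"
    and "(measure (quenched_law PX z y) A)\<^sup>2 = measure (quenched_law PX z' y) A"
proof -
  obtain T where T: "tail_family T" and eq: "\<And>z y. measure (quenched_law PX z y) A = measure (Qchain z y) (T 0)"
    using tail_X_obtain[OF A] by metis
  show "measure (quenched_law PX z y) A = (measure (quenched_law PX z y) A)\<^sup>2"
    "(measure (quenched_law PX z y) A)\<^sup>2 = measure (quenched_law PX z' y) A"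
    using measure_Qchain_tail_zero_one[OF T m] by (simp_all add: eq)
qed

end

section \<open>Conditional kernels\<close>

text \<open>The law of the pair and the measure built from the kernel agree on rectangles, hence
  everywhere. This lifts a statement about single events to integrands in which the conditioning
  variable and \<open>Z\<close> occur jointly, which is how all conditional laws are used
  later.\<close>

lemma nn_integral_joint_kernel:
  assumes M: "prob_space M" and spM: "space M = UNIV" and spF: "space F = UNIV" and FM: "sets F \<subseteq> sets M"
    and Z [measurable]: "Z \<in> M \<rightarrow>\<^sub>M N" and k [measurable]: "\<kappa> \<in> M \<rightarrow>\<^sub>M prob_algebra N"
    and N: "space N = UNIV" "sets N = sigma_sets UNIV \<G>" and \<G>: "Int_stable \<G>" "UNIV \<in> \<G>"
    and eq: "\<And>C A. C \<in> sets F \<Longrightarrow> A \<in> \<G> \<Longrightarrow>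
      emeasure M (C \<inter> Z -` A) = (\<integral>\<^sup>+\<omega>. indicator C \<omega> * emeasure (\<kappa> \<omega>) A \<partial>M)"
    and G: "G \<in> borel_measurable (F \<Otimes>\<^sub>M N)"
  shows "(\<integral>\<^sup>+\<omega>. G (\<omega>, Z \<omega>) \<partial>M) = (\<integral>\<^sup>+\<omega>. \<integral>\<^sup>+v. G (\<omega>, v) \<partial>\<kappa> \<omega> \<partial>M)"
proof -
  interpret prob_space M by (rule M)
  have [measurable]: "(\<lambda>\<omega>. \<omega>) \<in> M \<rightarrow>\<^sub>M F"
    using FM spM spF by (intro measurableI) (auto simp: subset_eq)
  define L where "L \<omega> = distr (\<kappa> \<omega>) (F \<Otimes>\<^sub>M N) (\<lambda>v. (\<omega>, v))" for \<omega>
  have L: "L \<in> M \<rightarrow>\<^sub>M prob_algebra (F \<Otimes>\<^sub>M N)"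
    unfolding L_def by measurable
  have Min: "M \<in> space (prob_algebra M)" using M by (simp add: space_prob_algebra)
  note kap = prob_kernelD(2,3)[OF k, unfolded spM, OF UNIV_I]
  have mP [measurable]: "(\<lambda>v. (\<omega>, v)) \<in> \<kappa> \<omega> \<rightarrow>\<^sub>M F \<Otimes>\<^sub>M N" for \<omega>
    using measurable_Pair1'[of \<omega> F N] spF by (simp add: measurable_cong_sets[OF kap(1) refl])
  let ?E = "{C \<times> A | C A. C \<in> sets F \<and> A \<in> \<G>}"
  have GN: "A \<in> sets N" if "A \<in> \<G>" for A using that N by auto
  have "distr M (F \<Otimes>\<^sub>M N) (\<lambda>\<omega>. (\<omega>, Z \<omega>)) = M \<bind> L"
  proof (rule measure_eqI_generator_eq[where E="?E" and \<Omega>="UNIV" and A="\<lambda>_. UNIV"])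
    show "Int_stable ?E"
    proof (rule Int_stableI, safe)
      fix C A C' A' assume "C \<in> sets F" "C' \<in> sets F" "A \<in> \<G>" "A' \<in> \<G>"
      then show "\<exists>C'' A''. C \<times> A \<inter> C' \<times> A' = C'' \<times> A'' \<and> C'' \<in> sets F \<and> A'' \<in> \<G>"
        using \<G>(1) by (intro exI[of _ "C \<inter> C'"] exI[of _ "A \<inter> A'"]) (auto simp: Int_stable_def)
    qed
    have s: "sets (F \<Otimes>\<^sub>M N) = sigma_sets UNIV ?E"
    proof -
      have "sets (F \<Otimes>\<^sub>M N) = sets (sigma (space F \<times> space N) {a \<times> b | a b. a \<in> sets F \<and> b \<in> \<G>})"
        using spF N \<G>(2) sets.top[of F] sets.sigma_sets_eq[of F]
        by (intro sets_pair_eq[where Ca="{UNIV}" and Cb="{UNIV}"]) auto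
      also have "\<dots> = sigma_sets UNIV ?E"
        using spF N by (subst sets_measure_of) auto
      finally show ?thesis .
    qed
    then show "sets (distr M (F \<Otimes>\<^sub>M N) (\<lambda>\<omega>. (\<omega>, Z \<omega>))) = sigma_sets UNIV ?E"
      "sets (M \<bind> L) = sigma_sets UNIV ?E"
      by (simp_all add: sets_bind'[OF Min L])
    have "UNIV \<times> UNIV \<in> ?E"
      using \<G>(2) sets.top[of F] unfolding spF by blast
    then show "range (\<lambda>_::nat. UNIV) \<subseteq> ?E" by simp
    interpret D: prob_space "distr M (F \<Otimes>\<^sub>M N) (\<lambda>\<omega>. (\<omega>, Z \<omega>))"
      by (rule prob_space_distr) measurable
    show "emeasure (distr M (F \<Otimes>\<^sub>M N) (\<lambda>\<omega>. (\<omega>, Z \<omega>))) UNIV \<noteq> \<infinity>" for i :: nat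
      using D.emeasure_finite[of UNIV] by simp
    fix X assume "X \<in> ?E"
    then obtain C A where X: "X = C \<times> A" "C \<in> sets F" "A \<in> \<G>" by auto
    have X' [measurable]: "X \<in> sets (F \<Otimes>\<^sub>M N)" using X GN by auto
    have "emeasure (distr M (F \<Otimes>\<^sub>M N) (\<lambda>\<omega>. (\<omega>, Z \<omega>))) X = emeasure M ((\<lambda>\<omega>. (\<omega>, Z \<omega>)) -` X \<inter> space M)"
      by (rule emeasure_distr) measurable
    also have "(\<lambda>\<omega>. (\<omega>, Z \<omega>)) -` X \<inter> space M = C \<inter> Z -` A"
      using X spM by auto
    also have "emeasure M (C \<inter> Z -` A) = (\<integral>\<^sup>+\<omega>. indicator C \<omega> * emeasure (\<kappa> \<omega>) A \<partial>M)"
      using X by (intro eq)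
    also have "\<dots> = (\<integral>\<^sup>+\<omega>. emeasure (L \<omega>) X \<partial>M)"
    proof (intro nn_integral_cong)
      fix \<omega>
      have "(\<lambda>v. (\<omega>, v)) -` X \<inter> space (\<kappa> \<omega>) = (if \<omega> \<in> C then A else {})"
        using kap N unfolding X(1) by auto
      then show "indicator C \<omega> * emeasure (\<kappa> \<omega>) A = emeasure (L \<omega>) X"
        unfolding L_def by (subst emeasure_distr) (auto split: split_indicator)
    qed
    also have "\<dots> = emeasure (M \<bind> L) X"
      by (rule emeasure_bind_prob_algebra[OF Min L X', symmetric])
    finally show "emeasure (distr M (F \<Otimes>\<^sub>M N) (\<lambda>\<omega>. (\<omega>, Z \<omega>))) X = emeasure (M \<bind> L) X" .
  qed auto
  then have "(\<integral>\<^sup>+w. G w \<partial>distr M (F \<Otimes>\<^sub>M N) (\<lambda>\<omega>. (\<omega>, Z \<omega>))) = (\<integral>\<^sup>+w. G w \<partial>(M \<bind> L))"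
    by simp
  then show ?thesis
    using G by (simp add: nn_integral_distr nn_integral_bind_prob_algebra[OF Min L] L_def)
qed

text \<open>The null set in the hypothesis depends on \<open>A\<close>, but it is only used under an
  integral over \<open>C\<close>, so no common null set has to be found; the generator may be
  uncountable.\<close>

lemma nn_integral_cond_kernel:
  assumes M: "prob_space M" and spM: "space M = UNIV" and spF: "space F = UNIV" and FM: "sets F \<subseteq> sets M"
    and Z [measurable]: "Z \<in> M \<rightarrow>\<^sub>M N" and k [measurable]: "\<kappa> \<in> M \<rightarrow>\<^sub>M prob_algebra N"
    and N: "space N = UNIV" "sets N = sigma_sets UNIV \<G>" and \<G>: "Int_stable \<G>" "UNIV \<in> \<G>"
    and eq: "\<And>A. A \<in> \<G> \<Longrightarrow> AE \<omega> in M. cprob M F (Z -` A) \<omega> = measure (\<kappa> \<omega>) A"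
    and G: "G \<in> borel_measurable (F \<Otimes>\<^sub>M N)"
  shows "(\<integral>\<^sup>+\<omega>. G (\<omega>, Z \<omega>) \<partial>M) = (\<integral>\<^sup>+\<omega>. \<integral>\<^sup>+v. G (\<omega>, v) \<partial>\<kappa> \<omega> \<partial>M)"
proof (rule nn_integral_joint_kernel[OF M spM spF FM Z k N \<G> _ G])
  interpret prob_space M by (rule M)
  interpret finite_measure_subalgebra M F
    by unfold_locales (use FM spM spF in \<open>simp add: subalgebra_def\<close>)
  fix C A assume C: "C \<in> sets F" and A: "A \<in> \<G>"
  have CM [measurable]: "C \<in> sets M" using C FM by auto
  have AN [measurable]: "A \<in> sets N" using A N by auto
  have ZA [measurable]: "Z -` A \<in> sets M" using measurable_sets[OF Z AN] spM by simp
  have k': "\<kappa> \<in> M \<rightarrow>\<^sub>M prob_algebra N" by (rule k)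
  have pk: "prob_space (\<kappa> \<omega>)" for \<omega> using prob_kernelD(1)[OF k', of \<omega>] spM by simp
  have i: "integrable M (indicat_real (Z -` A))"
    by (rule integrable_real_indicator) (auto simp: emeasure_eq_measure)
  have mk [measurable]: "(\<lambda>\<omega>. measure (\<kappa> \<omega>) A) \<in> borel_measurable M" by measurable
  have "measure M (C \<inter> Z -` A) = (\<integral>\<omega>. indicator C \<omega> * indicat_real (Z -` A) \<omega> \<partial>M)"
    using spM by (simp add: indicator_inter_arith[symmetric])
  also have "\<dots> = (\<integral>\<omega>. indicator C \<omega> * cprob M F (Z -` A) \<omega> \<partial>M)"
    using real_cond_exp_intA[OF i C] by (simp add: set_lebesgue_integral_def)
  also have "\<dots> = (\<integral>\<omega>. indicator C \<omega> * measure (\<kappa> \<omega>) A \<partial>M)"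
    using eq[OF A] by (intro integral_cong_AE) auto
  finally have m: "measure M (C \<inter> Z -` A) = (\<integral>\<omega>. indicator C \<omega> * measure (\<kappa> \<omega>) A \<partial>M)" .
  have "(\<integral>\<^sup>+\<omega>. indicator C \<omega> * emeasure (\<kappa> \<omega>) A \<partial>M) = (\<integral>\<^sup>+\<omega>. ennreal (indicator C \<omega> * measure (\<kappa> \<omega>) A) \<partial>M)"
    using pk by (intro nn_integral_cong)
      (auto simp: finite_measure.emeasure_eq_measure prob_space.finite_measure split: split_indicator)
  also have "\<dots> = ennreal (\<integral>\<omega>. indicator C \<omega> * measure (\<kappa> \<omega>) A \<partial>M)"
    using pk by (intro nn_integral_eq_integral integrable_const_bound[where B=1])
      (auto simp: prob_space.prob_le_1 split: split_indicator)
  finally show "emeasure M (C \<inter> Z -` A) = (\<integral>\<^sup>+\<omega>. indicator C \<omega> * emeasure (\<kappa> \<omega>) A \<partial>M)"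
    by (simp add: emeasure_eq_measure m)
qed

section \<open>Product kernels and coordinate sigma-algebras\<close>

lemma sets_PiM_cylinder [measurable]:
  assumes "finite J" "\<And>i. i \<in> J \<Longrightarrow> A i \<in> sets borel"
  shows "{x :: 'i \<Rightarrow> 'a::topological_space. \<forall>i\<in>J. x i \<in> A i} \<in> sets (PiM UNIV (\<lambda>_. borel))"
proof -
  have "{x :: 'i \<Rightarrow> 'a. \<forall>i\<in>J. x i \<in> A i} = prod_emb UNIV (\<lambda>_. borel) J (Pi\<^sub>E J A)"
    by (auto simp: prod_emb_def PiE_iff)
  then show ?thesis using assms by (auto intro: sets_PiM_I)
qed

lemma sets_PiM_sigma_cylinders:
  "sets (PiM UNIV (\<lambda>_. borel) :: ('i \<Rightarrow> 'a::topological_space) measure) =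
    sigma_sets UNIV {{x. \<forall>i\<in>J. x i \<in> A i} | J A. finite J \<and> (\<forall>i\<in>J. A i \<in> sets borel)}" (is "sets ?P = sigma_sets UNIV ?G")
proof (intro antisym)
  show "sets ?P \<subseteq> sigma_sets UNIV ?G"
    unfolding sets_PiM_single
  proof (simp add: PiE_def, rule sigma_sets_mono, safe)
    fix i :: 'i and A :: "'a set" assume A: "A \<in> sets borel"
    have "{f. f i \<in> A} = {x. \<forall>j\<in>{i}. x j \<in> A}"
      by auto
    then show "{f. f i \<in> A} \<in> sigma_sets UNIV ?G"
      using A by (intro sigma_sets.Basic CollectI exI[of _ "{i}"] exI[of _ "\<lambda>_. A"]) auto
  qed
  have "sigma_sets (space ?P) ?G \<subseteq> sets ?P"
    by (rule sets.sigma_sets_subset) auto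
  then show "sigma_sets UNIV ?G \<subseteq> sets ?P"
    by (simp add: space_PiM)
qed

lemma Int_stable_PiM_cylinders:
  "Int_stable {{x :: 'i \<Rightarrow> 'a::topological_space. \<forall>i\<in>J. x i \<in> A i} | J A. finite J \<and> (\<forall>i\<in>J. A i \<in> sets borel)}"
proof (rule Int_stableI, safe)
  fix J J' and A B :: "'i \<Rightarrow> 'a set" assume *: "finite J" "finite J'" "\<forall>i\<in>J. A i \<in> sets borel" "\<forall>i\<in>J'. B i \<in> sets borel"
  show "\<exists>I C. {x. \<forall>i\<in>J. x i \<in> A i} \<inter> {x. \<forall>i\<in>J'. x i \<in> B i} = {x. \<forall>i\<in>I. x i \<in> C i} \<and> finite I \<and> (\<forall>i\<in>I. C i \<in> sets borel)"
    using *
    by (intro exI[of _ "J \<union> J'"] exI[of _ "\<lambda>i. (if i \<in> J then A i else UNIV) \<inter> (if i \<in> J' then B i else UNIV)"]) auto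
qed

lemma emeasure_PiM_cylinder:
  fixes M :: "'i \<Rightarrow> 'a::topological_space measure"
  assumes M: "\<And>i. prob_space (M i)" "\<And>i. sets (M i) = sets borel" and J: "finite J" "\<And>i. i \<in> J \<Longrightarrow> A i \<in> sets borel"
  shows "emeasure (PiM UNIV M) {x. \<forall>i\<in>J. x i \<in> A i} = (\<Prod>i\<in>J. emeasure (M i) (A i))"
proof -
  have "space (M i) = UNIV" for i using sets_eq_imp_space_eq[OF M(2)] by simp
  then have "{x. \<forall>i\<in>J. x i \<in> A i} = prod_emb UNIV M J (Pi\<^sub>E J A)"
    by (auto simp: prod_emb_def PiE_iff)
  then show ?thesis using assms by (simp add: emeasure_PiM_emb)
qed

lemma sets_PiM_borel: "(\<And>i. sets (M i) = sets borel) \<Longrightarrow> sets (PiM UNIV M) = sets (PiM UNIV (\<lambda>_. borel))"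
  by (intro sets_PiM_cong) auto

lemma measurable_PiM_kernel [measurable (raw)]:
  fixes k :: "'i \<Rightarrow> 'b \<Rightarrow> 'a::topological_space measure"
  assumes k: "\<And>i. k i \<in> M \<rightarrow>\<^sub>M prob_algebra borel"
  shows "(\<lambda>x. PiM UNIV (\<lambda>i. k i x)) \<in> M \<rightarrow>\<^sub>M prob_algebra (PiM UNIV (\<lambda>_. borel))"
proof (rule measurable_prob_algebra_generated[OF sets_PiM_sigma_cylinders Int_stable_PiM_cylinders])
  fix x assume x: "x \<in> space M"
  note kx = prob_kernelD(1,2)[OF k x]
  show "prob_space (PiM UNIV (\<lambda>i. k i x))" by (intro prob_space_PiM kx)
  show "sets (PiM UNIV (\<lambda>i. k i x)) = sets (PiM UNIV (\<lambda>_. borel))" by (intro sets_PiM_borel kx)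
next
  fix B :: "('i \<Rightarrow> 'a) set" assume "B \<in> {{x. \<forall>i\<in>J. x i \<in> A i} | J A. finite J \<and> (\<forall>i\<in>J. A i \<in> sets borel)}"
  then obtain J A where B: "B = {x. \<forall>i\<in>J. x i \<in> A i}" and J: "finite J" "\<And>i. i \<in> J \<Longrightarrow> A i \<in> sets borel" by auto
  have "(\<lambda>x. emeasure (PiM UNIV (\<lambda>i. k i x)) B) \<in> borel_measurable M \<longleftrightarrow>
    (\<lambda>x. \<Prod>i\<in>J. emeasure (k i x) (A i)) \<in> borel_measurable M"
    unfolding B by (intro measurable_cong emeasure_PiM_cylinder prob_kernelD[OF k] J)
  also have "\<dots>"
    using J measurable_prob_algebraD[OF k]
    by (intro borel_measurable_prod_ennreal measurable_compose[OF _ measurable_emeasure_subprob_algebra]) auto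
  finally show "(\<lambda>x. emeasure (PiM UNIV (\<lambda>i. k i x)) B) \<in> borel_measurable M" .
qed auto

lemma space_FY [simp]: "space (FY I) = UNIV"
  by (simp add: FY_def space_measure_of_conv)

lemma sets_FY: "sets (FY I) = sigma_sets UNIV {Y_at k -` A | k A. k \<in> I \<and> A \<in> sets borel}"
  unfolding FY_def by (rule sets_measure_of) auto

lemma measurable_Y_at_FY: "k \<in> I \<Longrightarrow> Y_at k \<in> FY I \<rightarrow>\<^sub>M borel"
  by (rule measurableI) (auto simp: sets_FY)

lemma measurable_Y_path_FY: "Y_path \<in> FY UNIV \<rightarrow>\<^sub>M path_space"
  by (rule measurable_PiM_single') (auto simp: Y_path_def measurable_Y_at_FY)

lemma space_sigma_join [simp]: "space (sigma_join F G) = space F \<union> space G"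
  by (simp add: sigma_join_def space_measure_of_conv)

lemma sets_sigma_join:
  "space F = UNIV \<Longrightarrow> space G = UNIV \<Longrightarrow> sets (sigma_join F G) = sigma_sets UNIV (sets F \<union> sets G)"
  unfolding sigma_join_def by (subst sets_measure_of) auto

lemma measurable_X_at [measurable]: "X_at n \<in> Omega \<rightarrow>\<^sub>M borel"
  unfolding X_at_def [abs_def] by measurable

lemma measurable_Y_at [measurable]: "Y_at n \<in> Omega \<rightarrow>\<^sub>M borel"
  unfolding Y_at_def [abs_def] by measurable

lemma Y_path_eq: "Y_path = snd"
  by (auto simp: Y_path_def Y_at_def)

lemma space_Omega: "space Omega = UNIV"
  by (simp add: space_pair_measure space_PiM)

lemma sets_FX_subset: "sets (FX I) \<subseteq> sets (Omega :: ((int \<Rightarrow> 'e::polish_space) \<times> (int \<Rightarrow> 'f::polish_space)) measure)"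
proof -
  have "sigma_sets (space Omega) {X_at k -` A | k A. k \<in> I \<and> A \<in> sets borel} \<subseteq> sets (Omega :: ((int \<Rightarrow> 'e) \<times> (int \<Rightarrow> 'f)) measure)"
    using measurable_sets[OF measurable_X_at] by (intro sets.sigma_sets_subset) (auto simp: space_Omega)
  then show ?thesis by (simp add: sets_FX space_Omega)
qed

lemma sets_FY_subset: "sets (FY I) \<subseteq> sets (Omega :: ((int \<Rightarrow> 'e::polish_space) \<times> (int \<Rightarrow> 'f::polish_space)) measure)"
proof -
  have "sigma_sets (space Omega) {Y_at k -` A | k A. k \<in> I \<and> A \<in> sets borel} \<subseteq> sets (Omega :: ((int \<Rightarrow> 'e) \<times> (int \<Rightarrow> 'f)) measure)"
    using measurable_sets[OF measurable_Y_at] by (intro sets.sigma_sets_subset) (auto simp: space_Omega)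
  then show ?thesis by (simp add: sets_FY space_Omega)
qed

lemma sets_FXY_subset:
  "sets (sigma_join (FX I) (FY J)) \<subseteq> sets (Omega :: ((int \<Rightarrow> 'e::polish_space) \<times> (int \<Rightarrow> 'f::polish_space)) measure)"
proof -
  have "sigma_sets (space Omega) (sets (FX I) \<union> sets (FY J)) \<subseteq> sets (Omega :: ((int \<Rightarrow> 'e) \<times> (int \<Rightarrow> 'f)) measure)"
    using sets_FX_subset sets_FY_subset by (intro sets.sigma_sets_subset) auto
  then show ?thesis by (simp add: sets_sigma_join space_Omega)
qed

lemma sets_FX_mono: "I \<subseteq> J \<Longrightarrow> sets (FX I) \<subseteq> sets (FX J)"
  unfolding sets_FX by (rule sigma_sets_mono') auto

lemma measurable_X_at_FXY: "k \<in> I \<Longrightarrow> X_at k \<in> sigma_join (FX I) (FY J) \<rightarrow>\<^sub>M borel"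
  using measurable_sets[OF measurable_X_at_FX, of k I] by (intro measurableI) (auto simp: sets_sigma_join)

lemma measurable_Y_path_FXY: "Y_path \<in> sigma_join (FX I) (FY UNIV) \<rightarrow>\<^sub>M path_space"
  using measurable_sets[OF measurable_Y_path_FY] by (intro measurableI) (auto simp: sets_sigma_join space_PiM)

lemma sets_FXY_mono: "I \<subseteq> J \<Longrightarrow> sets (sigma_join (FX I) (FY K)) \<subseteq> sets (sigma_join (FX J) (FY K))"
  using sets_FX_mono[of I J] by (simp add: sets_sigma_join) (auto intro!: sigma_sets_mono')

lemma measurable_pair_mono:
  assumes "f \<in> M \<Otimes>\<^sub>M N \<rightarrow>\<^sub>M L" "space M = space M'" "sets M \<subseteq> sets M'"
  shows "f \<in> M' \<Otimes>\<^sub>M N \<rightarrow>\<^sub>M L"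
proof -
  have [measurable]: "(\<lambda>x. x) \<in> M' \<rightarrow>\<^sub>M M"
    using assms by (intro measurableI) auto
  have "(\<lambda>(x, y). (x, y)) \<in> M' \<Otimes>\<^sub>M N \<rightarrow>\<^sub>M M \<Otimes>\<^sub>M N" by measurable
  from measurable_compose[OF this assms(1)] show ?thesis by (simp add: case_prod_beta')
qed

section \<open>The hidden Markov model\<close>

locale stationary_hmm =
  fixes P :: "'e::polish_space \<Rightarrow> 'e measure" and \<pi> :: "'e measure"
    and \<Phi> :: "'e \<Rightarrow> 'f::polish_space measure"
    and \<P> :: "((int \<Rightarrow> 'e) \<times> (int \<Rightarrow> 'f)) measure"
  assumes P [measurable]: "P \<in> borel \<rightarrow>\<^sub>M prob_algebra borel"
    and \<Phi> [measurable]: "\<Phi> \<in> borel \<rightarrow>\<^sub>M prob_algebra borel"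
    and law: "stationary_hmm_law P \<pi> \<Phi> \<P>"
begin

lemma PP_in: "\<P> \<in> space (prob_algebra Omega)"
  and distr_X_at: "distr \<P> borel (X_at n) = \<pi>"
  using law by (auto simp: stationary_hmm_law_def)

lemma prob_PP [simp]: "prob_space \<P>" and sets_PP [simp, measurable_cong]: "sets \<P> = sets Omega"
  using PP_in by (auto simp: space_prob_algebra)

lemma space_PP [simp]: "space \<P> = UNIV"
  using sets_eq_imp_space_eq[OF sets_PP] by (simp add: space_Omega)

sublocale PP: prob_space \<P> by (rule prob_PP)

lemma sets_PP_measurable: "f \<in> Omega \<rightarrow>\<^sub>M N \<Longrightarrow> f \<in> \<P> \<rightarrow>\<^sub>M N"
  by (simp add: measurable_cong_sets[OF sets_PP refl])

lemma nn_integral_X_step: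
  assumes "G \<in> borel_measurable (FX {..n} \<Otimes>\<^sub>M borel)"
  shows "(\<integral>\<^sup>+\<omega>. G (\<omega>, X_at (n + 1) \<omega>) \<partial>\<P>) = (\<integral>\<^sup>+\<omega>. \<integral>\<^sup>+v. G (\<omega>, v) \<partial>P (X_at n \<omega>) \<partial>\<P>)"
proof (rule nn_integral_cond_kernel[where \<G>="sets borel" and F="FX {..n}"])
  show "sets (FX {..n}) \<subseteq> sets \<P>" using sets_FX_subset by simp
  show "AE \<omega> in \<P>. cprob \<P> (FX {..n}) (X_at (n + 1) -` A) \<omega> = measure (P (X_at n \<omega>)) A" if "A \<in> sets borel" for A
    using law that by (auto simp: stationary_hmm_law_def)
  show "sets borel = sigma_sets UNIV (sets (borel :: 'e measure))"
    using sets.sigma_sets_eq[of "borel :: 'e measure"] by simp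
qed (use assms in \<open>auto simp: Int_stable_def intro!: sets_PP_measurable\<close>)

text \<open>The index type is left open so that the same kernel serves two-sided signals and signals
  that start at time 0.\<close>

abbreviation obs_kernel :: "('i \<Rightarrow> 'e) \<Rightarrow> ('i \<Rightarrow> 'f) measure" where
  "obs_kernel x \<equiv> PiM UNIV (\<lambda>i. \<Phi> (x i))"

lemma \<Phi>_simps [simp]: "prob_space (\<Phi> x)" "sets (\<Phi> x) = sets borel" "space (\<Phi> x) = UNIV"
  using prob_kernelD[OF \<Phi>, of x] by auto

lemma measurable_obs_kernel [measurable]:
  "obs_kernel \<in> PiM UNIV (\<lambda>_. borel) \<rightarrow>\<^sub>M prob_algebra (PiM UNIV (\<lambda>_. borel))"
  by (rule measurable_PiM_kernel) measurable

lemma obs_kernel_simps [simp]: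
  "prob_space (obs_kernel x)" "sets (obs_kernel x) = sets (PiM UNIV (\<lambda>_. borel))" "space (obs_kernel x) = UNIV"
  using prob_kernelD[OF measurable_obs_kernel, of x] by (auto simp: space_PiM)

lemma nn_integral_observations:
  assumes "G \<in> borel_measurable (FX UNIV \<Otimes>\<^sub>M path_space)"
  shows "(\<integral>\<^sup>+\<omega>. G (\<omega>, Y_path \<omega>) \<partial>\<P>) = (\<integral>\<^sup>+\<omega>. \<integral>\<^sup>+y. G (\<omega>, y) \<partial>obs_kernel (fst \<omega>) \<partial>\<P>)"
proof (rule nn_integral_cond_kernel[where F="FX UNIV" and N="path_space"
    and \<G>="{{x. \<forall>i\<in>J. x i \<in> A i} | J A. finite J \<and> (\<forall>i\<in>J. A i \<in> sets borel)}"])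
  show "sets (FX UNIV) \<subseteq> sets \<P>" using sets_FX_subset by simp
  show "Y_path \<in> \<P> \<rightarrow>\<^sub>M path_space" unfolding Y_path_eq by measurable
  show "(\<lambda>\<omega>. obs_kernel (fst \<omega>)) \<in> \<P> \<rightarrow>\<^sub>M prob_algebra path_space" by measurable
  fix B :: "(int \<Rightarrow> 'f) set" assume "B \<in> {{x. \<forall>i\<in>J. x i \<in> A i} | J A. finite J \<and> (\<forall>i\<in>J. A i \<in> sets borel)}"
  then obtain J A where B: "B = {x. \<forall>i\<in>J. x i \<in> A i}" and J: "finite J" "\<And>i. i \<in> J \<Longrightarrow> A i \<in> sets borel" by auto
  have 1: "Y_path -` B = (\<Inter>j\<in>J. Y_at j -` A j)" unfolding B by (auto simp: Y_path_def)
  have 2: "measure (obs_kernel (fst \<omega>)) B = (\<Prod>j\<in>J. measure (\<Phi> (X_at j \<omega>)) (A j))" for \<omega>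
  proof -
    have "emeasure (obs_kernel (fst \<omega>)) B = (\<Prod>j\<in>J. emeasure (\<Phi> (X_at j \<omega>)) (A j))"
      unfolding B using J by (subst emeasure_PiM_cylinder) (auto simp: X_at_def)
    also have "\<dots> = ennreal (\<Prod>j\<in>J. measure (\<Phi> (X_at j \<omega>)) (A j))"
      by (simp add: finite_measure.emeasure_eq_measure prob_space.finite_measure prod_ennreal)
    finally show ?thesis by (simp add: measure_def prod_nonneg)
  qed
  show "AE \<omega> in \<P>. cprob \<P> (FX UNIV) (Y_path -` B) \<omega> = measure (obs_kernel (fst \<omega>)) B"
    unfolding 1 2 using law J by (auto simp: stationary_hmm_law_def)
next
  show "UNIV \<in> {{x :: int \<Rightarrow> 'f. \<forall>i\<in>J. x i \<in> A i} | J A. finite J \<and> (\<forall>i\<in>J. A i \<in> sets borel)}"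
    by (auto intro!: exI[of _ "{}"])
qed (use assms in \<open>auto simp: space_PiM sets_PiM_sigma_cylinders Int_stable_PiM_cylinders\<close>)

definition future :: "int \<Rightarrow> (int \<Rightarrow> 'e) \<times> (int \<Rightarrow> 'f) \<Rightarrow> nat \<Rightarrow> 'e" where
  "future n \<omega> k = X_at (n + int k) \<omega>"

lemma measurable_future [measurable]: "future n \<in> Omega \<rightarrow>\<^sub>M PiM UNIV (\<lambda>_. borel)"
  by (rule measurable_PiM_single') (auto simp: future_def)

abbreviation chain :: "'e \<Rightarrow> (nat \<Rightarrow> 'e) measure" where
  "chain z \<equiv> markov_chain z (\<lambda>_. P)"

lemma chain_simps [simp]: "prob_space (chain z)" "sets (chain z) = sets (PiM UNIV (\<lambda>_. borel))" "space (chain z) = UNIV"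
  by (simp_all add: prob_space_markov_chain sets_markov_chain space_markov_chain P)

lemma measurable_chain [measurable]: "chain \<in> borel \<rightarrow>\<^sub>M prob_algebra (PiM UNIV (\<lambda>_. borel))"
  by (rule measurable_markov_chain) (rule P)

lemma measurable_nn_integral_obs_kernel:
  assumes "k \<in> M \<rightarrow>\<^sub>M PiM UNIV (\<lambda>_. borel)" "(\<lambda>(p, y). f p y) \<in> borel_measurable (M \<Otimes>\<^sub>M PiM UNIV (\<lambda>_. borel))"
  shows "(\<lambda>p. \<integral>\<^sup>+y. f p y \<partial>obs_kernel (k p)) \<in> borel_measurable M"
  by (rule measurable_nn_integral_kernel[OF measurable_compose[OF assms(1) measurable_obs_kernel] assms(2)])

lemma measurable_nn_integral_chain:
  assumes "k \<in> M \<rightarrow>\<^sub>M borel" "(\<lambda>(p, y). f p y) \<in> borel_measurable (M \<Otimes>\<^sub>M PiM UNIV (\<lambda>_. borel))"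
  shows "(\<lambda>p. \<integral>\<^sup>+y. f p y \<partial>chain (k p)) \<in> borel_measurable M"
  by (rule measurable_nn_integral_kernel[OF measurable_compose[OF assms(1) measurable_chain] assms(2)])

text \<open>The constraint at time \<open>t\<close> is absorbed into the past event, which is then
  an event of the past of \<open>t + 1\<close>. For this the induction has to range over all past
  events \<open>C\<close>.\<close>

lemma emeasure_future_cylinder:
  assumes C: "C \<in> sets (FX {..t})" and A [measurable]: "\<And>i. A i \<in> sets borel"
  shows "emeasure \<P> (C \<inter> {\<omega>. \<forall>k\<le>n. future t \<omega> k \<in> A k}) =
    (\<integral>\<^sup>+\<omega>. indicator C \<omega> * cyl_integral n (\<lambda>_. P) A (\<lambda>_. 1) (X_at t \<omega>) \<partial>\<P>)"
  using assms
proof (induction n arbitrary: t C A)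
  case (0 t C A)
  have [measurable]: "C \<in> sets Omega" using 0 sets_FX_subset by blast
  have X: "X_at t -` A 0 \<in> sets Omega"
    using measurable_sets[OF measurable_X_at, of "A 0" t] 0 by (simp add: space_Omega)
  have "C \<inter> {\<omega>. \<forall>k\<le>0. future t \<omega> k \<in> A k} = C \<inter> X_at t -` A 0"
    by (auto simp: future_def)
  then have "emeasure \<P> (C \<inter> {\<omega>. \<forall>k\<le>0. future t \<omega> k \<in> A k}) = (\<integral>\<^sup>+\<omega>. indicator (C \<inter> X_at t -` A 0) \<omega> \<partial>\<P>)"
    using X by (subst nn_integral_indicator) auto
  also have "\<dots> = (\<integral>\<^sup>+\<omega>. indicator C \<omega> * cyl_integral 0 (\<lambda>_. P) A (\<lambda>_. 1) (X_at t \<omega>) \<partial>\<P>)"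
    by (intro nn_integral_cong) (auto split: split_indicator)
  finally show ?case .
next
  case (Suc n t C A)
  let ?C = "C \<inter> X_at t -` A 0"
  let ?h = "cyl_integral n (\<lambda>_. P) (\<lambda>i. A (Suc i)) (\<lambda>_. 1)"
  have C0: "?C \<in> sets (FX {..t})"
    using Suc.prems measurable_sets[OF measurable_X_at_FX, of t "{..t}" "A 0"] by auto
  then have C': "?C \<in> sets (FX {..t + 1})"
    using sets_FX_mono[of "{..t}" "{..t + 1}"] by auto
  have h [measurable]: "?h \<in> borel_measurable borel"
    using Suc.prems by (intro measurable_cyl_integral P) auto
  have eq: "C \<inter> {\<omega>. \<forall>k\<le>Suc n. future t \<omega> k \<in> A k} = ?C \<inter> {\<omega>. \<forall>k\<le>n. future (t + 1) \<omega> k \<in> A (Suc k)}"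
  proof -
    have "(\<forall>k\<le>Suc n. Q k) \<longleftrightarrow> Q 0 \<and> (\<forall>k\<le>n. Q (Suc k))" for Q
      by (metis Suc_le_mono bot_nat_0.extremum not0_implies_Suc)
    then show ?thesis by (auto simp: future_def ac_simps)
  qed
  have "emeasure \<P> (C \<inter> {\<omega>. \<forall>k\<le>Suc n. future t \<omega> k \<in> A k}) =
    (\<integral>\<^sup>+\<omega>. indicator ?C \<omega> * ?h (X_at (t + 1) \<omega>) \<partial>\<P>)"
    unfolding eq by (rule Suc.IH[OF C']) (rule Suc.prems)
  also have "\<dots> = (\<integral>\<^sup>+\<omega>. \<integral>\<^sup>+v. indicator ?C \<omega> * ?h v \<partial>P (X_at t \<omega>) \<partial>\<P>)"
  proof -
    have "(\<lambda>w. indicator ?C (fst w) * ?h (snd w)) \<in> borel_measurable (FX {..t} \<Otimes>\<^sub>M borel)"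
      using C0 by measurable
    from nn_integral_X_step[OF this] show ?thesis by simp
  qed
  also have "\<dots> = (\<integral>\<^sup>+\<omega>. indicator C \<omega> * cyl_integral (Suc n) (\<lambda>_. P) A (\<lambda>_. 1) (X_at t \<omega>) \<partial>\<P>)"
  proof (intro nn_integral_cong)
    fix \<omega>
    have "(\<integral>\<^sup>+v. indicator ?C \<omega> * ?h v \<partial>P (X_at t \<omega>)) = indicator ?C \<omega> * (\<integral>\<^sup>+v. ?h v \<partial>P (X_at t \<omega>))"
      using h prob_kernelD(2)[OF P, of "X_at t \<omega>"] by (intro nn_integral_cmult) (simp cong: measurable_cong_sets)
    then show "(\<integral>\<^sup>+v. indicator ?C \<omega> * ?h v \<partial>P (X_at t \<omega>)) =
      indicator C \<omega> * cyl_integral (Suc n) (\<lambda>_. P) A (\<lambda>_. 1) (X_at t \<omega>)"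
      by (auto split: split_indicator)
  qed
  finally show ?case .
qed

lemma nn_integral_future:
  assumes "G \<in> borel_measurable (FX {..t} \<Otimes>\<^sub>M PiM UNIV (\<lambda>_. borel))"
  shows "(\<integral>\<^sup>+\<omega>. G (\<omega>, future t \<omega>) \<partial>\<P>) = (\<integral>\<^sup>+\<omega>. \<integral>\<^sup>+w. G (\<omega>, w) \<partial>chain (X_at t \<omega>) \<partial>\<P>)"
proof (rule nn_integral_joint_kernel[where F="FX {..t}" and N="PiM UNIV (\<lambda>_. borel)"
    and \<G>="{{x. \<forall>i\<le>n. x i \<in> A i} | n A. \<forall>i. A i \<in> sets borel}"])
  show "sets (FX {..t}) \<subseteq> sets \<P>" using sets_FX_subset by simp
  show "future t \<in> \<P> \<rightarrow>\<^sub>M PiM UNIV (\<lambda>_. borel)" by measurable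
  show "(\<lambda>\<omega>. chain (X_at t \<omega>)) \<in> \<P> \<rightarrow>\<^sub>M prob_algebra (PiM UNIV (\<lambda>_. borel))" by measurable
  fix C :: "((int \<Rightarrow> 'e) \<times> (int \<Rightarrow> 'f)) set" and B :: "(nat \<Rightarrow> 'e) set" assume C: "C \<in> sets (FX {..t})"
    and "B \<in> {{x. \<forall>i\<le>n. x i \<in> A i} | n A. \<forall>i. A i \<in> sets borel}"
  then obtain n A where B: "B = {x. \<forall>i\<le>n. x i \<in> A i}" and A: "\<And>i. A i \<in> sets borel" by auto
  have *: "future t -` B = {\<omega>. \<forall>k\<le>n. future t \<omega> k \<in> A k}" unfolding B by auto
  show "emeasure \<P> (C \<inter> future t -` B) = (\<integral>\<^sup>+\<omega>. indicator C \<omega> * emeasure (chain (X_at t \<omega>)) B \<partial>\<P>)"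
    unfolding * emeasure_future_cylinder[OF C A]
    unfolding B by (simp add: emeasure_markov_chain_cylinder P A)
next
  show "UNIV \<in> {{x :: nat \<Rightarrow> 'e. \<forall>i\<le>n. x i \<in> A i} | n A. \<forall>i. A i \<in> sets borel}"
    by (auto intro!: exI[of _ "\<lambda>_. UNIV"])
qed (use assms in \<open>auto simp: space_PiM sets_seq_sigma_cylinders Int_stable_seq_cylinders\<close>)

lemma nn_integral_X_at:
  assumes [measurable]: "f \<in> borel_measurable borel"
  shows "(\<integral>\<^sup>+\<omega>. f (X_at n \<omega>) \<partial>\<P>) = (\<integral>\<^sup>+x. f x \<partial>\<pi>)"
  by (subst distr_X_at[of n, symmetric]) (simp add: nn_integral_distr)

lemma nn_integral_future_stationary:
  assumes f [measurable]: "f \<in> borel_measurable (PiM UNIV (\<lambda>_. borel))"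
  shows "(\<integral>\<^sup>+\<omega>. f (future t \<omega>) \<partial>\<P>) = (\<integral>\<^sup>+z. \<integral>\<^sup>+w. f w \<partial>chain z \<partial>\<pi>)"
proof -
  have "(\<lambda>p. f (snd p)) \<in> borel_measurable (FX {..t} \<Otimes>\<^sub>M PiM UNIV (\<lambda>_. borel))" by measurable
  from nn_integral_future[OF this]
  have "(\<integral>\<^sup>+\<omega>. f (future t \<omega>) \<partial>\<P>) = (\<integral>\<^sup>+\<omega>. \<integral>\<^sup>+w. f w \<partial>chain (X_at t \<omega>) \<partial>\<P>)" by simp
  also have "\<dots> = (\<integral>\<^sup>+z. \<integral>\<^sup>+w. f w \<partial>chain z \<partial>\<pi>)"
    by (intro nn_integral_X_at measurable_nn_integral_kernel[OF measurable_chain]) measurable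
  finally show ?thesis .
qed

lemma sets_obs_law [simp]: "sets (obs_law \<P>) = sets path_space"
  by (simp add: obs_law_def)

lemma obs_law_in: "obs_law \<P> \<in> space (prob_algebra path_space)"
  unfolding obs_law_def space_prob_algebra Y_path_eq by (auto intro!: PP.prob_space_distr)

lemma nn_integral_obs_law: "f \<in> borel_measurable path_space \<Longrightarrow> (\<integral>\<^sup>+y. f y \<partial>obs_law \<P>) = (\<integral>\<^sup>+\<omega>. f (Y_path \<omega>) \<partial>\<P>)"
  unfolding obs_law_def Y_path_eq by (simp add: nn_integral_distr)

text \<open>The right-hand side does not contain \<open>s\<close>, which is the stationarity of the
  observations. The signal is read from the earliest relevant time on, where its law is a chain
  started from \<pi> at whatever time that is.\<close>

lemma emeasure_Y_shift_cylinder: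
  assumes J: "finite J" and A [measurable]: "\<And>i. A i \<in> sets borel"
  shows "emeasure \<P> {\<omega>. \<forall>j\<in>J. Y_at (j + s) \<omega> \<in> A j} =
    (\<integral>\<^sup>+z. \<integral>\<^sup>+w. (\<Prod>j\<in>J. emeasure (\<Phi> (w (nat (j - Min (insert 0 J))))) (A j)) \<partial>chain z \<partial>\<pi>)"
proof -
  \<comment> \<open>Including 0 makes the minimum defined for empty \<open>J\<close>; all that
    matters is that \<open>m\<close> bounds \<open>J\<close> from below.\<close>
  define m where "m = Min (insert 0 J)"
  have m: "m \<le> j" if "j \<in> J" for j unfolding m_def using J that by simp
  have [measurable]: "(\<lambda>x. emeasure (\<Phi> x) (A j)) \<in> borel_measurable borel" for j
    by (rule measurable_compose[OF measurable_prob_algebraD[OF \<Phi>] measurable_emeasure_subprob_algebra[OF A]])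
  define B where "B = {y :: int \<Rightarrow> 'f. \<forall>i\<in>(\<lambda>j. j + s) ` J. y i \<in> A (i - s)}"
  have B [measurable]: "B \<in> sets path_space" unfolding B_def by (intro sets_PiM_cylinder) (use J A in auto)
  have "{\<omega>. \<forall>j\<in>J. Y_at (j + s) \<omega> \<in> A j} = Y_path -` B \<inter> space \<P>"
    unfolding B_def by (auto simp: Y_path_def)
  then have "emeasure \<P> {\<omega>. \<forall>j\<in>J. Y_at (j + s) \<omega> \<in> A j} = (\<integral>\<^sup>+\<omega>. indicator B (Y_path \<omega>) \<partial>\<P>)"
    using nn_integral_obs_law[of "indicator B"] unfolding obs_law_def Y_path_eq by (simp add: emeasure_distr)
  also have "\<dots> = (\<integral>\<^sup>+\<omega>. \<integral>\<^sup>+y. indicator B y \<partial>obs_kernel (fst \<omega>) \<partial>\<P>)"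
  proof -
    have "(\<lambda>p. indicator B (snd p) :: ennreal) \<in> borel_measurable (FX UNIV \<Otimes>\<^sub>M path_space)" by measurable
    from nn_integral_observations[OF this] show ?thesis by simp
  qed
  also have "\<dots> = (\<integral>\<^sup>+\<omega>. (\<Prod>j\<in>J. emeasure (\<Phi> (future (m + s) \<omega> (nat (j - m)))) (A j)) \<partial>\<P>)"
  proof (intro nn_integral_cong)
    fix \<omega> :: "(int \<Rightarrow> 'e) \<times> (int \<Rightarrow> 'f)"
    have "(\<integral>\<^sup>+y. indicator B y \<partial>obs_kernel (fst \<omega>)) = emeasure (obs_kernel (fst \<omega>)) B" by simp
    also have "\<dots> = (\<Prod>i\<in>(\<lambda>j. j + s) ` J. emeasure (\<Phi> (fst \<omega> i)) (A (i - s)))"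
      unfolding B_def using J by (subst emeasure_PiM_cylinder) auto
    also have "\<dots> = (\<Prod>j\<in>J. emeasure (\<Phi> (fst \<omega> (j + s))) (A j))"
      by (subst prod.reindex) (auto simp: inj_on_def)
    also have "\<dots> = (\<Prod>j\<in>J. emeasure (\<Phi> (future (m + s) \<omega> (nat (j - m)))) (A j))"
      using m by (intro prod.cong) (auto simp: future_def X_at_def ac_simps)
    finally show "(\<integral>\<^sup>+y. indicator B y \<partial>obs_kernel (fst \<omega>)) =
      (\<Prod>j\<in>J. emeasure (\<Phi> (future (m + s) \<omega> (nat (j - m)))) (A j))" .
  qed
  also have "\<dots> = (\<integral>\<^sup>+z. \<integral>\<^sup>+w. (\<Prod>j\<in>J. emeasure (\<Phi> (w (nat (j - m)))) (A j)) \<partial>chain z \<partial>\<pi>)"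
    by (rule nn_integral_future_stationary) measurable
  finally show ?thesis unfolding m_def .
qed

lemma obs_law_stationary: "distr (obs_law \<P>) path_space (shift_path 1) = obs_law \<P>"
proof (rule measure_eqI_PiM_cylinders)
  interpret O: prob_space "obs_law \<P>" using obs_law_in by (simp add: space_prob_algebra)
  have [measurable_cong]: "sets (obs_law \<P>) = sets path_space" by simp
  show "finite_measure (distr (obs_law \<P>) path_space (shift_path 1))"
    by (intro O.finite_measure_distr) measurable
  fix J :: "int set" and A :: "int \<Rightarrow> 'f set" assume J: "finite J" and A: "\<And>i. A i \<in> sets borel"
  let ?B = "{y. \<forall>i\<in>J. y i \<in> A i}"
  have B [measurable]: "?B \<in> sets path_space" using J A by measurable
  have s: "emeasure \<P> {\<omega>. \<forall>j\<in>J. Y_at (j + 1) \<omega> \<in> A j} = emeasure \<P> {\<omega>. \<forall>j\<in>J. Y_at (j + 0) \<omega> \<in> A j}"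
    unfolding emeasure_Y_shift_cylinder[OF J A] ..
  have "emeasure (distr (obs_law \<P>) path_space (shift_path 1)) ?B = emeasure \<P> {\<omega>. \<forall>j\<in>J. Y_at (j + 1) \<omega> \<in> A j}"
  proof -
    have "distr (obs_law \<P>) path_space (shift_path 1) = distr \<P> path_space (\<lambda>\<omega>. shift_path 1 (Y_path \<omega>))"
      unfolding obs_law_def Y_path_eq by (subst distr_distr) (auto simp: comp_def)
    then show ?thesis
      unfolding Y_path_eq by (simp add: emeasure_distr) (auto intro!: arg_cong[where f="emeasure \<P>"] simp: shift_path_def Y_at_def)
  qed
  also have "\<dots> = emeasure (obs_law \<P>) ?B"
    unfolding s obs_law_def Y_path_eq by (simp add: emeasure_distr) (auto intro!: arg_cong[where f="emeasure \<P>"] simp: Y_at_def)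
  finally show "emeasure (distr (obs_law \<P>) path_space (shift_path 1)) ?B = emeasure (obs_law \<P>) ?B" .
qed simp_all

end

section \<open>Quenched kernels as conditional laws\<close>

locale conditional_hmm = stationary_hmm P \<pi> \<Phi> \<P>
  for P :: "'e::polish_space \<Rightarrow> 'e measure" and \<pi> and \<Phi> :: "'e \<Rightarrow> 'f::polish_space measure" and \<P> +
  fixes PX :: "'e \<Rightarrow> (int \<Rightarrow> 'f) \<Rightarrow> 'e measure" and \<mu> :: "(int \<Rightarrow> 'f) \<Rightarrow> 'e measure"
  assumes cs: "conditional_signal \<P> PX \<mu>"
begin

sublocale stationary_environment PX \<mu> "obs_law \<P>"
  by unfold_locales (use cs obs_law_in obs_law_stationary in \<open>auto simp: conditional_signal_def\<close>)

lemma nn_integral_PX_step: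
  assumes "G \<in> borel_measurable (sigma_join (FX {..n}) (FY UNIV) \<Otimes>\<^sub>M borel)"
  shows "(\<integral>\<^sup>+\<omega>. G (\<omega>, X_at (n + 1) \<omega>) \<partial>\<P>) =
    (\<integral>\<^sup>+\<omega>. \<integral>\<^sup>+v. G (\<omega>, v) \<partial>PX (X_at n \<omega>) (shift_path n (Y_path \<omega>)) \<partial>\<P>)"
proof (rule nn_integral_cond_kernel[where \<G>="sets borel" and F="sigma_join (FX {..n}) (FY UNIV)"])
  show "sets (sigma_join (FX {..n}) (FY UNIV)) \<subseteq> sets \<P>" using sets_FXY_subset by simp
  show "AE \<omega> in \<P>. cprob \<P> (sigma_join (FX {..n}) (FY UNIV)) (X_at (n + 1) -` A) \<omega> =
    measure (PX (X_at n \<omega>) (shift_path n (Y_path \<omega>))) A" if "A \<in> sets borel" for A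
  proof -
    have "AE \<omega> in \<P>. measure (PX (X_at n \<omega>) (Y_path (Theta n \<omega>))) A
        = cprob \<P> (sigma_join (FX {..n}) (FY UNIV)) (X_at (n + 1) -` A) \<omega>"
      using cs that unfolding conditional_signal_def by blast
    then show ?thesis by eventually_elim (simp add: Y_path_Theta)
  qed
  show "sets borel = sigma_sets UNIV (sets (borel :: 'e measure))"
    using sets.sigma_sets_eq[of "borel :: 'e measure"] by simp
  show "(\<lambda>\<omega>. PX (X_at n \<omega>) (shift_path n (Y_path \<omega>))) \<in> \<P> \<rightarrow>\<^sub>M prob_algebra borel"
    unfolding Y_path_eq by measurable
qed (use assms in \<open>auto simp: Int_stable_def intro!: sets_PP_measurable\<close>)

lemma nn_integral_mu:
  assumes "G \<in> borel_measurable (path_space \<Otimes>\<^sub>M borel)"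
  shows "(\<integral>\<^sup>+\<omega>. G (Y_path \<omega>, X_at 0 \<omega>) \<partial>\<P>) = (\<integral>\<^sup>+\<omega>. \<integral>\<^sup>+v. G (Y_path \<omega>, v) \<partial>\<mu> (Y_path \<omega>) \<partial>\<P>)"
proof -
  have *: "(\<lambda>p. G (Y_path (fst p), snd p)) \<in> borel_measurable (FY UNIV \<Otimes>\<^sub>M borel)"
    by (rule measurable_compose[OF _ assms]) (intro measurable_Pair measurable_compose[OF measurable_fst measurable_Y_path_FY] measurable_snd)
  have "(\<integral>\<^sup>+\<omega>. (\<lambda>p. G (Y_path (fst p), snd p)) (\<omega>, X_at 0 \<omega>) \<partial>\<P>) =
    (\<integral>\<^sup>+\<omega>. \<integral>\<^sup>+v. (\<lambda>p. G (Y_path (fst p), snd p)) (\<omega>, v) \<partial>\<mu> (Y_path \<omega>) \<partial>\<P>)"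
  proof (rule nn_integral_cond_kernel[where \<G>="sets borel" and F="FY UNIV"])
    show "sets (FY UNIV) \<subseteq> sets \<P>" using sets_FY_subset by simp
    show "AE \<omega> in \<P>. cprob \<P> (FY UNIV) (X_at 0 -` A) \<omega> = measure (\<mu> (Y_path \<omega>)) A" if "A \<in> sets borel" for A
    proof -
      have "AE \<omega> in \<P>. measure (\<mu> (Y_path (Theta 0 \<omega>))) A = cprob \<P> (FY UNIV) (X_at 0 -` A) \<omega>"
        using cs that unfolding conditional_signal_def by blast
      then show ?thesis by eventually_elim (simp add: Y_path_Theta shift_path_0)
    qed
    show "sets borel = sigma_sets UNIV (sets (borel :: 'e measure))"
      using sets.sigma_sets_eq[of "borel :: 'e measure"] by simp
    show "(\<lambda>\<omega>. \<mu> (Y_path \<omega>)) \<in> \<P> \<rightarrow>\<^sub>M prob_algebra borel"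
      unfolding Y_path_eq by measurable
  qed (use * in \<open>auto simp: Int_stable_def intro!: sets_PP_measurable\<close>)
  then show ?thesis by simp
qed

text \<open>This ties the iterated kernels to \<P>: \<open>Qm n\<close> is the conditional law of
  the signal \<open>n\<close> steps after time \<open>t\<close>, given the signal up to
  \<open>t\<close> and all observations. The induction conditions at \<open>t + 1\<close> first,
  where an integrand of the past of \<open>t\<close> remains admissible.\<close>

lemma nn_integral_Qm:
  assumes "G \<in> borel_measurable (sigma_join (FX {..t}) (FY UNIV) \<Otimes>\<^sub>M borel)"
  shows "(\<integral>\<^sup>+\<omega>. G (\<omega>, X_at (t + int n) \<omega>) \<partial>\<P>) =
    (\<integral>\<^sup>+\<omega>. \<integral>\<^sup>+v. G (\<omega>, v) \<partial>Qm n (X_at t \<omega>) (shift_path t (Y_path \<omega>)) \<partial>\<P>)"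
  using assms
proof (induction n arbitrary: t)
  case 0
  have "(\<lambda>v. G (\<omega>, v)) \<in> borel_measurable borel" for \<omega>
    using measurable_compose[OF measurable_Pair1' 0, of \<omega>] by simp
  then show ?case by (simp add: quenched_marginal_def nn_integral_return)
next
  case (Suc n)
  let ?J = "\<lambda>t. sigma_join (FX {..t}) (FY UNIV)"
  have G': "G \<in> borel_measurable (?J (t + 1) \<Otimes>\<^sub>M borel)"
    by (rule measurable_pair_mono[OF Suc.prems], simp, rule sets_FXY_mono) auto
  define H where "H p = (\<integral>\<^sup>+v. G (fst p, v) \<partial>Qm n (snd p) (shift_path (t + 1) (Y_path (fst p))))" for p
  have Y: "(\<lambda>p. shift_path (t + 1) (Y_path (fst p))) \<in> ?J t \<Otimes>\<^sub>M borel \<rightarrow>\<^sub>M path_space"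
    by (rule measurable_compose[OF measurable_compose[OF measurable_fst measurable_Y_path_FXY] measurable_shift_path])
  have H: "H \<in> borel_measurable (?J t \<Otimes>\<^sub>M borel)"
    unfolding H_def
  proof (rule measurable_nn_integral_kernel)
    show "(\<lambda>p. Qm n (snd p) (shift_path (t + 1) (Y_path (fst p)))) \<in> ?J t \<Otimes>\<^sub>M borel \<rightarrow>\<^sub>M prob_algebra borel"
      by (rule measurable_Qm[OF measurable_snd Y])
    have "(\<lambda>(p, v). (fst p, v)) \<in> (?J t \<Otimes>\<^sub>M borel) \<Otimes>\<^sub>M borel \<rightarrow>\<^sub>M ?J t \<Otimes>\<^sub>M borel" by measurable
    from measurable_compose[OF this Suc.prems]
    show "(\<lambda>(p, v). G (fst p, v)) \<in> borel_measurable ((?J t \<Otimes>\<^sub>M borel) \<Otimes>\<^sub>M borel)"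
      by (simp add: case_prod_beta')
  qed
  have "(\<integral>\<^sup>+\<omega>. G (\<omega>, X_at (t + int (Suc n)) \<omega>) \<partial>\<P>) = (\<integral>\<^sup>+\<omega>. H (\<omega>, X_at (t + 1) \<omega>) \<partial>\<P>)"
    using Suc.IH[OF G'] by (simp add: H_def ac_simps)
  also have "\<dots> = (\<integral>\<^sup>+\<omega>. \<integral>\<^sup>+v. H (\<omega>, v) \<partial>PX (X_at t \<omega>) (shift_path t (Y_path \<omega>)) \<partial>\<P>)"
    by (rule nn_integral_PX_step[OF H])
  also have "\<dots> = (\<integral>\<^sup>+\<omega>. \<integral>\<^sup>+v. G (\<omega>, v) \<partial>Qm (Suc n) (X_at t \<omega>) (shift_path t (Y_path \<omega>)) \<partial>\<P>)"
  proof (intro nn_integral_cong)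
    fix \<omega>
    have "(\<lambda>v. G (\<omega>, v)) \<in> borel_measurable borel"
      using measurable_compose[OF measurable_Pair1' Suc.prems, of \<omega>] by simp
    from nn_integral_Qm_Suc[OF this, of n "X_at t \<omega>" "shift_path t (Y_path \<omega>)"]
    show "(\<integral>\<^sup>+v. H (\<omega>, v) \<partial>PX (X_at t \<omega>) (shift_path t (Y_path \<omega>))) =
      (\<integral>\<^sup>+v. G (\<omega>, v) \<partial>Qm (Suc n) (X_at t \<omega>) (shift_path t (Y_path \<omega>)))"
      by (simp add: H_def shift_path_add ac_simps)
  qed
  finally show ?case .
qed

end

section \<open>Resampling observations\<close>

text \<open>\<open>f\<close> says, for each index of the new path, which of the two old paths is
  read and where. This covers concatenation of sequences as well as gluing a half-line to a
  two-sided path. It is applied to families of measures too, which keeps products and paths in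
  step.\<close>

definition path_splice :: "('k \<Rightarrow> 'i + 'j) \<Rightarrow> ('i \<Rightarrow> 'a) \<Rightarrow> ('j \<Rightarrow> 'a) \<Rightarrow> 'k \<Rightarrow> 'a" where
  "path_splice f x y k = case_sum x y (f k)"

lemma measurable_path_splice [measurable (raw)]:
  assumes [measurable]: "g \<in> M \<rightarrow>\<^sub>M PiM UNIV (\<lambda>_. N)" "h \<in> M \<rightarrow>\<^sub>M PiM UNIV (\<lambda>_. N)"
  shows "(\<lambda>x. path_splice f (g x) (h x)) \<in> M \<rightarrow>\<^sub>M PiM UNIV (\<lambda>_. N)"
proof (rule measurable_PiM_single')
  show "(\<lambda>x. path_splice f (g x) (h x) k) \<in> M \<rightarrow>\<^sub>M N" for k
    by (cases "f k") (simp_all add: path_splice_def)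
  show "(\<lambda>x i. path_splice f (g x) (h x) i) \<in> space M \<rightarrow> (\<Pi>\<^sub>E i\<in>UNIV. space N)"
    using measurable_space[OF assms(1)] measurable_space[OF assms(2)]
    by (auto simp: path_splice_def space_PiM PiE_iff split: sum.split)
qed

text \<open>Injectivity ensures that no coordinate is read twice, so the spliced coordinates stay
  independent. Coordinates that are never read integrate to 1.\<close>

lemma distr_PiM_path_splice:
  fixes M1 :: "'i \<Rightarrow> 'a::topological_space measure" and M2 :: "'j \<Rightarrow> 'a measure" and f :: "'k \<Rightarrow> 'i + 'j"
  assumes M1: "\<And>i. prob_space (M1 i)" "\<And>i. sets (M1 i) = sets borel"
    and M2: "\<And>i. prob_space (M2 i)" "\<And>i. sets (M2 i) = sets borel" and f: "inj f"
  shows "distr (PiM UNIV M1 \<Otimes>\<^sub>M PiM UNIV M2) (PiM UNIV (\<lambda>_. borel)) (\<lambda>(x, y). path_splice f x y) = PiM UNIV (path_splice f M1 M2)"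
proof (rule measure_eqI_PiM_cylinders)
  have s: "prob_space (path_splice f M1 M2 k)" "sets (path_splice f M1 M2 k) = sets borel" for k
    using M1 M2 by (auto simp: path_splice_def split: sum.split)
  interpret p1: prob_space "PiM UNIV M1" by (intro prob_space_PiM M1)
  interpret p2: prob_space "PiM UNIV M2" by (intro prob_space_PiM M2)
  interpret p: pair_prob_space "PiM UNIV M1" "PiM UNIV M2" ..
  note [measurable_cong] = sets_PiM_borel[of M1, OF M1(2)] sets_PiM_borel[of M2, OF M2(2)]
  have sp: "space (PiM UNIV M1) = UNIV" "space (PiM UNIV M2) = UNIV"
    using M1(2)[THEN sets_eq_imp_space_eq] M2(2)[THEN sets_eq_imp_space_eq] by (auto simp: space_PiM)
  have m: "(\<lambda>(x, y). path_splice f x y) \<in> PiM UNIV M1 \<Otimes>\<^sub>M PiM UNIV M2 \<rightarrow>\<^sub>M PiM UNIV (\<lambda>_. borel)"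
    by measurable
  show "sets (PiM UNIV (path_splice f M1 M2)) = sets (PiM UNIV (\<lambda>_. borel))"
    by (rule sets_PiM_borel) (rule s)
  show "finite_measure (distr (PiM UNIV M1 \<Otimes>\<^sub>M PiM UNIV M2) (PiM UNIV (\<lambda>_. borel)) (\<lambda>(x, y). path_splice f x y))"
    by (rule p.finite_measure_distr[OF m])
  fix J :: "'k set" and A :: "'k \<Rightarrow> 'a set" assume J: "finite J" and A [measurable]: "\<And>i. A i \<in> sets borel"
  define J1 where "J1 = {k \<in> J. \<exists>i. f k = Inl i}"
  define J2 where "J2 = {k \<in> J. \<exists>i. f k = Inr i}"
  have "(\<exists>i. f k = Inl i) \<or> (\<exists>i. f k = Inr i)" for k
    by (cases "f k") auto
  then have J12: "J = J1 \<union> J2" "J1 \<inter> J2 = {}" "finite J1" "finite J2"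
    unfolding J1_def J2_def using J by auto
  define g where "g = inv f"
  have gf: "g (f k) = k" for k unfolding g_def using f by simp
  define p1 where "p1 k = projl (f k)" for k
  define p2 where "p2 k = projr (f k)" for k
  have f1: "f k = Inl (p1 k)" if "k \<in> J1" for k using that by (auto simp: J1_def p1_def)
  have f2: "f k = Inr (p2 k)" if "k \<in> J2" for k using that by (auto simp: J2_def p2_def)
  have i1: "inj_on p1 J1" using f1 f by (auto simp: inj_on_def inj_def)
  have i2: "inj_on p2 J2" using f2 f by (auto simp: inj_on_def inj_def)
  let ?B1 = "{x. \<forall>i\<in>p1 ` J1. x i \<in> A (g (Inl i))}" and ?B2 = "{x. \<forall>i\<in>p2 ` J2. x i \<in> A (g (Inr i))}"
  have g1: "g (Inl (p1 k)) = k" if "k \<in> J1" for k using f1[OF that] gf by metis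
  have g2: "g (Inr (p2 k)) = k" if "k \<in> J2" for k using f2[OF that] gf by metis
  have pre: "(\<lambda>(x, y). path_splice f x y) -` {x. \<forall>i\<in>J. x i \<in> A i} \<inter> space (PiM UNIV M1 \<Otimes>\<^sub>M PiM UNIV M2) = ?B1 \<times> ?B2"
  proof -
    have s1: "path_splice f a b i = a (p1 i)" if "i \<in> J1" for i and a :: "'i \<Rightarrow> 'a" and b
      using f1[OF that] by (simp add: path_splice_def)
    have s2: "path_splice f a b i = b (p2 i)" if "i \<in> J2" for i and a :: "'i \<Rightarrow> 'a" and b
      using f2[OF that] by (simp add: path_splice_def)
    show ?thesis
      by (auto simp: J12(1) ball_Un s1 s2 g1 g2 space_pair_measure sp)
  qed
  have B: "?B1 \<in> sets (PiM UNIV M1)" "?B2 \<in> sets (PiM UNIV M2)"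
    using sets_PiM_cylinder[of "p1 ` J1" "\<lambda>i. A (g (Inl i))"] sets_PiM_cylinder[of "p2 ` J2" "\<lambda>i. A (g (Inr i))"] J12
    by (auto simp: sets_PiM_borel[of M1, OF M1(2)] sets_PiM_borel[of M2, OF M2(2)])
  have "emeasure (distr (PiM UNIV M1 \<Otimes>\<^sub>M PiM UNIV M2) (PiM UNIV (\<lambda>_. borel)) (\<lambda>(x, y). path_splice f x y)) {x. \<forall>i\<in>J. x i \<in> A i}
    = emeasure (PiM UNIV M1 \<Otimes>\<^sub>M PiM UNIV M2) (?B1 \<times> ?B2)"
    unfolding pre[symmetric] using J A by (intro emeasure_distr m sets_PiM_cylinder) auto
  also have "\<dots> = emeasure (PiM UNIV M1) ?B1 * emeasure (PiM UNIV M2) ?B2"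
    using B by (rule p2.emeasure_pair_measure_Times)
  also have "emeasure (PiM UNIV M1) ?B1 = (\<Prod>k\<in>J1. emeasure (path_splice f M1 M2 k) (A k))"
    using M1 J12(3) i1 f1 g1 by (subst emeasure_PiM_cylinder) (auto simp: prod.reindex path_splice_def intro!: prod.cong)
  also have "emeasure (PiM UNIV M2) ?B2 = (\<Prod>k\<in>J2. emeasure (path_splice f M1 M2 k) (A k))"
    using M2 J12(4) i2 f2 g2 by (subst emeasure_PiM_cylinder) (auto simp: prod.reindex path_splice_def intro!: prod.cong)
  also have "(\<Prod>k\<in>J1. emeasure (path_splice f M1 M2 k) (A k)) * (\<Prod>k\<in>J2. emeasure (path_splice f M1 M2 k) (A k)) =
    (\<Prod>k\<in>J. emeasure (path_splice f M1 M2 k) (A k))"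
    using J12 by (simp add: prod.union_disjoint)
  also have "\<dots> = emeasure (PiM UNIV (path_splice f M1 M2)) {x. \<forall>i\<in>J. x i \<in> A i}"
    using s J A by (intro emeasure_PiM_cylinder[symmetric]) auto
  finally show "emeasure (distr (PiM UNIV M1 \<Otimes>\<^sub>M PiM UNIV M2) (PiM UNIV (\<lambda>_. borel)) (\<lambda>(x, y). path_splice f x y)) {x. \<forall>i\<in>J. x i \<in> A i}
    = emeasure (PiM UNIV (path_splice f M1 M2)) {x. \<forall>i\<in>J. x i \<in> A i}" .
qed simp

lemma nn_integral_PiM_path_splice:
  fixes M1 :: "'i \<Rightarrow> 'a::topological_space measure" and M2 :: "'j \<Rightarrow> 'a measure" and f :: "'k \<Rightarrow> 'i + 'j"
  assumes M1: "\<And>i. prob_space (M1 i)" "\<And>i. sets (M1 i) = sets borel"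
    and M2: "\<And>i. prob_space (M2 i)" "\<And>i. sets (M2 i) = sets borel" and f: "inj f"
    and G [measurable]: "G \<in> borel_measurable (PiM UNIV (\<lambda>_. borel))"
  shows "(\<integral>\<^sup>+y. G y \<partial>PiM UNIV (path_splice f M1 M2)) = (\<integral>\<^sup>+x. \<integral>\<^sup>+y. G (path_splice f x y) \<partial>PiM UNIV M2 \<partial>PiM UNIV M1)"
proof -
  interpret p2: prob_space "PiM UNIV M2" by (intro prob_space_PiM M2)
  note [measurable_cong] = sets_PiM_borel[of M1, OF M1(2)] sets_PiM_borel[of M2, OF M2(2)]
  have m: "(\<lambda>(x, y). path_splice f x y) \<in> PiM UNIV M1 \<Otimes>\<^sub>M PiM UNIV M2 \<rightarrow>\<^sub>M PiM UNIV (\<lambda>_. borel)"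
    by measurable
  have "(\<integral>\<^sup>+y. G y \<partial>PiM UNIV (path_splice f M1 M2)) = (\<integral>\<^sup>+w. G (path_splice f (fst w) (snd w)) \<partial>(PiM UNIV M1 \<Otimes>\<^sub>M PiM UNIV M2))"
    unfolding distr_PiM_path_splice[OF M1 M2 f, symmetric] by (subst nn_integral_distr[OF m]) (auto simp: case_prod_beta')
  also have "\<dots> = (\<integral>\<^sup>+x. \<integral>\<^sup>+y. G (path_splice f x y) \<partial>PiM UNIV M2 \<partial>PiM UNIV M1)"
    by (subst p2.nn_integral_fst[symmetric]) auto
  finally show ?thesis .
qed

lemma nn_integral_eq_0_cong:
  assumes "sets N = sets M" "\<And>A. A \<in> sets M \<Longrightarrow> emeasure M A = 0 \<longleftrightarrow> emeasure N A = 0" "f \<in> borel_measurable M"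
  shows "(\<integral>\<^sup>+x. f x \<partial>M) = 0 \<longleftrightarrow> (\<integral>\<^sup>+x. f x \<partial>N) = 0"
proof -
  have sp: "space N = space M" using assms(1) by (rule sets_eq_imp_space_eq)
  have fN: "f \<in> borel_measurable N" using assms(1,3) by (simp cong: measurable_cong_sets)
  have A: "{x \<in> space M. f x \<noteq> 0} \<in> sets M" using assms(3) by measurable
  show ?thesis
    using assms(2)[OF A] by (simp add: nn_integral_0_iff[OF assms(3)] nn_integral_0_iff[OF fN] sp)
qed

text \<open>With coordinate \<open>i\<close> integrated last, the inner integral is a function that
  does not involve the law of that coordinate, and whether its outer integral vanishes depends only
  on null sets.\<close>

lemma PiM_null_replace_one:
  fixes M :: "'i \<Rightarrow> 'a::topological_space measure"
  assumes M: "\<And>i. prob_space (M i)" "\<And>i. sets (M i) = sets borel"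
    and \<phi>: "prob_space \<phi>" "sets \<phi> = sets borel"
    and ac: "\<And>A. A \<in> sets borel \<Longrightarrow> emeasure (M i) A = 0 \<longleftrightarrow> emeasure \<phi> A = 0"
    and G: "G \<in> borel_measurable (PiM UNIV (\<lambda>_. borel))"
  shows "(\<integral>\<^sup>+y. G y \<partial>PiM UNIV M) = 0 \<longleftrightarrow> (\<integral>\<^sup>+y. G y \<partial>PiM UNIV (M(i := \<phi>))) = 0"
proof -
  let ?M = "M(i := \<phi>)"
  have M': "prob_space (?M j)" "sets (?M j) = sets borel" for j using M \<phi> by auto
  let ?R = "PiM (UNIV - {i}) M"
  have R: "PiM (UNIV - {i}) ?M = ?R" by (rule PiM_cong) auto
  interpret R: prob_space ?R by (intro prob_space_PiM M)
  have sR: "sets ?R = sets (PiM (UNIV - {i}) (\<lambda>_. borel))" using M by (intro sets_PiM_cong) auto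
  have ins: "insert i (UNIV - {i}) = UNIV" by auto
  have upd: "(\<lambda>(x, X). X(i := x)) \<in> borel \<Otimes>\<^sub>M PiM (UNIV - {i}) (\<lambda>_. borel) \<rightarrow>\<^sub>M PiM UNIV (\<lambda>_. borel)"
    using measurable_fun_upd[of UNIV "UNIV - {i}" i snd "borel \<Otimes>\<^sub>M PiM (UNIV - {i}) (\<lambda>_. borel)" "\<lambda>_. borel" fst]
    by (simp add: case_prod_beta' insert_UNIV)
  have Gu: "(\<lambda>(x, X). G (X(i := x))) \<in> borel_measurable (borel \<Otimes>\<^sub>M PiM (UNIV - {i}) (\<lambda>_. borel))"
    using measurable_compose[OF upd G] by (simp add: case_prod_beta')
  have 1: "(\<integral>\<^sup>+y. G y \<partial>PiM UNIV K) = (\<integral>\<^sup>+x. \<integral>\<^sup>+X. G (X(i := x)) \<partial>?R \<partial>K i)"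
    if K: "\<And>j. prob_space (K j)" "\<And>j. sets (K j) = sets borel" "PiM (UNIV - {i}) K = ?R" for K
  proof -
    have s: "sets (K i \<Otimes>\<^sub>M ?R) = sets (borel \<Otimes>\<^sub>M PiM (UNIV - {i}) (\<lambda>_. borel))"
      by (intro sets_pair_measure_cong K sR)
    have sK: "sets (PiM UNIV K) = sets (PiM UNIV (\<lambda>_. borel))" by (rule sets_PiM_borel) (rule K)
    have "(\<integral>\<^sup>+y. G y \<partial>PiM UNIV K) = (\<integral>\<^sup>+y. G y \<partial>distr (K i \<Otimes>\<^sub>M ?R) (PiM UNIV K) (\<lambda>(x, X). X(i := x)))"
      using distr_pair_PiM_eq_PiM[of "UNIV - {i}" K i] K by (simp add: ins insert_UNIV)
    also have "\<dots> = (\<integral>\<^sup>+w. (\<lambda>(x, X). G (X(i := x))) w \<partial>(K i \<Otimes>\<^sub>M ?R))"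
      using upd G by (subst nn_integral_distr) (auto simp: measurable_cong_sets[OF s sK] measurable_cong_sets[OF sK refl] case_prod_beta')
    also have "\<dots> = (\<integral>\<^sup>+x. \<integral>\<^sup>+X. G (X(i := x)) \<partial>?R \<partial>K i)"
      using Gu by (subst R.nn_integral_fst[symmetric]) (auto simp: measurable_cong_sets[OF s refl])
    finally show ?thesis .
  qed
  have m: "(\<lambda>x. \<integral>\<^sup>+X. G (X(i := x)) \<partial>?R) \<in> borel_measurable borel"
  proof -
    have "(\<lambda>(x, X). G (X(i := x))) \<in> borel_measurable (borel \<Otimes>\<^sub>M ?R)"
      using Gu by (simp add: measurable_cong_sets[OF sets_pair_measure_cong[OF refl sR] refl])
    from R.borel_measurable_nn_integral_fst[OF this] show ?thesis by simp
  qed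
  show ?thesis
    unfolding 1[OF M refl] 1[OF M' R] fun_upd_same using M \<phi> ac m
    by (intro nn_integral_eq_0_cong) (auto simp: measurable_cong_sets[OF M(2) refl])
qed

text \<open>Finiteness of \<open>S\<close> is essential: infinite products of pairwise equivalent
  laws can be mutually singular. For this reason the observations after a late time need the
  separate argument from ergodicity.\<close>

lemma PiM_null_replace:
  fixes M :: "'i \<Rightarrow> 'a::topological_space measure"
  assumes M: "\<And>i. prob_space (M i)" "\<And>i. sets (M i) = sets borel"
    and \<phi>: "prob_space \<phi>" "sets \<phi> = sets borel"
    and ac: "\<And>i A. A \<in> sets borel \<Longrightarrow> emeasure (M i) A = 0 \<longleftrightarrow> emeasure \<phi> A = 0"
    and G: "G \<in> borel_measurable (PiM UNIV (\<lambda>_. borel))" and S: "finite S"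
  shows "(\<integral>\<^sup>+y. G y \<partial>PiM UNIV M) = 0 \<longleftrightarrow> (\<integral>\<^sup>+y. G y \<partial>PiM UNIV (\<lambda>i. if i \<in> S then \<phi> else M i)) = 0"
  using S
proof (induction S rule: finite_induct)
  case (insert i S)
  have eq: "(\<lambda>j. if j \<in> insert i S then \<phi> else M j) = (\<lambda>j. if j \<in> S then \<phi> else M j)(i := \<phi>)"
    by (auto simp: fun_eq_iff)
  show ?case
    unfolding insert.IH eq using M \<phi> ac by (intro PiM_null_replace_one G) auto
qed simp

section \<open>Resampling the observations of a chain\<close>

definition comb_index :: "nat \<Rightarrow> nat \<Rightarrow> nat + nat" where
  "comb_index m k = (if k < m then Inl k else Inr (k - m))"

lemma inj_comb_index: "inj (comb_index m)"
  by (auto simp: inj_def comb_index_def split: if_splits)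

lemma path_splice_comb_index: "path_splice (comb_index m) x y = comb_seq m x y"
  by (auto simp: fun_eq_iff path_splice_def comb_index_def comb_seq_def)

text \<open>Nondegeneracy enters as equality of null sets, the property that lets an observation be
  replaced by one with law \<phi>.\<close>

locale nondegenerate_hmm = stationary_hmm P \<pi> \<Phi> \<P>
  for P :: "'e::polish_space \<Rightarrow> 'e measure" and \<pi> and \<Phi> :: "'e \<Rightarrow> 'f::polish_space measure" and \<P> +
  fixes \<phi> :: "'f measure"
  assumes \<phi>: "\<phi> \<in> space (prob_algebra borel)"
    and equiv: "\<And>z A. A \<in> sets borel \<Longrightarrow> emeasure (\<Phi> z) A = 0 \<longleftrightarrow> emeasure \<phi> A = 0"
begin

lemma \<phi>_simps: "prob_space \<phi>" "sets \<phi> = sets borel"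
  using \<phi> by (auto simp: space_prob_algebra)

abbreviation "\<phi>_seq \<equiv> PiM UNIV (\<lambda>_::nat. \<phi>)"

lemma prob_\<phi>_seq: "prob_space \<phi>_seq" and sets_\<phi>_seq [measurable_cong]: "sets \<phi>_seq = sets (PiM UNIV (\<lambda>_. borel))"
  using \<phi>_simps by (auto intro!: prob_space_PiM sets_PiM_borel)

abbreviation Pn :: "nat \<Rightarrow> 'e \<Rightarrow> 'e measure" where
  "Pn n z \<equiv> iter_kernel n (\<lambda>_. P) z"

lemma measurable_Pn [measurable]: "Pn n \<in> borel \<rightarrow>\<^sub>M prob_algebra borel"
  by (rule measurable_iter_kernel) (rule P)

lemma Pn_simps [simp]: "prob_space (Pn n z)" "sets (Pn n z) = sets borel" "space (Pn n z) = UNIV"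
  using prob_kernelD[OF measurable_Pn, of z n] by auto

lemma nn_integral_chain_two:
  assumes f [measurable]: "(\<lambda>(x, v). f x v) \<in> borel_measurable (borel \<Otimes>\<^sub>M borel)"
  shows "(\<integral>\<^sup>+x. f (x n) (x (n + j)) \<partial>chain z) = (\<integral>\<^sup>+x. \<integral>\<^sup>+v. f x v \<partial>Pn j x \<partial>Pn n z)"
proof -
  have f' [measurable]: "(\<lambda>v. f x v) \<in> borel_measurable borel" for x
    using measurable_compose[OF measurable_Pair1' f, of x] by simp
  have g: "(\<lambda>x. \<integral>\<^sup>+v. f x v \<partial>Pn j x) \<in> borel_measurable borel"
    by (rule measurable_nn_integral_kernel[OF measurable_Pn]) measurable
  have fx: "(\<lambda>x. f (x n) (x (n + j))) \<in> borel_measurable (PiM UNIV (\<lambda>_. borel))"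
    using measurable_compose[OF _ f, of "\<lambda>x. (x n, x (n + j))"] by simp
  have "(\<integral>\<^sup>+x. f (x n) (x (n + j)) \<partial>chain z) =
    (\<integral>\<^sup>+x. \<integral>\<^sup>+w. f (comb_seq n x w n) (comb_seq n x w (n + j)) \<partial>chain (x n) \<partial>chain z)"
    by (rule nn_integral_markov_chain_Markov[OF P fx])
  also have "\<dots> = (\<integral>\<^sup>+x. \<integral>\<^sup>+w. f (x n) (w j) \<partial>chain (x n) \<partial>chain z)"
  proof (rule nn_integral_cong, rule nn_integral_cong_AE)
    fix x
    have "AE w in chain (x n). w 0 = x n" by (rule AE_markov_chain_start) (rule P)
    then show "AE w in chain (x n). f (comb_seq n x w n) (comb_seq n x w (n + j)) = f (x n) (w j)"
      by eventually_elim (simp add: comb_seq_def)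
  qed
  also have "\<dots> = (\<integral>\<^sup>+x. \<integral>\<^sup>+v. f (x n) v \<partial>Pn j (x n) \<partial>chain z)"
    by (intro nn_integral_cong nn_integral_markov_chain_marginal[OF P]) measurable
  also have "\<dots> = (\<integral>\<^sup>+x. \<integral>\<^sup>+v. f x v \<partial>Pn j x \<partial>Pn n z)"
    by (rule nn_integral_markov_chain_marginal[OF P g])
  finally show ?thesis .
qed

text \<open>The law of the observations of a chain whose state at time \<open>m\<close> is \<open>v\<close>, where the observations
  before time \<open>m\<close> are replaced by independent variables with law \<open>\<phi>\<close>.\<close>

definition resampled :: "nat \<Rightarrow> 'e \<Rightarrow> ((nat \<Rightarrow> 'f) \<Rightarrow> ennreal) \<Rightarrow> ennreal" where
  "resampled m v F = (\<integral>\<^sup>+w. \<integral>\<^sup>+u. \<integral>\<^sup>+y. F (comb_seq m u y) \<partial>obs_kernel w \<partial>\<phi>_seq \<partial>chain v)"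

text \<open>Replacing the observations before time \<open>n + j\<close> preserves null sets and cuts
  their link to the earlier signal. By the Markov property what is left depends on the past only
  through the state at time \<open>n + j\<close>, so the signal enters through two states
  alone.\<close>

lemma resample_null_iff:
  assumes h [measurable]: "(\<lambda>(x, v, y). h x v y) \<in> borel_measurable (borel \<Otimes>\<^sub>M borel \<Otimes>\<^sub>M PiM UNIV (\<lambda>_. borel))"
  shows "(\<integral>\<^sup>+x. \<integral>\<^sup>+y. h (x n) (x (n + j)) y \<partial>obs_kernel x \<partial>chain z) = 0 \<longleftrightarrow>
    (\<integral>\<^sup>+x. \<integral>\<^sup>+v. resampled (n + j) v (\<lambda>y. h x v y) \<partial>Pn j x \<partial>Pn n z) = 0"
    and "(\<lambda>(x, v). resampled m v (\<lambda>y. h x v y)) \<in> borel_measurable (borel \<Otimes>\<^sub>M borel)"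
proof -
  let ?S = "PiM UNIV (\<lambda>_. borel) :: (nat \<Rightarrow> 'f) measure" and ?E = "PiM UNIV (\<lambda>_. borel) :: (nat \<Rightarrow> 'e) measure"
  have hc: "(\<lambda>p. h (f p) (g p) (k p)) \<in> borel_measurable M"
    if "f \<in> borel_measurable M" "g \<in> borel_measurable M" "k \<in> M \<rightarrow>\<^sub>M ?S" for f g k and M :: "'z measure"
    using measurable_compose[OF _ h, of "\<lambda>p. (f p, g p, k p)" M] that by simp
  define G where "G m x v w = (\<integral>\<^sup>+u. \<integral>\<^sup>+y. h x v (comb_seq m u y) \<partial>obs_kernel w \<partial>\<phi>_seq)" for m x v w
  have \<phi>m: "(\<lambda>_. \<phi>_seq) \<in> M \<rightarrow>\<^sub>M prob_algebra ?S" for M :: "'z measure"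
    using prob_\<phi>_seq sets_\<phi>_seq by (simp add: space_prob_algebra)
  have G: "(\<lambda>p. G m (f p) (g p) (k p)) \<in> borel_measurable M"
    if [measurable]: "f \<in> borel_measurable M" "g \<in> borel_measurable M" "k \<in> M \<rightarrow>\<^sub>M ?E" for f g k m and M :: "'z measure"
    unfolding G_def
  proof (rule measurable_nn_integral_kernel[OF \<phi>m])
    show "(\<lambda>(p, u). \<integral>\<^sup>+y. h (f p) (g p) (comb_seq m u y) \<partial>obs_kernel (k p)) \<in> borel_measurable (M \<Otimes>\<^sub>M ?S)"
      unfolding case_prod_beta'
    proof (rule measurable_nn_integral_obs_kernel)
      show "(\<lambda>p. k (fst p)) \<in> M \<Otimes>\<^sub>M ?S \<rightarrow>\<^sub>M ?E" by measurable
      show "(\<lambda>(p, y). h (f (fst p)) (g (fst p)) (comb_seq m (snd p) y)) \<in> borel_measurable ((M \<Otimes>\<^sub>M ?S) \<Otimes>\<^sub>M ?S)"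
        unfolding case_prod_beta' by (rule hc) measurable
    qed
  qed
  have H: "(\<lambda>(x, v). resampled m v (\<lambda>y. h x v y)) \<in> borel_measurable (borel \<Otimes>\<^sub>M borel)" for m
    unfolding resampled_def G_def[symmetric] case_prod_beta'
  proof (rule measurable_nn_integral_chain)
    show "(\<lambda>(p, w). G m (fst p) (snd p) w) \<in> borel_measurable ((borel \<Otimes>\<^sub>M borel) \<Otimes>\<^sub>M ?E)"
      unfolding case_prod_beta' by (rule G) measurable
  qed measurable
  then show "(\<lambda>(x, v). resampled m v (\<lambda>y. h x v y)) \<in> borel_measurable (borel \<Otimes>\<^sub>M borel)" .
  let ?m = "n + j"
  let ?M = "\<lambda>x k. if k \<in> {..<?m} then \<phi> else \<Phi> (x k)"
  have h1: "(\<lambda>y. h (x n) (x ?m) y) \<in> borel_measurable ?S" for x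
    by (rule hc) measurable
  have 1: "(\<integral>\<^sup>+y. h (x n) (x ?m) y \<partial>obs_kernel x) = 0 \<longleftrightarrow> (\<integral>\<^sup>+y. h (x n) (x ?m) y \<partial>PiM UNIV (?M x)) = 0" for x
    using \<phi>_simps equiv h1 by (intro PiM_null_replace) auto
  have 2: "(\<integral>\<^sup>+y. h (x n) (x ?m) y \<partial>PiM UNIV (?M x)) = G ?m (x n) (x ?m) (\<lambda>k. x (k + ?m))" for x
  proof -
    have M: "?M x = path_splice (comb_index ?m) (\<lambda>_. \<phi>) (\<lambda>k. \<Phi> (x (k + ?m)))"
      by (auto simp: fun_eq_iff path_splice_comb_index comb_seq_def)
    have "(\<integral>\<^sup>+y. h (x n) (x ?m) y \<partial>PiM UNIV (?M x)) =
      (\<integral>\<^sup>+u. \<integral>\<^sup>+y. h (x n) (x ?m) (path_splice (comb_index ?m) u y) \<partial>obs_kernel (\<lambda>k. x (k + ?m)) \<partial>\<phi>_seq)"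
      unfolding M by (rule nn_integral_PiM_path_splice) (use \<phi>_simps h1 inj_comb_index in auto)
    then show ?thesis by (simp only: path_splice_comb_index G_def)
  qed
  have m1: "(\<lambda>x. \<integral>\<^sup>+y. h (x n) (x ?m) y \<partial>obs_kernel x) \<in> borel_measurable ?E"
  proof (rule measurable_nn_integral_obs_kernel)
    show "(\<lambda>(x, y). h (x n) (x ?m) y) \<in> borel_measurable (?E \<Otimes>\<^sub>M ?S)"
      unfolding case_prod_beta' by (rule hc) measurable
  qed measurable
  have m2: "(\<lambda>x. G ?m (x n) (x ?m) (\<lambda>k. x (k + ?m))) \<in> borel_measurable ?E"
    by (rule G) (measurable, rule measurable_PiM_single', auto simp: space_PiM)
  have "(\<integral>\<^sup>+x. \<integral>\<^sup>+y. h (x n) (x ?m) y \<partial>obs_kernel x \<partial>chain z) = 0 \<longleftrightarrow>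
    (\<integral>\<^sup>+x. G ?m (x n) (x ?m) (\<lambda>k. x (k + ?m)) \<partial>chain z) = 0"
    using m1 m2 1 unfolding 2
    by (subst (1 2) nn_integral_0_iff_AE) (auto simp: measurable_cong_sets[OF chain_simps(2) refl])
  also have "(\<integral>\<^sup>+x. G ?m (x n) (x ?m) (\<lambda>k. x (k + ?m)) \<partial>chain z) =
    (\<integral>\<^sup>+x. \<integral>\<^sup>+w. G ?m (comb_seq ?m x w n) (comb_seq ?m x w ?m) (\<lambda>k. comb_seq ?m x w (k + ?m)) \<partial>chain (x ?m) \<partial>chain z)"
    by (rule nn_integral_markov_chain_Markov[OF P m2])
  also have "\<dots> = (\<integral>\<^sup>+x. resampled ?m (x ?m) (\<lambda>y. h (x n) (x ?m) y) \<partial>chain z)"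
    unfolding resampled_def G_def[symmetric]
  proof (rule nn_integral_cong, rule nn_integral_cong_AE)
    fix x
    have "AE w in chain (x ?m). w 0 = x ?m" by (rule AE_markov_chain_start) (rule P)
    then show "AE w in chain (x ?m). G ?m (comb_seq ?m x w n) (comb_seq ?m x w ?m) (\<lambda>k. comb_seq ?m x w (k + ?m)) = G ?m (x n) (x ?m) w"
      \<comment> \<open>For \<open>j = 0\<close> the time \<open>n\<close> is the splice point
        itself, and both states are then read from the restarted path; otherwise time
        \<open>n\<close> still belongs to the old one.\<close>
      by eventually_elim (cases "j = 0"; simp add: comb_seq_def)
  qed
  also have "\<dots> = (\<integral>\<^sup>+x. \<integral>\<^sup>+v. resampled ?m v (\<lambda>y. h x v y) \<partial>Pn j x \<partial>Pn n z)"
    by (rule nn_integral_chain_two[OF H])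
  finally show "(\<integral>\<^sup>+x. \<integral>\<^sup>+y. h (x n) (x (n + j)) y \<partial>obs_kernel x \<partial>chain z) = 0 \<longleftrightarrow>
    (\<integral>\<^sup>+x. \<integral>\<^sup>+v. resampled (n + j) v (\<lambda>y. h x v y) \<partial>Pn j x \<partial>Pn n z) = 0" .
qed

text \<open>Up to the resampling of finitely many observations, the observations depend on the state at time
  \<open>n\<close> only through the state at a late time \<open>n + j\<close>, whose dependence on the state at time
  \<open>n\<close> vanishes by ergodicity.\<close>

lemma decoupled_null:
  assumes erg: "AE x in Pn n z. (\<lambda>j. tvd (Pn (n + j) z) (Pn j x)) \<longlonglongrightarrow> 0"
    and N: "N \<in> sets (borel \<Otimes>\<^sub>M PiM UNIV (\<lambda>_. borel))"
    and null: "(\<integral>\<^sup>+x. \<integral>\<^sup>+y. indicator N (x n, y) \<partial>obs_kernel x \<partial>chain z) = 0"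
  shows "(\<integral>\<^sup>+x. \<integral>\<^sup>+w. \<integral>\<^sup>+y. indicator N (x, y) \<partial>obs_kernel w \<partial>chain z \<partial>Pn n z) = 0"
proof -
  let ?S = "PiM UNIV (\<lambda>_. borel) :: (nat \<Rightarrow> 'f) measure"
  define h where "h x v y = (indicator N (x, y) :: ennreal)" for x :: 'e and v :: 'e and y :: "nat \<Rightarrow> 'f"
  have iN [measurable]: "indicator N \<in> borel_measurable (borel \<Otimes>\<^sub>M ?S)" using N by simp
  have h [measurable]: "(\<lambda>(x, v, y). h x v y) \<in> borel_measurable (borel \<Otimes>\<^sub>M borel \<Otimes>\<^sub>M ?S)"
    unfolding h_def case_prod_beta' by measurable
  have R: "(\<lambda>(x, v). resampled m v (\<lambda>y. indicator N (x, y))) \<in> borel_measurable (borel \<Otimes>\<^sub>M borel)" for m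
    using resample_null_iff(2)[OF h] by (simp add: h_def)
  have Rx: "(\<lambda>v. resampled m v (\<lambda>y. indicator N (x, y))) \<in> borel_measurable borel" for m x
    using measurable_compose[OF measurable_Pair1' R[of m], of x] by simp
  have RP: "(\<lambda>x. \<integral>\<^sup>+v. resampled m v (\<lambda>y. indicator N (x, y)) \<partial>Pn j x) \<in> borel_measurable borel" for m j
    by (rule measurable_nn_integral_kernel[OF measurable_Pn R])
  \<comment> \<open>Disintegration over the state at time \<open>n\<close>: for almost every
    \<open>x\<close>, the event with this \<open>x\<close> inserted stays null when the chain runs
    \<open>j\<close> steps from \<open>x\<close> and the earlier observations are resampled.\<close>
  have "AE x in Pn n z. (\<integral>\<^sup>+v. resampled (n + j) v (\<lambda>y. indicator N (x, y)) \<partial>Pn j x) = 0" for j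
    using resample_null_iff(1)[OF h, where n=n and j=j and z=z] null RP
    by (simp add: h_def nn_integral_0_iff_AE measurable_cong_sets[OF Pn_simps(2) refl])
  then have "AE x in Pn n z. \<forall>j. (\<integral>\<^sup>+v. resampled (n + j) v (\<lambda>y. indicator N (x, y)) \<partial>Pn j x) = 0"
    by (simp add: AE_all_countable)
  with erg have "AE x in Pn n z. (\<integral>\<^sup>+w. \<integral>\<^sup>+y. indicator N (x, y) \<partial>obs_kernel w \<partial>chain z) = 0"
  proof eventually_elim
    case (elim x)
    let ?I = "\<integral>\<^sup>+w. \<integral>\<^sup>+y. indicator N (x, y) \<partial>obs_kernel w \<partial>chain z"
    have iNx [measurable]: "(\<lambda>y. indicator N (x, y) :: ennreal) \<in> borel_measurable ?S"
      using measurable_compose[OF measurable_Pair1' iN, of x] by simp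
    have I: "?I \<le> ennreal (tvd (Pn (n + j) z) (Pn j x))" for j
    proof -
      let ?m = "n + j"
      \<comment> \<open>The late states from which the section of \<open>N\<close> at
        \<open>x\<close> has positive mass after resampling. Being null for the chain restarted at
        \<open>x\<close>, it has mass at most the distance of the two late laws when the chain
        starts from \<open>z\<close>.\<close>
      define S where "S = {v. resampled ?m v (\<lambda>y. indicator N (x, y)) \<noteq> 0}"
      have S [measurable]: "S \<in> sets borel"
        using measurable_sets[OF Rx, of "- {0}" ?m x] by (simp add: S_def vimage_def)
      have PS: "emeasure (Pn j x) S = 0"
        using elim(2)[rule_format, of j] Rx
        by (simp add: nn_integral_0_iff measurable_cong_sets[OF Pn_simps(2) refl] S_def)
      have "measure (Pn ?m z) S \<le> tvd (Pn ?m z) (Pn j x)"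
        using tvd_upper[of "Pn ?m z" "Pn j x" S] PS by (simp add: measure_def)
      then have 1: "emeasure (Pn ?m z) S \<le> ennreal (tvd (Pn ?m z) (Pn j x))"
        using tvd_nonneg[of "Pn ?m z" "Pn j x"]
        by (simp add: finite_measure.emeasure_eq_measure prob_space.finite_measure ennreal_leI)
      \<comment> \<open>Here the equivalence is used backwards, at time \<open>?m\<close> with
        \<open>j = 0\<close>. Off \<open>S\<close> the section has zero mass after resampling, hence
        it is null under the chain from \<open>z\<close> with its original observations. The first
        argument is a dummy that fits the shape required by
        \<open>resample_null_iff\<close>.\<close>
      define k where "k a v y = (indicator (- S) v * indicator N (x, y) :: ennreal)" for a v :: 'e and y
      have k: "(\<lambda>(a, v, y). k a v y) \<in> borel_measurable (borel \<Otimes>\<^sub>M borel \<Otimes>\<^sub>M ?S)"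
        unfolding k_def case_prod_beta' by measurable
      have k1: "(\<lambda>w. \<integral>\<^sup>+y. k a (w ?m) y \<partial>obs_kernel w) \<in> borel_measurable (PiM UNIV (\<lambda>_. borel))" for a
      proof (rule measurable_nn_integral_obs_kernel)
        show "(\<lambda>(w, y). k a (w ?m) y) \<in> borel_measurable (PiM UNIV (\<lambda>_. borel) \<Otimes>\<^sub>M ?S)"
          unfolding k_def case_prod_beta' by measurable
      qed measurable
      have "resampled ?m v (\<lambda>y. k a v y) = 0" for a v
        by (cases "v \<in> S") (auto simp: k_def resampled_def S_def)
      then have 2: "(\<integral>\<^sup>+w. \<integral>\<^sup>+y. k (w ?m) (w ?m) y \<partial>obs_kernel w \<partial>chain z) = 0"
        using resample_null_iff(1)[OF k, where n="?m" and j=0 and z=z] by simp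
      have "?I \<le> (\<integral>\<^sup>+w. indicator S (w ?m) + (\<integral>\<^sup>+y. k (w ?m) (w ?m) y \<partial>obs_kernel w) \<partial>chain z)"
      proof (rule nn_integral_mono)
        fix w
        have "(\<integral>\<^sup>+y. indicator N (x, y) \<partial>obs_kernel w) \<le> (\<integral>\<^sup>+y. indicator S (w ?m) + k (w ?m) (w ?m) y \<partial>obs_kernel w)"
          by (intro nn_integral_mono) (auto simp: k_def split: split_indicator)
        also have "\<dots> = indicator S (w ?m) + (\<integral>\<^sup>+y. k (w ?m) (w ?m) y \<partial>obs_kernel w)"
          using prob_space.emeasure_space_1[OF obs_kernel_simps(1), of w] unfolding k_def
          by (subst nn_integral_add) (auto simp: measurable_cong_sets[OF obs_kernel_simps(2) refl])
        finally show "(\<integral>\<^sup>+y. indicator N (x, y) \<partial>obs_kernel w) \<le>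
          indicator S (w ?m) + (\<integral>\<^sup>+y. k (w ?m) (w ?m) y \<partial>obs_kernel w)" .
      qed
      also have "\<dots> = (\<integral>\<^sup>+w. indicator S (w ?m) \<partial>chain z) + (\<integral>\<^sup>+w. \<integral>\<^sup>+y. k (w ?m) (w ?m) y \<partial>obs_kernel w \<partial>chain z)"
        using k1[unfolded k_def] unfolding k_def
        by (intro nn_integral_add) (auto simp: measurable_cong_sets[OF chain_simps(2) refl])
      also have "(\<integral>\<^sup>+w. indicator S (w ?m) \<partial>chain z) = (\<integral>\<^sup>+v. indicator S v \<partial>Pn ?m z)"
        by (rule nn_integral_markov_chain_marginal[OF P]) measurable
      finally show ?thesis using 1 2 by simp
    qed
    have "(\<lambda>j. ennreal (tvd (Pn (n + j) z) (Pn j x))) \<longlonglongrightarrow> ennreal 0"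
      using elim(1) by (rule tendsto_ennrealI)
    then have "?I \<le> ennreal 0"
      by (rule LIMSEQ_le_const) (use I in auto)
    then show ?case by simp
  qed
  then have "(\<integral>\<^sup>+x. \<integral>\<^sup>+w. \<integral>\<^sup>+y. indicator N (x, y) \<partial>obs_kernel w \<partial>chain z \<partial>Pn n z) = (\<integral>\<^sup>+x. 0 \<partial>Pn n z)"
    by (rule nn_integral_cong_AE)
  then show ?thesis by simp
qed

end

section \<open>Absolute continuity of the conditional signal\<close>

text \<open>Intersection stability is free: a countable basis has only countably many finite
  subfamilies, and their intersections are closed under further intersection.\<close>

lemma ex_countable_borel_generator:
  "\<exists>\<G>::'a::second_countable_topology set set. countable \<G> \<and> Int_stable \<G> \<and> UNIV \<in> \<G> \<and> sets borel = sigma_sets UNIV \<G>"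
proof -
  obtain B :: "'a set set" where B: "countable B" "topological_basis B"
    using ex_countable_basis by auto
  define \<G> where "\<G> = Inter ` {F. finite F \<and> F \<subseteq> B}"
  have "countable \<G>"
    unfolding \<G>_def by (intro countable_image countable_Collect_finite_subset B)
  moreover have "Int_stable \<G>"
  proof (rule Int_stableI)
    fix a b assume "a \<in> \<G>" "b \<in> \<G>"
    then obtain F F' where "a = \<Inter>F" "b = \<Inter>F'" "finite F" "finite F'" "F \<subseteq> B" "F' \<subseteq> B"
      by (auto simp: \<G>_def)
    then show "a \<inter> b \<in> \<G>" unfolding \<G>_def by (intro image_eqI[of _ _ "F \<union> F'"]) auto
  qed
  moreover have "UNIV \<in> \<G>" unfolding \<G>_def by (intro image_eqI[of _ _ "{}"]) auto
  moreover have "sets borel = sigma_sets UNIV \<G>"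
  proof (rule antisym)
    have "B \<subseteq> \<G>"
    proof
      fix b assume "b \<in> B"
      then show "b \<in> \<G>" unfolding \<G>_def by (intro image_eqI[of _ _ "{b}"]) auto
    qed
    moreover have "sets borel = sigma_sets UNIV B"
      unfolding borel_eq_countable_basis[OF B] by (rule sets_measure_of) simp
    ultimately show "sets borel \<subseteq> sigma_sets UNIV \<G>" by (simp add: sigma_sets_mono')
    have "open b" if "b \<in> B" for b using topological_basis_open[OF B(2) that] .
    then have "\<G> \<subseteq> sets borel"
      unfolding \<G>_def by (auto intro!: borel_open open_Inter)
    then have "sigma_sets (space borel) \<G> \<subseteq> sets borel" by (rule sets.sigma_sets_subset)
    then show "sigma_sets UNIV \<G> \<subseteq> sets borel" by simp
  qed
  ultimately show ?thesis by blast
qed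

text \<open>A density of the joint laws is a density of the kernels, as can be tested on countably many sets.\<close>

lemma AE_absolutely_continuous_kernel:
  fixes k1 k2 :: "'w \<Rightarrow> 'a::second_countable_topology measure"
  assumes L: "prob_space L" and k1: "k1 \<in> L \<rightarrow>\<^sub>M prob_algebra borel" and k2: "k2 \<in> L \<rightarrow>\<^sub>M prob_algebra borel"
    and null: "\<And>N. N \<in> sets (L \<Otimes>\<^sub>M borel) \<Longrightarrow> (\<integral>\<^sup>+w. \<integral>\<^sup>+x. indicator N (w, x) \<partial>k1 w \<partial>L) = 0 \<Longrightarrow>
      (\<integral>\<^sup>+w. \<integral>\<^sup>+x. indicator N (w, x) \<partial>k2 w \<partial>L) = 0"
  shows "AE w in L. absolutely_continuous (k1 w) (k2 w)"
proof -
  interpret prob_space L by (rule L)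
  have Lin: "L \<in> space (prob_algebra L)" using L by (simp add: space_prob_algebra)
  define J where "J k = L \<bind> (\<lambda>w. distr (k w) (L \<Otimes>\<^sub>M borel) (Pair w))" for k :: "'w \<Rightarrow> 'a measure"
  have kern: "(\<lambda>w. distr (k w) (L \<Otimes>\<^sub>M borel) (Pair w)) \<in> L \<rightarrow>\<^sub>M prob_algebra (L \<Otimes>\<^sub>M borel)"
    if [measurable]: "k \<in> L \<rightarrow>\<^sub>M prob_algebra borel" for k
    by measurable
  have sJ: "sets (J k) = sets (L \<Otimes>\<^sub>M borel)" "prob_space (J k)" if "k \<in> L \<rightarrow>\<^sub>M prob_algebra borel" for k
    unfolding J_def by (rule sets_bind'[OF Lin kern[OF that]], rule prob_space_bind'[OF Lin kern[OF that]])
  have J: "(\<integral>\<^sup>+p. f p \<partial>J k) = (\<integral>\<^sup>+w. \<integral>\<^sup>+x. f (w, x) \<partial>k w \<partial>L)"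
    if k: "k \<in> L \<rightarrow>\<^sub>M prob_algebra borel" and f: "f \<in> borel_measurable (L \<Otimes>\<^sub>M borel)" for k f
    unfolding J_def nn_integral_bind_prob_algebra[OF Lin kern[OF k] f]
  proof (rule nn_integral_cong)
    fix w assume w: "w \<in> space L"
    have "Pair w \<in> k w \<rightarrow>\<^sub>M L \<Otimes>\<^sub>M borel"
      using measurable_Pair1'[OF w, of borel] by (simp add: measurable_cong_sets[OF prob_kernelD(2)[OF k w] refl])
    then show "(\<integral>\<^sup>+p. f p \<partial>distr (k w) (L \<Otimes>\<^sub>M borel) (Pair w)) = (\<integral>\<^sup>+x. f (w, x) \<partial>k w)"
      using f by (simp add: nn_integral_distr)
  qed
  interpret J1: prob_space "J k1" by (rule sJ(2)[OF k1])
  \<comment> \<open>The density is taken for the joint laws, which makes it jointly measurable;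
    densities chosen separately for each \<open>w\<close> need not be.\<close>
  have "absolutely_continuous (J k1) (J k2)"
    unfolding absolutely_continuous_def
  proof
    fix N assume "N \<in> null_sets (J k1)"
    then have N: "N \<in> sets (L \<Otimes>\<^sub>M borel)" and "emeasure (J k1) N = 0" by (auto simp: sJ[OF k1])
    then have "(\<integral>\<^sup>+p. indicator N p \<partial>J k1) = 0" by (simp add: sJ[OF k1])
    then have "(\<integral>\<^sup>+p. indicator N p \<partial>J k2) = 0"
      using N null by (simp add: J k1 k2 del: nn_integral_indicator)
    with N show "N \<in> null_sets (J k2)" by (auto simp: sJ[OF k2] null_sets_def)
  qed
  then obtain f where f: "f \<in> borel_measurable (J k1)" "density (J k1) f = J k2"
    using J1.Radon_Nikodym[of "J k2"] by (auto simp: sJ k1 k2)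
  then have f' [measurable]: "f \<in> borel_measurable (L \<Otimes>\<^sub>M borel)"
    by (simp add: measurable_cong_sets[OF sJ(1)[OF k1] refl])
  obtain \<G> :: "'a set set" where \<G>: "countable \<G>" "Int_stable \<G>" "UNIV \<in> \<G>" "sets borel = sigma_sets UNIV \<G>"
    using ex_countable_borel_generator by blast
  have "AE w in L. emeasure (k2 w) B = (\<integral>\<^sup>+x. f (w, x) * indicator B x \<partial>k1 w)" if "B \<in> \<G>" for B
  proof -
    have B [measurable]: "B \<in> sets borel" using that \<G> by auto
    let ?g = "\<lambda>w. \<integral>\<^sup>+x. f (w, x) * indicator B x \<partial>k1 w"
    have g: "?g \<in> borel_measurable L" by (rule measurable_nn_integral_kernel[OF k1]) measurable
    have e: "(\<lambda>w. emeasure (k2 w) B) \<in> borel_measurable L"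
      by (rule measurable_compose[OF measurable_prob_algebraD[OF k2] measurable_emeasure_subprob_algebra[OF B]])
    \<comment> \<open>Testing against every \<open>C\<close> turns equality of joint integrals into
      equality of two densities over \<open>L\<close>, which are unique almost everywhere.\<close>
    have "density L (\<lambda>w. emeasure (k2 w) B) = density L ?g"
    proof (rule measure_eqI)
      fix C assume "C \<in> sets (density L (\<lambda>w. emeasure (k2 w) B))"
      then have C [measurable]: "C \<in> sets L" by simp
      have "emeasure (density L (\<lambda>w. emeasure (k2 w) B)) C = (\<integral>\<^sup>+w. emeasure (k2 w) B * indicator C w \<partial>L)"
        using e by (simp add: emeasure_density)
      also have "\<dots> = (\<integral>\<^sup>+w. \<integral>\<^sup>+x. indicator (C \<times> B) (w, x) \<partial>k2 w \<partial>L)"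
        by (intro nn_integral_cong) (auto simp: indicator_times prob_kernelD[OF k2] split: split_indicator)
      also have "\<dots> = (\<integral>\<^sup>+p. indicator (C \<times> B) p \<partial>J k2)"
        by (subst J[OF k2]) auto
      also have "\<dots> = (\<integral>\<^sup>+p. f p * indicator (C \<times> B) p \<partial>J k1)"
        unfolding f(2)[symmetric] using f(1) sJ(1)[OF k1] by (subst nn_integral_density) auto
      also have "\<dots> = (\<integral>\<^sup>+w. \<integral>\<^sup>+x. f (w, x) * indicator (C \<times> B) (w, x) \<partial>k1 w \<partial>L)"
        by (subst J[OF k1]) auto
      also have "\<dots> = (\<integral>\<^sup>+w. ?g w * indicator C w \<partial>L)"
        by (intro nn_integral_cong) (auto simp: indicator_times split: split_indicator)
      also have "\<dots> = emeasure (density L ?g) C"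
        using g by (simp add: emeasure_density)
      finally show "emeasure (density L (\<lambda>w. emeasure (k2 w) B)) C = emeasure (density L ?g) C" .
    qed simp
    then show ?thesis by (rule density_unique[OF e g])
  qed
  then have "AE w in L. \<forall>B\<in>\<G>. emeasure (k2 w) B = (\<integral>\<^sup>+x. f (w, x) * indicator B x \<partial>k1 w)"
    using \<G>(1) by (intro AE_ball_countable[THEN iffD2]) auto
  then show ?thesis
  proof (rule AE_mp, intro AE_I2 impI)
    fix w assume w: "w \<in> space L" and eq: "\<forall>B\<in>\<G>. emeasure (k2 w) B = (\<integral>\<^sup>+x. f (w, x) * indicator B x \<partial>k1 w)"
    have s1: "sets (k1 w) = sets borel" "sets (k2 w) = sets borel" and pk: "prob_space (k2 w)"
      using prob_kernelD[OF k1 w] prob_kernelD[OF k2 w] by auto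
    have fw: "(\<lambda>x. f (w, x)) \<in> borel_measurable (k1 w)"
      using measurable_compose[OF measurable_Pair1'[OF w] f'] by (simp add: measurable_cong_sets[OF s1(1) refl])
    interpret K2: prob_space "k2 w" by (rule pk)
    have "k2 w = density (k1 w) (\<lambda>x. f (w, x))"
    proof (rule measure_eqI_generator_eq[OF \<G>(2), where \<Omega>="UNIV" and A="\<lambda>_. UNIV"])
      show "emeasure (k2 w) B = emeasure (density (k1 w) (\<lambda>x. f (w, x))) B" if "B \<in> \<G>" for B
        using eq that fw \<G>(4) s1 by (subst emeasure_density) auto
    qed (use \<G> s1 in auto)
    then show "absolutely_continuous (k1 w) (k2 w)"
      using absolutely_continuousI_density[OF fw] by simp
  qed
qed

section \<open>Redrawing the future given the present state\<close>

definition future_index :: "int \<Rightarrow> int + nat" where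
  "future_index k = (if k \<le> 0 then Inl k else Inr (nat k))"

lemma inj_future_index: "inj future_index"
  by (auto simp: inj_def future_index_def split: if_splits)

text \<open>The boundary lies at 0: the state and the observation at time 0 belong to the past that
  is kept, and entry 0 of the new sequence is never read.\<close>

lemma path_splice_future_index: "path_splice future_index x w k = (if k \<le> 0 then x k else w (nat k))"
  by (simp add: path_splice_def future_index_def)

lemma measurable_fst_FX: "fst \<in> FX UNIV \<rightarrow>\<^sub>M path_space"
  by (rule measurable_PiM_single') (use measurable_X_at_FX in \<open>auto simp: X_at_def [abs_def]\<close>)

lemma measurable_path_splice_FX:
  "(\<lambda>(\<omega>, w). path_splice future_index (fst \<omega>) w) \<in> FX {..0} \<Otimes>\<^sub>M PiM UNIV (\<lambda>_. borel) \<rightarrow>\<^sub>M path_space"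
  unfolding case_prod_beta'
proof (rule measurable_PiM_single')
  fix k :: int
  show "(\<lambda>p. path_splice future_index (fst (fst p)) (snd p) k) \<in> FX {..0} \<Otimes>\<^sub>M PiM UNIV (\<lambda>_. borel) \<rightarrow>\<^sub>M borel"
  proof (cases "k \<le> 0")
    case True
    then have "X_at k \<in> FX {..0} \<rightarrow>\<^sub>M borel" by (intro measurable_X_at_FX) simp
    from measurable_compose[OF measurable_fst this] True show ?thesis
      by (simp add: path_splice_future_index X_at_def)
  qed (simp add: path_splice_future_index)
qed auto

context stationary_hmm
begin

text \<open>Given the state at time 0, the future of signal and observations may be redrawn while
  the past of both is kept. This is conditional independence of past and future in the form of an
  integral identity, so that past observations can be frozen later on.\<close>

lemma nn_integral_resample_future:
  assumes G: "G \<in> borel_measurable Omega"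
  shows "(\<integral>\<^sup>+\<omega>. G \<omega> \<partial>\<P>) = (\<integral>\<^sup>+\<omega>. \<integral>\<^sup>+w. \<integral>\<^sup>+u.
    G (path_splice future_index (fst \<omega>) w, path_splice future_index (snd \<omega>) u) \<partial>obs_kernel w \<partial>chain (X_at 0 \<omega>) \<partial>\<P>)"
proof -
  let ?s = "path_splice future_index" and ?E = "PiM UNIV (\<lambda>_. borel) :: (nat \<Rightarrow> 'e) measure" and ?F = "PiM UNIV (\<lambda>_. borel) :: (nat \<Rightarrow> 'f) measure"
  have Gc: "(\<lambda>p. G (f p, g p)) \<in> borel_measurable M" if "f \<in> M \<rightarrow>\<^sub>M path_space" "g \<in> M \<rightarrow>\<^sub>M path_space" for f g and M :: "'z measure"
    using measurable_compose[OF measurable_Pair[OF that] G] .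
  define H where "H x w y = (\<integral>\<^sup>+u. G (?s x w, ?s y u) \<partial>obs_kernel w)" for x w y
  have H: "(\<lambda>p. H (f p) (g p) (h p)) \<in> borel_measurable M"
    if [measurable]: "f \<in> M \<rightarrow>\<^sub>M path_space" "g \<in> M \<rightarrow>\<^sub>M ?E" "h \<in> M \<rightarrow>\<^sub>M path_space" for f g h and M :: "'z measure"
    unfolding H_def
  proof (rule measurable_nn_integral_obs_kernel)
    show "(\<lambda>(p, y). G (?s (f p) (g p), ?s (h p) y)) \<in> borel_measurable (M \<Otimes>\<^sub>M ?F)"
      unfolding case_prod_beta' by (rule Gc) measurable
  qed measurable
  define G1 where "G1 x = (\<integral>\<^sup>+y. G (x, y) \<partial>obs_kernel x)" for x
  have G1: "G1 \<in> borel_measurable path_space"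
    unfolding G1_def by (rule measurable_nn_integral_obs_kernel) (use G in auto)
  have "(\<integral>\<^sup>+\<omega>. G \<omega> \<partial>\<P>) = (\<integral>\<^sup>+\<omega>. G1 (fst \<omega>) \<partial>\<P>)"
  proof -
    have "(\<lambda>p. G (fst (fst p), snd p)) \<in> borel_measurable (FX UNIV \<Otimes>\<^sub>M path_space)"
      by (rule Gc) (auto intro: measurable_compose[OF measurable_fst measurable_fst_FX])
    from nn_integral_observations[OF this] show ?thesis by (simp add: G1_def Y_path_eq)
  qed
  \<comment> \<open>The actual future is spliced back in where it already was, which exposes it to
    the Markov property.\<close>
  also have "\<dots> = (\<integral>\<^sup>+\<omega>. G1 (?s (fst \<omega>) (future 0 \<omega>)) \<partial>\<P>)"
  proof -
    have "?s (fst \<omega>) (future 0 \<omega>) = fst \<omega>" for \<omega>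
      by (auto simp: fun_eq_iff path_splice_future_index future_def X_at_def)
    then show ?thesis by simp
  qed
  also have "\<dots> = (\<integral>\<^sup>+\<omega>. \<integral>\<^sup>+w. G1 (?s (fst \<omega>) w) \<partial>chain (X_at 0 \<omega>) \<partial>\<P>)"
  proof -
    have "(\<lambda>p. G1 (?s (fst (fst p)) (snd p))) \<in> borel_measurable (FX {..0} \<Otimes>\<^sub>M ?E)"
      using measurable_compose[OF measurable_path_splice_FX G1] by (simp add: case_prod_beta')
    from nn_integral_future[OF this] show ?thesis by simp
  qed
  also have "\<dots> = (\<integral>\<^sup>+\<omega>. \<integral>\<^sup>+w. \<integral>\<^sup>+y. H (fst \<omega>) w y \<partial>obs_kernel (fst \<omega>) \<partial>chain (X_at 0 \<omega>) \<partial>\<P>)"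
  proof (intro nn_integral_cong)
    fix \<omega> :: "(int \<Rightarrow> 'e) \<times> (int \<Rightarrow> 'f)" and w
    let ?x = "fst \<omega>"
    have eq: "(\<lambda>k. \<Phi> (?s ?x w k)) = ?s (\<lambda>k. \<Phi> (?x k)) (\<lambda>k. \<Phi> (w k))"
      by (auto simp: fun_eq_iff path_splice_future_index)
    have "(\<lambda>y. G (?s ?x w, y)) \<in> borel_measurable path_space"
      by (rule Gc) (auto simp: space_PiM)
    then show "G1 (?s ?x w) = (\<integral>\<^sup>+y. H ?x w y \<partial>obs_kernel ?x)"
      unfolding G1_def H_def eq by (intro nn_integral_PiM_path_splice inj_future_index) auto
  qed
  \<comment> \<open>The old observations must be integrated outside the new chain before they can be
    recognised as the actual observations. Their positive coordinates are discarded by the splice,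
    so drawing them along the whole old signal is harmless.\<close>
  also have "\<dots> = (\<integral>\<^sup>+\<omega>. \<integral>\<^sup>+y. \<integral>\<^sup>+w. H (fst \<omega>) w y \<partial>chain (X_at 0 \<omega>) \<partial>obs_kernel (fst \<omega>) \<partial>\<P>)"
  proof (rule nn_integral_cong)
    fix \<omega> :: "(int \<Rightarrow> 'e) \<times> (int \<Rightarrow> 'f)"
    interpret A: prob_space "chain (X_at 0 \<omega>)" by simp
    interpret B: prob_space "obs_kernel (fst \<omega>)" by simp
    interpret AB: pair_prob_space "chain (X_at 0 \<omega>)" "obs_kernel (fst \<omega>)" ..
    have "(\<lambda>(w, y). H (fst \<omega>) w y) \<in> borel_measurable (?E \<Otimes>\<^sub>M path_space)"
      unfolding case_prod_beta' by (rule H) (auto simp: space_PiM)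
    then have "(\<lambda>(w, y). H (fst \<omega>) w y) \<in> borel_measurable (chain (X_at 0 \<omega>) \<Otimes>\<^sub>M obs_kernel (fst \<omega>))"
      by (simp cong: measurable_cong_sets sets_pair_measure_cong)
    from AB.Fubini'[OF this]
    show "(\<integral>\<^sup>+w. \<integral>\<^sup>+y. H (fst \<omega>) w y \<partial>obs_kernel (fst \<omega>) \<partial>chain (X_at 0 \<omega>)) =
      (\<integral>\<^sup>+y. \<integral>\<^sup>+w. H (fst \<omega>) w y \<partial>chain (X_at 0 \<omega>) \<partial>obs_kernel (fst \<omega>))" by simp
  qed
  also have "\<dots> = (\<integral>\<^sup>+\<omega>. \<integral>\<^sup>+w. H (fst \<omega>) w (snd \<omega>) \<partial>chain (X_at 0 \<omega>) \<partial>\<P>)"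
  proof -
    have "(\<lambda>p. \<integral>\<^sup>+w. H (fst (fst p)) w (snd p) \<partial>chain (X_at 0 (fst p))) \<in> borel_measurable (FX UNIV \<Otimes>\<^sub>M path_space)"
    proof (rule measurable_nn_integral_chain)
      show "(\<lambda>p. X_at 0 (fst p)) \<in> FX UNIV \<Otimes>\<^sub>M path_space \<rightarrow>\<^sub>M borel"
        by (rule measurable_compose[OF measurable_fst measurable_X_at_FX]) simp
      show "(\<lambda>(p, w). H (fst (fst p)) w (snd p)) \<in> borel_measurable ((FX UNIV \<Otimes>\<^sub>M path_space) \<Otimes>\<^sub>M ?E)"
        unfolding case_prod_beta'
        by (rule H) (auto intro: measurable_compose[OF measurable_compose[OF measurable_fst measurable_fst] measurable_fst_FX])
    qed
    from nn_integral_observations[OF this] show ?thesis by (simp add: Y_path_eq)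
  qed
  finally show ?thesis unfolding H_def .
qed

lemma measurable_FY_I:
  fixes f :: "'a \<Rightarrow> (int \<Rightarrow> 'e) \<times> (int \<Rightarrow> 'f)"
  assumes c: "\<And>k. k \<in> I \<Longrightarrow> (\<lambda>x. Y_at k (f x)) \<in> M \<rightarrow>\<^sub>M borel"
  shows "f \<in> M \<rightarrow>\<^sub>M FY I"
  unfolding FY_def
proof (rule measurable_measure_of)
  fix B :: "((int \<Rightarrow> 'e) \<times> (int \<Rightarrow> 'f)) set" assume "B \<in> {Y_at k -` A | k A. k \<in> I \<and> A \<in> sets borel}"
  then obtain k A where B: "B = Y_at k -` A" "k \<in> I" "A \<in> sets borel" by auto
  have "f -` B \<inter> space M = (\<lambda>x. Y_at k (f x)) -` A \<inter> space M" using B by auto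
  with measurable_sets[OF c[OF B(2)] B(3)] show "f -` B \<inter> space M \<in> sets M" by simp
qed auto

lemma measurable_sigma_join_I:
  assumes "f \<in> M \<rightarrow>\<^sub>M F" "f \<in> M \<rightarrow>\<^sub>M G" "space F = UNIV" "space G = UNIV"
  shows "f \<in> M \<rightarrow>\<^sub>M sigma_join F G"
  unfolding sigma_join_def
  by (rule measurable_measure_of) (use assms measurable_sets[OF assms(1)] measurable_sets[OF assms(2)] in auto)

lemma distr_hmm_law_from: "distr (hmm_law_from P \<Phi> z) borel (X_at (int n)) = iter_kernel n (\<lambda>_. P) z"
proof (rule measure_eqI)
  let ?J = "sigma_join (FX {0..}) (FY {0..}) :: ((int \<Rightarrow> 'e) \<times> (int \<Rightarrow> 'f)) measure"
  let ?e = "\<lambda>(x :: nat \<Rightarrow> 'e) (u :: nat \<Rightarrow> 'f). (\<lambda>k::int. x (nat k), \<lambda>k::int. u (nat k))"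
  let ?k = "\<lambda>x. distr (obs_kernel x) ?J (?e x)"
  let ?E = "PiM UNIV (\<lambda>_. borel) :: (nat \<Rightarrow> 'e) measure" and ?F = "PiM UNIV (\<lambda>_. borel) :: (nat \<Rightarrow> 'f) measure"
  have e: "(\<lambda>(x, u). ?e x u) \<in> ?E \<Otimes>\<^sub>M ?F \<rightarrow>\<^sub>M ?J"
    by (intro measurable_sigma_join_I measurable_FX_I measurable_FY_I) (auto simp: X_at_def Y_at_def case_prod_beta')
  have k: "?k \<in> ?E \<rightarrow>\<^sub>M prob_algebra ?J"
    by (rule measurable_distr_prob_space2[OF measurable_obs_kernel e])
  have c: "chain z \<in> space (prob_algebra ?E)" by (simp add: space_prob_algebra)
  have P: "P \<in> borel \<rightarrow>\<^sub>M prob_algebra borel" by (rule P)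
  have I: "iter_kernel n (\<lambda>_. P) \<in> borel \<rightarrow>\<^sub>M prob_algebra borel" by (rule measurable_iter_kernel) (rule P)
  have sI: "sets (iter_kernel n (\<lambda>_. P) z) = sets borel" using prob_kernelD(2)[OF I, of z] by simp
  then show "sets (distr (hmm_law_from P \<Phi> z) borel (X_at (int n))) = sets (iter_kernel n (\<lambda>_. P) z)" by simp
  fix A assume "A \<in> sets (distr (hmm_law_from P \<Phi> z) borel (X_at (int n)))"
  then have A [measurable]: "A \<in> sets borel" by simp
  have s: "sets (hmm_law_from P \<Phi> z) = sets ?J"
    unfolding hmm_law_from_def by (rule sets_bind'[OF c k])
  have X: "X_at (int n) \<in> ?J \<rightarrow>\<^sub>M borel" by (rule measurable_X_at_FXY) simp
  then have XA: "X_at (int n) -` A \<in> sets ?J" using measurable_sets[OF X A] by simp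
  have "emeasure (distr (hmm_law_from P \<Phi> z) borel (X_at (int n))) A = emeasure (hmm_law_from P \<Phi> z) (X_at (int n) -` A)"
    using X sets_eq_imp_space_eq[OF s] by (subst emeasure_distr) (auto simp: measurable_cong_sets[OF s refl])
  also have "\<dots> = (\<integral>\<^sup>+x. emeasure (?k x) (X_at (int n) -` A) \<partial>chain z)"
    unfolding hmm_law_from_def by (rule emeasure_bind_prob_algebra[OF c k XA])
  also have "\<dots> = (\<integral>\<^sup>+x. indicator A (x n) \<partial>chain z)"
  proof (rule nn_integral_cong)
    fix x
    have "?e x \<in> obs_kernel x \<rightarrow>\<^sub>M ?J"
      using measurable_compose[OF measurable_Pair1' e, of x] by (simp add: space_PiM measurable_cong_sets[OF obs_kernel_simps(2) refl])
    then have "emeasure (?k x) (X_at (int n) -` A) = emeasure (obs_kernel x) (?e x -` (X_at (int n) -` A) \<inter> space (obs_kernel x))"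
      using XA by (rule emeasure_distr)
    also have "?e x -` (X_at (int n) -` A) \<inter> space (obs_kernel x) = (if x n \<in> A then space (obs_kernel x) else {})"
      by (auto simp: X_at_def)
    finally show "emeasure (?k x) (X_at (int n) -` A) = indicator A (x n)"
      using prob_space.emeasure_space_1[OF obs_kernel_simps(1), of x] by (auto split: split_indicator)
  qed
  also have "\<dots> = (\<integral>\<^sup>+x. indicator A x \<partial>iter_kernel n (\<lambda>_. P) z)"
    by (rule nn_integral_markov_chain_marginal[OF P]) measurable
  also have "\<dots> = emeasure (iter_kernel n (\<lambda>_. P) z) A"
    using A sI by (subst nn_integral_indicator) auto
  finally show "emeasure (distr (hmm_law_from P \<Phi> z) borel (X_at (int n))) A = emeasure (iter_kernel n (\<lambda>_. P) z) A" .
qed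

end

text \<open>Both distances on the right end in \<open>M\<close>, the form in which convergence to
  \<pi> from two starting points supplies them.\<close>

lemma tvd_triangle:
  assumes "prob_space L" "prob_space M" "prob_space N" "sets L = sets M" "sets N = sets M"
  shows "tvd L N \<le> tvd L M + tvd N M"
proof (rule tvd_leI)
  fix A assume A: "A \<in> sets L"
  have "\<bar>measure L A - measure M A\<bar> \<le> tvd L M" "\<bar>measure N A - measure M A\<bar> \<le> tvd N M"
    using A assms by (auto intro!: tvd_upper)
  then show "\<bar>measure L A - measure N A\<bar> \<le> tvd L M + tvd N M" by linarith
qed

lemma mutually_singular_imp_tvd_eq_1:
  assumes M: "prob_space M" and N: "prob_space N" and MN: "sets M = sets N" and ms: "mutually_singular M N"
  shows "1 \<le> tvd M N"
proof -
  interpret M: prob_space M by (rule M)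
  interpret N: prob_space N by (rule N)
  obtain A where A: "A \<in> sets M" "emeasure M A = 0" "emeasure N (space M - A) = 0"
    using ms by (auto simp: mutually_singular_def)
  have "measure M A = 0" "measure N (space N - A) = 0"
    using A sets_eq_imp_space_eq[OF MN] by (auto simp: measure_def)
  moreover from this have "measure N A = 1"
    using N.prob_compl[of A] A MN by simp
  ultimately show ?thesis using tvd_upper[OF M N A(1)] by simp
qed

section \<open>Overlap of the quenched laws\<close>

locale ergodic_hmm = conditional_hmm P \<pi> \<Phi> \<P> PX \<mu> + nondegenerate_hmm P \<pi> \<Phi> \<P> \<phi>
  for P :: "'e::polish_space \<Rightarrow> 'e measure" and \<pi> and \<Phi> :: "'e \<Rightarrow> 'f::polish_space measure" and \<P> PX \<mu> \<phi> +
  assumes erg: "AE z in \<pi>. (\<lambda>n. tvd (Pn n z) \<pi>) \<longlonglongrightarrow> 0"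
begin

lemma prob_\<pi>: "prob_space \<pi>" and sets_\<pi> [measurable_cong]: "sets \<pi> = sets borel"
proof -
  have "prob_space (distr \<P> borel (X_at 0))" by (rule PP.prob_space_distr) measurable
  then show "prob_space \<pi>" by (simp add: distr_X_at)
  have "sets (distr \<P> borel (X_at 0)) = sets borel" by simp
  then show "sets \<pi> = sets borel" by (simp add: distr_X_at)
qed

text \<open>The signal has law \<pi> at every time, so a \<pi>-null set is avoided at time
  \<open>n\<close> from almost every starting point.\<close>

lemma AE_\<pi>_Pn:
  assumes "AE z in \<pi>. R z"
  shows "AE z in \<pi>. \<forall>n. AE x in Pn n z. R x"
proof -
  obtain N where N: "{z \<in> space \<pi>. \<not> R z} \<subseteq> N" "emeasure \<pi> N = 0" "N \<in> sets \<pi>"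
    using assms by (rule AE_E)
  have [measurable]: "N \<in> sets borel" using N sets_\<pi> by simp
  have sp: "space \<pi> = UNIV" using sets_eq_imp_space_eq[OF sets_\<pi>] by simp
  have "AE z in \<pi>. AE x in Pn n z. R x" for n
  proof -
    have m: "(\<lambda>z. \<integral>\<^sup>+x. indicator N x \<partial>Pn n z) \<in> borel_measurable \<pi>"
      using measurable_nn_integral_kernel[OF measurable_Pn, of "\<lambda>_. indicator N" n]
      by (simp add: measurable_cong_sets[OF sets_\<pi> refl])
    have "(\<integral>\<^sup>+\<omega>. indicator N (future 0 \<omega> n) \<partial>\<P>) = (\<integral>\<^sup>+z. \<integral>\<^sup>+w. indicator N (w n) \<partial>chain z \<partial>\<pi>)"
      by (rule nn_integral_future_stationary) measurable
    also have "\<dots> = (\<integral>\<^sup>+z. \<integral>\<^sup>+x. indicator N x \<partial>Pn n z \<partial>\<pi>)"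
      by (intro nn_integral_cong nn_integral_markov_chain_marginal[OF P]) measurable
    finally have "(\<integral>\<^sup>+z. \<integral>\<^sup>+x. indicator N x \<partial>Pn n z \<partial>\<pi>) = (\<integral>\<^sup>+\<omega>. indicator N (X_at (int n) \<omega>) \<partial>\<P>)"
      by (simp add: future_def)
    also have "\<dots> = (\<integral>\<^sup>+x. indicator N x \<partial>\<pi>)" by (rule nn_integral_X_at) measurable
    also have "\<dots> = 0" using N by simp
    finally have "AE z in \<pi>. (\<integral>\<^sup>+x. indicator N x \<partial>Pn n z) = 0"
      using m by (simp add: nn_integral_0_iff_AE)
    then show ?thesis
    proof eventually_elim
      case (elim z)
      then have "AE x in Pn n z. indicator N x = (0::ennreal)"
        by (subst (asm) nn_integral_0_iff_AE) (auto simp: measurable_cong_sets[OF Pn_simps(2) refl])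
      then show ?case
        by eventually_elim (use N(1) sp in \<open>auto split: split_indicator_asm\<close>)
    qed
  qed
  then show ?thesis by (simp add: AE_all_countable)
qed

text \<open>The state reached after \<open>n\<close> steps is again a typical starting point, so
  both laws converge to \<pi>.\<close>

lemma AE_tvd_forget: "AE z in \<pi>. \<forall>n. AE x in Pn n z. (\<lambda>j. tvd (Pn (n + j) z) (Pn j x)) \<longlonglongrightarrow> 0"
  using erg AE_\<pi>_Pn[OF erg]
proof eventually_elim
  case (elim z)
  show ?case
  proof
    fix n
    from elim(2) have "AE x in Pn n z. (\<lambda>j. tvd (Pn j x) \<pi>) \<longlonglongrightarrow> 0" by blast
    then show "AE x in Pn n z. (\<lambda>j. tvd (Pn (n + j) z) (Pn j x)) \<longlonglongrightarrow> 0"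
    proof eventually_elim
      fix x assume x: "(\<lambda>j. tvd (Pn j x) \<pi>) \<longlonglongrightarrow> 0"
      have "(\<lambda>j. tvd (Pn (n + j) z) \<pi>) \<longlonglongrightarrow> 0"
        using LIMSEQ_ignore_initial_segment[OF elim(1), of n] by (simp add: add.commute)
      from tendsto_add[OF this x] have "(\<lambda>j. tvd (Pn (n + j) z) \<pi> + tvd (Pn j x) \<pi>) \<longlonglongrightarrow> 0" by simp
      then show "(\<lambda>j. tvd (Pn (n + j) z) (Pn j x)) \<longlonglongrightarrow> 0"
      proof (rule tendsto_sandwich[OF _ _ tendsto_const, rotated 2])
        show "\<forall>\<^sub>F j in sequentially. 0 \<le> tvd (Pn (n + j) z) (Pn j x)"
          by (simp add: tvd_nonneg)
        show "\<forall>\<^sub>F j in sequentially. tvd (Pn (n + j) z) (Pn j x) \<le> tvd (Pn (n + j) z) \<pi> + tvd (Pn j x) \<pi>"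
          using prob_\<pi> sets_\<pi> by (intro always_eventually allI tvd_triangle) auto
      qed
    qed
  qed
qed

lemma AE_X_0: "AE z in \<pi>. R z \<Longrightarrow> AE \<omega> in \<P>. R (X_at 0 \<omega>)"
  by (subst (asm) distr_X_at[of 0, symmetric]) (erule AE_distrD[rotated], measurable)

text \<open>The domination in terms of joint laws: the state at time \<open>n\<close> may be made
  independent of the observations given the start without charging a null set. Past observations are
  frozen by redrawing the future, after which the statement about one-sided chains applies. For
  \<open>n > 0\<close> the state lies in the redrawn part.\<close>

lemma joint_null_imp_decoupled_null:
  assumes N: "N \<in> sets ((borel \<Otimes>\<^sub>M path_space) \<Otimes>\<^sub>M borel)" and n: "0 < n"
    and null: "(\<integral>\<^sup>+\<omega>. indicator N ((X_at 0 \<omega>, Y_path \<omega>), X_at (int n) \<omega>) \<partial>\<P>) = 0"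
  shows "(\<integral>\<^sup>+\<omega>. \<integral>\<^sup>+x. indicator N ((X_at 0 \<omega>, Y_path \<omega>), x) \<partial>Pn n (X_at 0 \<omega>) \<partial>\<P>) = 0"
proof -
  let ?s = "path_splice future_index" and ?F = "PiM UNIV (\<lambda>_. borel) :: (nat \<Rightarrow> 'f) measure"
  let ?E = "PiM UNIV (\<lambda>_. borel) :: (nat \<Rightarrow> 'e) measure"
  have Nc: "(\<lambda>p. indicator N ((f p, g p), h p) :: ennreal) \<in> borel_measurable M"
    if "f \<in> borel_measurable M" "g \<in> M \<rightarrow>\<^sub>M path_space" "h \<in> borel_measurable M" for f g h and M :: "'z measure"
    using measurable_compose[OF measurable_Pair[OF measurable_Pair[OF that(1,2)] that(3)] borel_measurable_indicator[OF N]] .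
  have X0: "X_at 0 (?s x w, y) = x 0" for x :: "int \<Rightarrow> 'e" and w and y :: "int \<Rightarrow> 'f"
    by (simp add: X_at_def path_splice_future_index)
  have Xn: "X_at (int n) (?s x w, y) = w n" for x :: "int \<Rightarrow> 'e" and w and y :: "int \<Rightarrow> 'f"
    using n by (simp add: X_at_def path_splice_future_index)
  have 1: "(\<lambda>\<omega>. indicator N ((X_at 0 \<omega>, Y_path \<omega>), X_at (int n) \<omega>) :: ennreal) \<in> borel_measurable Omega"
    unfolding Y_path_eq by (rule Nc) measurable
  have 2: "(\<lambda>\<omega>. \<integral>\<^sup>+x. indicator N ((X_at 0 \<omega>, Y_path \<omega>), x) \<partial>Pn n (X_at 0 \<omega>)) \<in> borel_measurable Omega"
    unfolding Y_path_eq
  proof (rule measurable_nn_integral_kernel)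
    show "(\<lambda>\<omega>. Pn n (X_at 0 \<omega>)) \<in> Omega \<rightarrow>\<^sub>M prob_algebra borel" by measurable
    show "(\<lambda>(\<omega>, x). indicator N ((X_at 0 \<omega>, snd \<omega>), x) :: ennreal) \<in> borel_measurable (Omega \<Otimes>\<^sub>M borel)"
      unfolding case_prod_beta' by (rule Nc) measurable
  qed
  \<comment> \<open>A single redrawn chain \<open>w\<close> supplies both the state at time
    \<open>n\<close> and the new observations; decoupling separates these two roles.\<close>
  define I where "I \<omega> = (\<integral>\<^sup>+w. \<integral>\<^sup>+u. indicator N ((X_at 0 \<omega>, ?s (snd \<omega>) u), w n) \<partial>obs_kernel w \<partial>chain (X_at 0 \<omega>))" for \<omega>
  have I: "I \<in> borel_measurable \<P>"
    unfolding I_def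
  proof (intro sets_PP_measurable measurable_nn_integral_chain)
    show "(\<lambda>(\<omega>, w). \<integral>\<^sup>+u. indicator N ((X_at 0 \<omega>, ?s (snd \<omega>) u), w n) \<partial>obs_kernel w) \<in> borel_measurable (Omega \<Otimes>\<^sub>M ?E)"
      unfolding case_prod_beta'
    proof (rule measurable_nn_integral_obs_kernel)
      show "(\<lambda>(p, u). indicator N ((X_at 0 (fst p), ?s (snd (fst p)) u), snd p n) :: ennreal) \<in> borel_measurable ((Omega \<Otimes>\<^sub>M ?E) \<Otimes>\<^sub>M ?F)"
        unfolding case_prod_beta' by (rule Nc) measurable
    qed measurable
  qed measurable
  have "(\<integral>\<^sup>+\<omega>. I \<omega> \<partial>\<P>) = 0"
    using null unfolding nn_integral_resample_future[OF 1] I_def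
    by (simp add: X0 Xn Y_path_eq) (simp add: X_at_def)
  then have "AE \<omega> in \<P>. I \<omega> = 0"
    using I by (simp add: nn_integral_0_iff_AE)
  moreover have "AE \<omega> in \<P>. AE x in Pn n (X_at 0 \<omega>). (\<lambda>j. tvd (Pn (n + j) (X_at 0 \<omega>)) (Pn j x)) \<longlonglongrightarrow> 0"
    using AE_X_0[OF AE_tvd_forget] by eventually_elim blast
  ultimately have "AE \<omega> in \<P>. (\<integral>\<^sup>+w. \<integral>\<^sup>+u. \<integral>\<^sup>+x. indicator N ((X_at 0 \<omega>, ?s (snd \<omega>) u), x)
    \<partial>Pn n (X_at 0 \<omega>) \<partial>obs_kernel w \<partial>chain (X_at 0 \<omega>)) = 0"
  proof eventually_elim
    case (elim \<omega>)
    let ?z = "X_at 0 \<omega>"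
    \<comment> \<open>The section at a fixed start and fixed past observations; only the state at
      time \<open>n\<close> and the redrawn observations remain as arguments.\<close>
    let ?N = "{(x, u). ((?z, ?s (snd \<omega>) u), x) \<in> N}"
    have m: "(\<lambda>(x, u). ((?z, ?s (snd \<omega>) u), x)) \<in> borel \<Otimes>\<^sub>M ?F \<rightarrow>\<^sub>M (borel \<Otimes>\<^sub>M path_space) \<Otimes>\<^sub>M borel"
      unfolding case_prod_beta' by (intro measurable_Pair measurable_path_splice) (auto simp: space_PiM)
    have sN: "?N \<in> sets (borel \<Otimes>\<^sub>M ?F)"
      using measurable_sets[OF m N] by (simp add: space_pair_measure space_PiM vimage_def case_prod_beta')
    have i: "indicator ?N (x, u) = (indicator N ((?z, ?s (snd \<omega>) u), x) :: ennreal)" for x u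
      by (auto split: split_indicator)
    have "(\<integral>\<^sup>+x. \<integral>\<^sup>+y. indicator ?N (x n, y) \<partial>obs_kernel x \<partial>chain ?z) = 0"
      using elim(1) by (simp add: i I_def)
    from decoupled_null[OF elim(2) sN this]
    have 0: "(\<integral>\<^sup>+x. \<integral>\<^sup>+w. \<integral>\<^sup>+u. indicator N ((?z, ?s (snd \<omega>) u), x) \<partial>obs_kernel w \<partial>chain ?z \<partial>Pn n ?z) = 0"
      by (simp add: i)
    \<comment> \<open>Decoupling leaves the state as the outermost variable, while the redrawing
      identity needs it innermost. Collecting chain and observations into one law \<open>U\<close>
      reduces this to a single exchange of integrals.\<close>
    define U where "U = chain ?z \<bind> obs_kernel"
    have c: "chain ?z \<in> space (prob_algebra ?E)" by (simp add: space_prob_algebra)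
    have sU: "sets U = sets ?F" and pU: "prob_space U"
      unfolding U_def by (rule sets_bind'[OF c measurable_obs_kernel], rule prob_space_bind'[OF c measurable_obs_kernel])
    have U: "(\<integral>\<^sup>+w. \<integral>\<^sup>+u. f u \<partial>obs_kernel w \<partial>chain ?z) = (\<integral>\<^sup>+u. f u \<partial>U)" if "f \<in> borel_measurable ?F" for f
      unfolding U_def by (rule nn_integral_bind_prob_algebra[OF c measurable_obs_kernel that, symmetric])
    interpret U: prob_space U by (rule pU)
    interpret Q: prob_space "Pn n ?z" by simp
    interpret QU: pair_prob_space "Pn n ?z" U ..
    have mm: "(\<lambda>(x, u). indicator N ((?z, ?s (snd \<omega>) u), x) :: ennreal) \<in> borel_measurable (borel \<Otimes>\<^sub>M ?F)"
      unfolding case_prod_beta' by (rule Nc) (auto intro!: measurable_path_splice simp: space_PiM)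
    then have mm': "(\<lambda>(x, u). indicator N ((?z, ?s (snd \<omega>) u), x) :: ennreal) \<in> borel_measurable (Pn n ?z \<Otimes>\<^sub>M U)"
      using measurable_cong_sets[OF sets_pair_measure_cong[OF Pn_simps(2) sU] refl] by blast
    have mu: "(\<lambda>u. indicator N ((?z, ?s (snd \<omega>) u), x) :: ennreal) \<in> borel_measurable ?F" for x
      by (rule Nc) (auto intro!: measurable_path_splice simp: space_PiM)
    have "(\<lambda>(u, x). indicator N ((?z, ?s (snd \<omega>) u), x) :: ennreal) \<in> borel_measurable (?F \<Otimes>\<^sub>M Pn n ?z)"
      unfolding case_prod_beta'
      by (rule Nc) (auto intro!: measurable_path_splice simp: space_PiM measurable_cong_sets[OF sets_pair_measure_cong[OF refl Pn_simps(2)] refl])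
    from Q.borel_measurable_nn_integral[OF this]
    have mx: "(\<lambda>u. \<integral>\<^sup>+x. indicator N ((?z, ?s (snd \<omega>) u), x) \<partial>Pn n ?z) \<in> borel_measurable ?F" by simp
    show ?case
      using 0 QU.Fubini'[OF mm'] by (simp add: U[OF mu] U[OF mx])
  qed
  then have "(\<integral>\<^sup>+\<omega>. \<integral>\<^sup>+w. \<integral>\<^sup>+u. \<integral>\<^sup>+x. indicator N ((X_at 0 \<omega>, ?s (snd \<omega>) u), x)
    \<partial>Pn n (X_at 0 \<omega>) \<partial>obs_kernel w \<partial>chain (X_at 0 \<omega>) \<partial>\<P>) = (\<integral>\<^sup>+\<omega>. 0 \<partial>\<P>)"
    by (rule nn_integral_cong_AE)
  then show ?thesis
    unfolding nn_integral_resample_future[OF 2]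
    by (simp add: X0 Y_path_eq) (simp add: X_at_def)
qed

abbreviation "initial_law \<equiv> distr \<P> (borel \<Otimes>\<^sub>M path_space) (\<lambda>\<omega>. (X_at 0 \<omega>, Y_path \<omega>))"

lemma measurable_initial: "(\<lambda>\<omega>. (X_at 0 \<omega>, Y_path \<omega>)) \<in> \<P> \<rightarrow>\<^sub>M borel \<Otimes>\<^sub>M path_space"
  unfolding Y_path_eq by measurable

text \<open>Both joint laws have the same marginal for the start and the observations; the
  implication between their null sets disintegrates over that marginal.\<close>

lemma AE_Pn_absolutely_continuous:
  assumes n: "0 < n"
  shows "AE w in initial_law. absolutely_continuous (Qm n (fst w) (snd w)) (Pn n (fst w))"
proof (rule AE_absolutely_continuous_kernel)
  show "prob_space initial_law" by (rule PP.prob_space_distr[OF measurable_initial])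
  have s: "sets initial_law = sets (borel \<Otimes>\<^sub>M path_space)" by simp
  show "(\<lambda>w. Qm n (fst w) (snd w)) \<in> initial_law \<rightarrow>\<^sub>M prob_algebra borel" by measurable
  show "(\<lambda>w. Pn n (fst w)) \<in> initial_law \<rightarrow>\<^sub>M prob_algebra borel" by measurable
  fix N assume "N \<in> sets (initial_law \<Otimes>\<^sub>M borel)"
    and null: "(\<integral>\<^sup>+w. \<integral>\<^sup>+x. indicator N (w, x) \<partial>Qm n (fst w) (snd w) \<partial>initial_law) = 0"
  then have N: "N \<in> sets ((borel \<Otimes>\<^sub>M path_space) \<Otimes>\<^sub>M borel)" by (simp cong: sets_pair_measure_cong)
  have kQ: "(\<lambda>w. Qm n (fst w) (snd w)) \<in> borel \<Otimes>\<^sub>M path_space \<rightarrow>\<^sub>M prob_algebra borel" by measurable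
  have kP: "(\<lambda>w. Pn n (fst w)) \<in> borel \<Otimes>\<^sub>M path_space \<rightarrow>\<^sub>M prob_algebra borel" by measurable
  have iN: "(\<lambda>(w, x). indicator N (w, x) :: ennreal) \<in> borel_measurable ((borel \<Otimes>\<^sub>M path_space) \<Otimes>\<^sub>M borel)"
    using N by (simp add: case_prod_beta')
  have kern: "(\<integral>\<^sup>+w. \<integral>\<^sup>+x. indicator N (w, x) \<partial>k w \<partial>initial_law) = (\<integral>\<^sup>+\<omega>. \<integral>\<^sup>+x. indicator N ((X_at 0 \<omega>, Y_path \<omega>), x) \<partial>k (X_at 0 \<omega>, Y_path \<omega>) \<partial>\<P>)"
    if "k \<in> borel \<Otimes>\<^sub>M path_space \<rightarrow>\<^sub>M prob_algebra borel" for k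
    by (rule nn_integral_distr[OF measurable_initial]) (use measurable_nn_integral_kernel[OF that iN] in simp)
  have "(\<integral>\<^sup>+\<omega>. indicator N ((X_at 0 \<omega>, Y_path \<omega>), X_at (int n) \<omega>) \<partial>\<P>) =
    (\<integral>\<^sup>+\<omega>. \<integral>\<^sup>+x. indicator N ((X_at 0 \<omega>, Y_path \<omega>), x) \<partial>Qm n (X_at 0 \<omega>) (Y_path \<omega>) \<partial>\<P>)"
  proof -
    have "(\<lambda>p. ((X_at 0 (fst p), Y_path (fst p)), snd p)) \<in> sigma_join (FX {..0}) (FY UNIV) \<Otimes>\<^sub>M borel \<rightarrow>\<^sub>M (borel \<Otimes>\<^sub>M path_space) \<Otimes>\<^sub>M borel"
      by (intro measurable_Pair measurable_snd measurable_compose[OF measurable_fst measurable_X_at_FXY]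
        measurable_compose[OF measurable_fst measurable_Y_path_FXY]) simp
    from nn_integral_Qm[OF measurable_compose[OF this borel_measurable_indicator[OF N]], of n]
    show ?thesis by (simp add: shift_path_0)
  qed
  also have "\<dots> = 0"
    using null unfolding kern[OF kQ] fst_conv snd_conv .
  finally have "(\<integral>\<^sup>+\<omega>. \<integral>\<^sup>+x. indicator N ((X_at 0 \<omega>, Y_path \<omega>), x) \<partial>Pn n (X_at 0 \<omega>) \<partial>\<P>) = 0"
    by (rule joint_null_imp_decoupled_null[OF N n])
  then show "(\<integral>\<^sup>+w. \<integral>\<^sup>+x. indicator N (w, x) \<partial>Pn n (fst w) \<partial>initial_law) = 0"
    unfolding kern[OF kP] fst_conv .
qed

text \<open>\<mu> is the conditional law of the state at time 0 given the observations. A measurable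
  null set that covers the exceptions stands in for \<open>R\<close>, whose measurability is not
  assumed.\<close>

lemma AE_initial_law_disintegrate:
  assumes "AE w in initial_law. R w"
  shows "AE y in obs_law \<P>. AE z in \<mu> y. R (z, y)"
proof -
  obtain N where N: "{w \<in> space initial_law. \<not> R w} \<subseteq> N" "emeasure initial_law N = 0" "N \<in> sets initial_law"
    using assms by (rule AE_E)
  have N' [measurable]: "N \<in> sets (borel \<Otimes>\<^sub>M path_space)" using N by simp
  have iN: "(\<lambda>(y, z). indicator N (z, y) :: ennreal) \<in> borel_measurable (path_space \<Otimes>\<^sub>M borel)" by measurable
  have m: "(\<lambda>y. \<integral>\<^sup>+z. indicator N (z, y) \<partial>\<mu> y) \<in> borel_measurable path_space"
    by (rule measurable_nn_integral_kernel[OF mu iN])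
  have "0 = (\<integral>\<^sup>+w. indicator N w \<partial>initial_law)" using N by simp
  also have "\<dots> = (\<integral>\<^sup>+\<omega>. indicator N (X_at 0 \<omega>, Y_path \<omega>) \<partial>\<P>)"
    by (rule nn_integral_distr[OF measurable_initial]) measurable
  also have "\<dots> = (\<integral>\<^sup>+\<omega>. \<integral>\<^sup>+z. indicator N (z, Y_path \<omega>) \<partial>\<mu> (Y_path \<omega>) \<partial>\<P>)"
    using nn_integral_mu[OF iN] by simp
  also have "\<dots> = (\<integral>\<^sup>+y. \<integral>\<^sup>+z. indicator N (z, y) \<partial>\<mu> y \<partial>obs_law \<P>)"
    by (rule nn_integral_obs_law[OF m, symmetric])
  finally have "AE y in obs_law \<P>. (\<integral>\<^sup>+z. indicator N (z, y) \<partial>\<mu> y) = 0"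
    using m by (subst (asm) eq_commute) (simp add: nn_integral_0_iff_AE measurable_cong_sets[OF sets_obs_law refl])
  then show ?thesis
  proof eventually_elim
    case (elim y)
    have "(\<lambda>z. indicator N (z, y) :: ennreal) \<in> borel_measurable borel"
      by (rule measurable_compose[OF measurable_Pair2' borel_measurable_indicator[OF N']]) (simp add: space_PiM)
    then have "AE z in \<mu> y. indicator N (z, y) = (0::ennreal)"
      using elim by (subst (asm) nn_integral_0_iff_AE) (auto simp: measurable_cong_sets[OF sets_mu refl])
    then show ?case
      by eventually_elim (use N(1) in \<open>auto simp: space_pair_measure space_PiM split: split_indicator_asm\<close>)
  qed
qed

text \<open>A set that separates the quenched laws would also separate the unconditional laws they
  dominate. For large \<open>n\<close> these are both close to \<pi>, so their distance is below 1
  and they cannot be singular.\<close>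

lemma AE_not_mutually_singular:
  "AE y in obs_law \<P>. AE z' in \<mu> y. AE z in \<mu> y. \<exists>n. \<not> mutually_singular (Qm n z y) (Qm n z' y)"
proof -
  let ?R = "\<lambda>w. (\<forall>n>0. absolutely_continuous (Qm n (fst w) (snd w)) (Pn n (fst w))) \<and> (\<lambda>n. tvd (Pn n (fst w)) \<pi>) \<longlonglongrightarrow> 0"
  have "AE w in initial_law. \<forall>n. 0 < n \<longrightarrow> absolutely_continuous (Qm n (fst w) (snd w)) (Pn n (fst w))"
    using AE_Pn_absolutely_continuous by (subst AE_all_countable) (auto intro: AE_I2)
  moreover have "AE w in initial_law. (\<lambda>n. tvd (Pn n (fst w)) \<pi>) \<longlonglongrightarrow> 0"
  proof -
    have d: "distr initial_law borel fst = \<pi>"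
      using distr_X_at[of 0] by (subst distr_distr[OF _ measurable_initial]) (auto simp: comp_def)
    have "AE z in distr initial_law borel fst. (\<lambda>n. tvd (Pn n z) \<pi>) \<longlonglongrightarrow> 0" unfolding d by (rule erg)
    then show ?thesis by (rule AE_distrD[rotated]) measurable
  qed
  ultimately have "AE w in initial_law. ?R w" by eventually_elim simp
  from AE_initial_law_disintegrate[OF this] show ?thesis
  proof eventually_elim
    case (elim y)
    have R: "AE z in \<mu> y. ?R (z, y)" by (rule elim)
    from R show ?case
    proof eventually_elim
      fix z' assume z': "?R (z', y)"
      from R show "AE z in \<mu> y. \<exists>n. \<not> mutually_singular (Qm n z y) (Qm n z' y)"
      proof eventually_elim
        fix z assume z: "?R (z, y)"
        have "(\<lambda>n. tvd (Pn n z) \<pi> + tvd (Pn n z') \<pi>) \<longlonglongrightarrow> 0 + 0"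
          using z z' by (intro tendsto_add) auto
        then have "\<forall>\<^sub>F n in sequentially. tvd (Pn n z) \<pi> + tvd (Pn n z') \<pi> < 1"
          by (rule order_tendstoD) simp
        \<comment> \<open>Domination is available at positive times only, so \<open>n\<close> is
          taken both large and positive.\<close>
        then have "\<forall>\<^sub>F n in sequentially. tvd (Pn n z) \<pi> + tvd (Pn n z') \<pi> < 1 \<and> 0 < n"
          using eventually_gt_at_top[of 0] by eventually_elim simp
        then obtain n where n: "tvd (Pn n z) \<pi> + tvd (Pn n z') \<pi> < 1" "0 < n"
          by (auto dest: eventually_happens)
        have "tvd (Pn n z) (Pn n z') \<le> tvd (Pn n z) \<pi> + tvd (Pn n z') \<pi>"
          using prob_\<pi> sets_\<pi> by (intro tvd_triangle) auto
        then have "\<not> mutually_singular (Pn n z) (Pn n z')"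
          using n mutually_singular_imp_tvd_eq_1[of "Pn n z" "Pn n z'"] by auto
        moreover have "mutually_singular (Pn n z) (Pn n z')" if ms: "mutually_singular (Qm n z y) (Qm n z' y)"
        proof -
          obtain A where A: "A \<in> sets borel" "emeasure (Qm n z y) A = 0" "emeasure (Qm n z' y) (UNIV - A) = 0"
            using ms unfolding mutually_singular_def sets_Qm space_Qm by blast
          have "null_sets (Qm n z y) \<subseteq> null_sets (Pn n z)" "null_sets (Qm n z' y) \<subseteq> null_sets (Pn n z')"
            using z z' n(2) unfolding absolutely_continuous_def fst_conv snd_conv by blast+
          moreover have "A \<in> null_sets (Qm n z y)" "UNIV - A \<in> null_sets (Qm n z' y)"
            using A by (auto intro!: null_setsI)
          ultimately have "A \<in> null_sets (Pn n z)" "UNIV - A \<in> null_sets (Pn n z')"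
            by blast+
          then show ?thesis
            unfolding mutually_singular_def by (intro bexI[of _ A]) (auto simp: A)
        qed
        ultimately show "\<exists>n. \<not> mutually_singular (Qm n z y) (Qm n z' y)" by blast
      qed
    qed
  qed
qed

section \<open>The set of full measure and the three conditions\<close>

lemma AE_coupled_law:
  assumes H: "H \<in> sets (borel \<Otimes>\<^sub>M borel \<Otimes>\<^sub>M path_space)"
    and ae: "AE y in obs_law \<P>. AE z' in \<mu> y. AE z in \<mu> y. (z, z', y) \<in> H"
  shows "sets (coupled_law \<mu> (obs_law \<P>)) = sets (borel \<Otimes>\<^sub>M borel \<Otimes>\<^sub>M path_space)"
    and "emeasure (coupled_law \<mu> (obs_law \<P>)) (space (coupled_law \<mu> (obs_law \<P>)) - H) = 0"
proof -
  let ?T = "borel \<Otimes>\<^sub>M borel \<Otimes>\<^sub>M path_space :: ('e \<times> 'e \<times> (int \<Rightarrow> 'f)) measure"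
  let ?k1 = "\<lambda>y z'. \<mu> y \<bind> (\<lambda>z. return ?T (z, z', y))"
  let ?k2 = "\<lambda>y. \<mu> y \<bind> ?k1 y"
  have k1: "(\<lambda>(y, z'). ?k1 y z') \<in> path_space \<Otimes>\<^sub>M borel \<rightarrow>\<^sub>M prob_algebra ?T"
    unfolding case_prod_beta' by measurable
  have k1y: "?k1 y \<in> borel \<rightarrow>\<^sub>M prob_algebra ?T" for y
    using measurable_compose[OF measurable_Pair1' k1, of y] by (simp add: space_PiM)
  have k2: "?k2 \<in> path_space \<rightarrow>\<^sub>M prob_algebra ?T"
    by (rule measurable_bind_prob_space2[OF mu k1])
  have k0: "(\<lambda>z. return ?T (z, z', y)) \<in> borel \<rightarrow>\<^sub>M prob_algebra ?T" for z' y
    by (rule measurable_compose[OF _ measurable_return_prob_space]) (auto intro!: measurable_Pair simp: space_PiM space_pair_measure)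
  show s: "sets (coupled_law \<mu> (obs_law \<P>)) = sets ?T"
    unfolding coupled_law_def by (rule sets_bind'[OF obs_law_in k2])
  have sp: "space (coupled_law \<mu> (obs_law \<P>)) = UNIV"
    using sets_eq_imp_space_eq[OF s] by (simp add: space_pair_measure space_PiM)
  have C: "UNIV - H \<in> sets ?T"
    using sets.compl_sets[OF H] by (simp add: space_pair_measure space_PiM)
  then have i: "indicator (UNIV - H) \<in> borel_measurable ?T" by simp
  have "emeasure (coupled_law \<mu> (obs_law \<P>)) (UNIV - H) = (\<integral>\<^sup>+p. indicator (UNIV - H) p \<partial>coupled_law \<mu> (obs_law \<P>))"
    using C by (simp add: s)
  also have "\<dots> = (\<integral>\<^sup>+y. \<integral>\<^sup>+z'. \<integral>\<^sup>+z. indicator (UNIV - H) (z, z', y) \<partial>\<mu> y \<partial>\<mu> y \<partial>obs_law \<P>)"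
    unfolding coupled_law_def nn_integral_bind_prob_algebra[OF obs_law_in k2 i]
      nn_integral_bind_prob_algebra[OF mu_in k1y i] nn_integral_bind_prob_algebra[OF mu_in k0 i]
    by (intro nn_integral_cong nn_integral_return i) (simp add: space_pair_measure space_PiM)
  also have "\<dots> = (\<integral>\<^sup>+y. 0 \<partial>obs_law \<P>)"
  proof (rule nn_integral_cong_AE, use ae in eventually_elim)
    case (elim y)
    then have "AE z' in \<mu> y. (\<integral>\<^sup>+z. indicator (UNIV - H) (z, z', y) \<partial>\<mu> y) = 0"
    proof eventually_elim
      case (elim z')
      then have "AE z in \<mu> y. indicator (UNIV - H) (z, z', y) = (0::ennreal)"
        by eventually_elim simp
      then have "(\<integral>\<^sup>+z. indicator (UNIV - H) (z, z', y) \<partial>\<mu> y) = (\<integral>\<^sup>+z. 0 \<partial>\<mu> y)"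
        by (rule nn_integral_cong_AE)
      then show ?case by simp
    qed
    then have "(\<integral>\<^sup>+z'. \<integral>\<^sup>+z. indicator (UNIV - H) (z, z', y) \<partial>\<mu> y \<partial>\<mu> y) = (\<integral>\<^sup>+z'. 0 \<partial>\<mu> y)"
      by (rule nn_integral_cong_AE)
    then show ?case by simp
  qed
  finally show "emeasure (coupled_law \<mu> (obs_law \<P>)) (space (coupled_law \<mu> (obs_law \<P>)) - H) = 0"
    by (simp add: sp)
qed

text \<open>The second condition asks for one measurable set that serves all tail events. Nested
  almost sure statements do not display their measurability, so they are recoded as the vanishing of
  the integrals \<open>V\<close>.\<close>

lemma ex_merging_set:
  obtains H where "H \<in> sets (borel \<Otimes>\<^sub>M borel \<Otimes>\<^sub>M path_space)"
    "AE y in obs_law \<P>. AE z' in \<mu> y. AE z in \<mu> y. (z, z', y) \<in> H"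
    "\<And>z z' y. (z, z', y) \<in> H \<Longrightarrow> merging PX z z' y = 0"
    "\<And>z z' y n. (z, z', y) \<in> H \<Longrightarrow> AE x in Qm n z y. AE x' in Qm n z' y. merging PX x x' (shift_path (int n) y) = 0"
proof
  let ?T = "borel \<Otimes>\<^sub>M borel \<Otimes>\<^sub>M path_space :: ('e \<times> 'e \<times> (int \<Rightarrow> 'f)) measure"
  define V where "V n z z' y = (\<integral>\<^sup>+x. \<integral>\<^sup>+x'. ennreal (merging PX x x' (shift_path (int n) y)) \<partial>Qm n z' y \<partial>Qm n z y)" for n z z' y
  define H where "H = {p \<in> space ?T. merging PX (fst p) (fst (snd p)) (snd (snd p)) = 0 \<and>
    (\<forall>n. V n (fst p) (fst (snd p)) (snd (snd p)) = 0)}"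
  have V: "(\<lambda>p. V n (fst p) (fst (snd p)) (snd (snd p))) \<in> borel_measurable ?T" for n
    unfolding V_def
  proof (rule measurable_nn_integral_kernel)
    show "(\<lambda>p. Qm n (fst p) (snd (snd p))) \<in> ?T \<rightarrow>\<^sub>M prob_algebra borel" by measurable
    show "(\<lambda>(p, x). \<integral>\<^sup>+x'. ennreal (merging PX x x' (shift_path (int n) (snd (snd p)))) \<partial>Qm n (fst (snd p)) (snd (snd p)))
      \<in> borel_measurable (?T \<Otimes>\<^sub>M borel)"
      unfolding case_prod_beta'
    proof (rule measurable_nn_integral_kernel)
      show "(\<lambda>q. Qm n (fst (snd (fst q))) (snd (snd (fst q)))) \<in> ?T \<Otimes>\<^sub>M borel \<rightarrow>\<^sub>M prob_algebra borel" by measurable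
      show "(\<lambda>(q, x'). ennreal (merging PX (snd q) x' (shift_path (int n) (snd (snd (fst q)))))) \<in> borel_measurable ((?T \<Otimes>\<^sub>M borel) \<Otimes>\<^sub>M borel)"
        by measurable
    qed
  qed
  have "Measurable.pred ?T (\<lambda>p. merging PX (fst p) (fst (snd p)) (snd (snd p)) = 0 \<and>
    (\<forall>n. V n (fst p) (fst (snd p)) (snd (snd p)) = 0))"
    using V by measurable
  then show "H \<in> sets ?T" unfolding H_def by (simp add: pred_def)
  have V0: "V n z z' y = 0 \<longleftrightarrow> (AE x in Qm n z y. AE x' in Qm n z' y. merging PX x x' (shift_path (int n) y) = 0)" for n z z' y
  proof -
    let ?y = "shift_path (int n) y"
    have y: "(\<lambda>_. ?y) \<in> M \<rightarrow>\<^sub>M path_space" for M :: "'z measure" by (simp add: space_PiM)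
    have 1: "(\<lambda>(x, x'). ennreal (merging PX x x' ?y)) \<in> borel_measurable (borel \<Otimes>\<^sub>M borel)"
      unfolding case_prod_beta' by (intro measurable_compose[OF measurable_merging measurable_ennreal] y) auto
    have 2: "(\<lambda>x. \<integral>\<^sup>+x'. ennreal (merging PX x x' ?y) \<partial>Qm n z' y) \<in> borel_measurable borel"
      by (rule measurable_nn_integral_kernel[OF _ 1]) simp
    have 3: "(\<lambda>x'. ennreal (merging PX x x' ?y)) \<in> borel_measurable borel" for x
      using measurable_compose[OF measurable_Pair1' 1, of x] by simp
    have eq: "(\<integral>\<^sup>+x'. ennreal (merging PX x x' ?y) \<partial>Qm n z' y) = 0 \<longleftrightarrow> (AE x' in Qm n z' y. merging PX x x' ?y = 0)" for x
    proof -
      have "(ennreal (merging PX x x' ?y) = 0) = (merging PX x x' ?y = 0)" for x'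
        using merging_bounds(1)[of x x' ?y] by (simp add: ennreal_eq_0_iff)
      then show ?thesis using 3 by (simp add: nn_integral_0_iff_AE measurable_cong_sets[OF sets_Qm refl])
    qed
    show ?thesis
      unfolding V_def using 2 by (simp add: nn_integral_0_iff_AE measurable_cong_sets[OF sets_Qm refl] eq)
  qed
  have H_iff: "(z, z', y) \<in> H \<longleftrightarrow> merging PX z z' y = 0 \<and> (\<forall>n. V n z z' y = 0)" for z z' y
    by (simp add: H_def space_pair_measure space_PiM)
  show "AE y in obs_law \<P>. AE z' in \<mu> y. AE z in \<mu> y. (z, z', y) \<in> H"
    unfolding H_iff V0 by (rule AE_merging_0[OF AE_not_mutually_singular])
  show "merging PX z z' y = 0" if "(z, z', y) \<in> H" for z z' y
    using that unfolding H_iff by simp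
  show "AE x in Qm n z y. AE x' in Qm n z' y. merging PX x x' (shift_path (int n) y) = 0" if "(z, z', y) \<in> H" for z z' y n
    using that unfolding H_iff V0 by simp
qed

lemma tv_dist_tendsto_0:
  assumes "merging PX z z' y = 0"
  shows "(\<lambda>n. tv_dist (Qm n z y) (Qm n z' y)) \<longlonglongrightarrow> 0"
proof (rule tendsto_sandwich[OF _ _ tendsto_const])
  show "\<forall>\<^sub>F n in sequentially. 0 \<le> tv_dist (Qm n z y) (Qm n z' y)"
    by (intro always_eventually allI order_trans[OF tvd_nonneg tvd_le_tv_dist]) auto
  show "\<forall>\<^sub>F n in sequentially. tv_dist (Qm n z y) (Qm n z' y) \<le> 2 * tvd (Qm n z y) (Qm n z' y)"
    by (intro always_eventually allI tv_dist_le_tvd) auto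
  show "(\<lambda>n. 2 * tvd (Qm n z y) (Qm n z' y)) \<longlonglongrightarrow> 0"
    using tendsto_mult_left[OF tendsto_merging[of z y z'], of 2] assms by simp
qed

lemma ex_not_mutually_singular:
  assumes "merging PX z z' y = 0"
  shows "\<exists>n. \<not> mutually_singular (Qm n z y) (Qm n z' y)"
proof -
  have "\<forall>\<^sub>F n in sequentially. tvd (Qm n z y) (Qm n z' y) < 1"
    using tendsto_merging[of z y z'] assms by (intro order_tendstoD(2)) auto
  then obtain n where "tvd (Qm n z y) (Qm n z' y) < 1"
    by (auto dest: eventually_happens)
  then show ?thesis
    using mutually_singular_imp_tvd_eq_1[of "Qm n z y" "Qm n z' y"] by (intro exI[of _ n]) auto
qed

end

theorem theorem3p4:
  fixes P :: "'e::polish_space \<Rightarrow> 'e measure"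
    and \<pi> :: "'e measure"
    and \<Phi> :: "'e \<Rightarrow> 'f::polish_space measure"
    and \<P> :: "((int \<Rightarrow> 'e) \<times> (int \<Rightarrow> 'f)) measure"
    and PX :: "'e \<Rightarrow> (int \<Rightarrow> 'f) \<Rightarrow> 'e measure"
    and \<mu> :: "(int \<Rightarrow> 'f) \<Rightarrow> 'e measure"
  assumes "P \<in> borel \<rightarrow>\<^sub>M prob_algebra borel"
    and "\<pi> \<in> space (prob_algebra borel)"
    and "invariant_law P \<pi>"
    and "\<Phi> \<in> borel \<rightarrow>\<^sub>M prob_algebra borel"
    and "stationary_hmm_law P \<pi> \<Phi> \<P>"
    and "conditional_signal \<P> PX \<mu>"
    and ergodicity: "ergodic P \<pi> \<Phi>"
    and nondegeneracy: "nondegenerate \<Phi>"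
  shows "(AE (z, z', y) in coupled_law \<mu> (obs_law \<P>).
            (\<lambda>n. tv_dist (distr (quenched_law PX z y) borel (X_at (int n)))
                         (distr (quenched_law PX z' y) borel (X_at (int n)))) \<longlonglongrightarrow> 0)
       \<and> (\<exists>H\<in>sets (coupled_law \<mu> (obs_law \<P>)).
            emeasure (coupled_law \<mu> (obs_law \<P>)) (space (coupled_law \<mu> (obs_law \<P>)) - H) = 0 \<and>
            (\<forall>(z, z', y)\<in>H. \<forall>A\<in>tail_X.
               measure (quenched_law PX z y) A = (measure (quenched_law PX z y) A)\<^sup>2 \<and>
               (measure (quenched_law PX z y) A)\<^sup>2 = measure (quenched_law PX z' y) A))
       \<and> (AE (z, z', y) in coupled_law \<mu> (obs_law \<P>).
            \<exists>n::nat. \<not> mutually_singular (distr (quenched_law PX z y) borel (X_at (int n)))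
                                         (distr (quenched_law PX z' y) borel (X_at (int n))))"
proof -
  interpret hmm: stationary_hmm P \<pi> \<Phi> \<P>
    using assms by unfold_locales
  obtain \<phi> g where \<phi>: "\<phi> \<in> space (prob_algebra borel)"
    and g [measurable]: "g \<in> borel_measurable (borel \<Otimes>\<^sub>M borel)" and g0: "\<And>z u. (0::real) < g (z, u)"
    and \<Phi>: "\<And>z A. A \<in> sets borel \<Longrightarrow> emeasure (\<Phi> z) A = (\<integral>\<^sup>+u. indicator A u * ennreal (g (z, u)) \<partial>\<phi>)"
    using nondegeneracy unfolding nondegenerate_def by blast
  have s\<phi>: "sets \<phi> = sets borel" using \<phi> by (simp add: space_prob_algebra)
  \<comment> \<open>Strict positivity makes the integrand nonzero exactly on \<open>A\<close>, so
    both laws have the same null sets.\<close>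
  have equiv: "emeasure (\<Phi> z) A = 0 \<longleftrightarrow> emeasure \<phi> A = 0" if A [measurable]: "A \<in> sets borel" for z A
  proof -
    have "(\<lambda>u. indicator A u * ennreal (g (z, u))) \<in> borel_measurable borel" by measurable
    then have "emeasure (\<Phi> z) A = 0 \<longleftrightarrow> emeasure \<phi> {u \<in> space \<phi>. indicator A u * ennreal (g (z, u)) \<noteq> 0} = 0"
      unfolding \<Phi>[OF A] by (intro nn_integral_0_iff) (simp add: measurable_cong_sets[OF s\<phi> refl])
    also have "{u \<in> space \<phi>. indicator A u * ennreal (g (z, u)) \<noteq> 0} = A"
      using g0 sets_eq_imp_space_eq[OF s\<phi>] by (auto simp: ennreal_eq_0_iff not_le split: split_indicator_asm)
    finally show ?thesis .
  qed
  \<comment> \<open>The signal part of the one-sided model is the plain chain, so ergodicity becomes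
    a statement about the iterates of \<open>P\<close>, on the scale of \<open>tvd\<close>.\<close>
  have "AE z in \<pi>. (\<lambda>n. tvd (iter_kernel n (\<lambda>_. P) z) \<pi>) \<longlonglongrightarrow> 0"
    using ergodicity unfolding ergodic_def hmm.distr_hmm_law_from
  proof eventually_elim
    case (elim z)
    have \<pi>: "prob_space \<pi>" "sets \<pi> = sets borel" using assms(2) by (auto simp: space_prob_algebra)
    have I: "prob_space (iter_kernel n (\<lambda>_. P) z)" "sets (iter_kernel n (\<lambda>_. P) z) = sets borel" for n
      using prob_kernelD[OF measurable_iter_kernel[OF assms(1)], of z n] by auto
    show ?case
    proof (rule tendsto_sandwich[OF _ _ tendsto_const elim])
      show "\<forall>\<^sub>F n in sequentially. 0 \<le> tvd (iter_kernel n (\<lambda>_. P) z) \<pi>"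
        using \<pi> I by (simp add: tvd_nonneg)
      show "\<forall>\<^sub>F n in sequentially. tvd (iter_kernel n (\<lambda>_. P) z) \<pi> \<le> tv_dist (iter_kernel n (\<lambda>_. P) z) \<pi>"
        using \<pi> I by (intro always_eventually allI tvd_le_tv_dist) auto
    qed
  qed
  then interpret ergodic_hmm P \<pi> \<Phi> \<P> PX \<mu> \<phi>
    using assms \<phi> equiv by unfold_locales
  \<comment> \<open>One set yields all three conditions: distances tend to 0 on it, hence drop below
    1 at some time, and tail events are trivial on it.\<close>
  obtain H where H: "H \<in> sets (borel \<Otimes>\<^sub>M borel \<Otimes>\<^sub>M path_space)"
    "AE y in obs_law \<P>. AE z' in \<mu> y. AE z in \<mu> y. (z, z', y) \<in> H"
    and m: "\<And>z z' y. (z, z', y) \<in> H \<Longrightarrow> merging PX z z' y = 0"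
    "\<And>z z' y n. (z, z', y) \<in> H \<Longrightarrow> AE x in Qm n z y. AE x' in Qm n z' y. merging PX x x' (shift_path (int n) y) = 0"
    by (rule ex_merging_set) blast
  let ?C = "coupled_law \<mu> (obs_law \<P>)"
  have H': "H \<in> sets ?C" "emeasure ?C (space ?C - H) = 0"
    using AE_coupled_law[OF H] H(1) by simp_all
  have AE_H: "AE p in ?C. p \<in> H"
    using H' by (intro AE_I[of _ _ "space ?C - H"]) auto
  have "AE (z, z', y) in ?C. (\<lambda>n. tv_dist (Qm n z y) (Qm n z' y)) \<longlonglongrightarrow> 0"
    using AE_H by eventually_elim (auto intro!: tv_dist_tendsto_0 m(1))
  moreover have "\<exists>H\<in>sets ?C. emeasure ?C (space ?C - H) = 0 \<and>
    (\<forall>(z, z', y)\<in>H. \<forall>A\<in>tail_X.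
      measure (quenched_law PX z y) A = (measure (quenched_law PX z y) A)\<^sup>2 \<and>
      (measure (quenched_law PX z y) A)\<^sup>2 = measure (quenched_law PX z' y) A)"
    using H' quenched_law_tail_zero_one[OF _ m] by (intro bexI[of _ H]) blast+
  moreover have "AE (z, z', y) in ?C. \<exists>n. \<not> mutually_singular (Qm n z y) (Qm n z' y)"
    using AE_H by eventually_elim (auto intro!: ex_not_mutually_singular m(1))
  ultimately show ?thesis
    unfolding distr_quenched_law_X_at by blast
qed

end
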